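(* There is a strict monoidal functor $\mathbf{A}\colon \mathcal{OS}(q,t)\to \mathcal{E}nd(\mathcal{B}(q,t))^{\mathrm{rev}}$ given on objects by $\uparrow,\downarrow\,\mapsto \mathbf{A}_1$, and on generating morphisms by the natural transformations $$\mathbf{A}(X_+),\mathbf{A}(X_-)\colon \mathbf{A}_2\to\mathbf{A}_2,\quad \mathbf{A}(c),\mathbf{A}(c')\colon \mathrm{id}\to\mathbf{A}_2,\quad \mathbf{A}(d),\mathbf{A}(d')\colon\mathbf{A}_2\to\mathrm{id}$$ whose components at $\mathsf{B}_r$, $r\in\mathbb{N}$, are $$\mathbf{A}(X_+)_{\mathsf{B}_r}=\sigma_{r+1},\qquad \mathbf{A}(X_-)_{\mathsf{B}_r}=\sigma_{r+1}^{-1},$$ $$\mathbf{A}(c)_{\mathsf{B}_r}=(\sigma_r^{-1}\sigma_{r-1}^{-1}\cdots\sigma_1^{-1})(\sigma_{r+1}\sigma_r\cdots\sigma_2)\,\mathrm{cup}_r,\qquad \mathbf{A}(c')_{\mathsf{B}_r}=q^{-1}t\,(\sigma_r\cdots\sigma_1)(\sigma_{r+1}^{-1}\cdots\sigma_2^{-1})\,\mathrm{cup}_r,$$ $$\mathbf{A}(d')_{\mathsf{B}_r}=\mathrm{cap}_r\,(\sigma_2^{-1}\cdots\sigma_{r+1}^{-1})(\sigma_1\cdots\sigma_r),\qquad \mathbf{A}(d)_{\mathsf{B}_r}=qt^{-1}\,\mathrm{cap}_r\,(\sigma_2\cdots\sigma_{r+1})(\sigma_1^{-1}\cdots\sigm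a_r^{-1}).$$
   Context: Let $k$ be a commutative ring and $q,t\in k^\times$ with $t-t^{-1}$ divisible by $z:=q-q^{-1}$; write $\delta=(t-t^{-1})/(q-q^{-1})$. $\mathbb{N}$ is the set of nonnegative integers. Composition is written right to left. **Oriented skein category.** $\mathcal{OS}(q,t)$ is the strict $k$-linear monoidal category generated by objects $\uparrow,\downarrow$ and morphisms $X_+,X_-\colon\uparrow\uparrow\to\uparrow\uparrow$, $c\colon\mathbf 1\to\downarrow\uparrow$, $d\colon\uparrow\downarrow\to\mathbf 1$, $c'\colon\mathbf 1\to\uparrow\downarrow$, $d'\colon\downarrow\uparrow\to\mathbf 1$ (tensor product of objects written as juxtaposition), subject to: $X_+X_-=1=X_-X_+$; $(X_+\otimes1_\uparrow)(1_\uparrow\otimes X_+)(X_+\otimes1_\uparrow)=(1_\uparrow\otimes X_+)(X_+\otimes1_\uparrow)(1_\uparrow\otimes X_+)$; $L_-R_+=1_{\uparrow\downarrow}$; $R_+L_-=1_{\downarrow\uparrow}$; $X_+-X_-=z\,1_{\uparrow\uparrow}$; $(d'\otimes1_\uparrow)(1_\downarrow\otimes X_+)(c\otimes1_\uparrow)=t1_\uparrow=(1_\uparrow\otimes d)(X_+\otimes1_\downarrow)(1_\uparrow\otimes c')$; $d\,c'=\delta1_{\mathbf 1}$; $(d\otimes1_\uparrow)(1_\uparrow\otimes c)=1_\uparrow$; $(1_\downarrow\otimes d)(c\otimes1_\downarrow)=1_\downarrow$. Here $R_+=(1_{\downarrow\uparrow}\otimes d)(1_\downarrow\otimes X_+\otimes1_\downarrow)(c\otimes1_{\uparrow\downarrow})\colon\uparrow\downarrow\to\downarrow\uparrow$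 and $L_-=(d'\otimes1_{\uparrow\downarrow})(1_\downarrow\otimes X_-\otimes1_\downarrow)(1_{\downarrow\uparrow}\otimes c')\colon\downarrow\uparrow\to\uparrow\downarrow$. **iquantum Brauer category.** $\mathcal{B}(q,t)$ is the $k$-linear category with objects $\mathsf{B}_r$, $r\in\mathbb{N}$, generating morphisms $\mathrm{cup}_r\colon\mathsf{B}_r\to\mathsf{B}_{r+2}$, $\mathrm{cap}_r\colon\mathsf{B}_{r+2}\to\mathsf{B}_r$ ($r\in\mathbb{N}$; the cup or cap is to the left of $r$ identity strands) and $\sigma_i,\sigma_i^{-1}\colon\mathsf{B}_n\to\mathsf{B}_n$ for $n\ge2$, $1\le i\le n-1$ (positive, resp. negative, crossing of strands $i,i+1$; $n$ is suppressed), with relations, whenever both sides make sense: $\sigma_i\sigma_i^{-1}=1=\sigma_i^{-1}\sigma_i$; $\sigma_i\sigma_{i+1}\sigma_i=\sigma_{i+1}\sigma_i\sigma_{i+1}$; $\sigma_i\sigma_j=\sigma_j\sigma_i$ for $|i-j|>1$; $\sigma_i-\sigma_i^{-1}=z$; $\mathrm{cup}_n\sigma_i=\sigma_{i+2}\mathrm{cup}_n$; $\mathrm{cap}_n\sigma_{i+2}=\sigma_i\mathrm{cap}_n$; $\mathrm{cap}_n\mathrm{cup}_n=\delta1_{\mathsf{B}_n}$; $\mathrm{cap}_n\sigma_1=q\,\mathrm{cap}_n$; $\sigma_1\mathrm{cup}_n=q\,\mathrm{cup}_n$; $\mathrm{cap}_n\sigma_2\mathrm{cup}_n=t1_{\mathsf{B}_n}$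 ($n\ge1$); $\mathrm{cap}_n\sigma_2\sigma_3\sigma_1^{-1}\sigma_2^{-1}\mathrm{cup}_n=\mathrm{cup}_{n-2}\mathrm{cap}_{n-2}$ ($n\ge2$); $\mathrm{cap}_n\mathrm{cap}_{n+2}\sigma_2^{-1}\sigma_3^{-1}\sigma_1\sigma_2=\mathrm{cap}_n\mathrm{cap}_{n+2}$; $\sigma_2^{-1}\sigma_1^{-1}\sigma_3\sigma_2\mathrm{cup}_{n+2}\mathrm{cup}_n=\mathrm{cup}_{n+2}\mathrm{cup}_n$. **Functors $\mathbf{A}_k$.** For $k\in\mathbb{N}$, $\mathbf{A}_k$ is the linear endofunctor of $\mathcal{B}(q,t)$ adding $k$ identity strands on the right: $\mathbf{A}_k(\mathsf{B}_r)=\mathsf{B}_{r+k}$, $\mathbf{A}_k(\mathrm{cup}_r)=\mathrm{cup}_{r+k}$, $\mathbf{A}_k(\mathrm{cap}_r)=\mathrm{cap}_{r+k}$, $\mathbf{A}_k(\sigma_i^{\pm1})=\sigma_i^{\pm1}$ (now on $k$ more strands). $\mathcal{E}nd(\mathcal{M})$ is the strict monoidal category of $k$-linear endofunctors of $\mathcal{M}$ under composition, and $\mathrm{rev}$ means that the tensor product is reversed. Thus such an $\mathbf{A}$ makes $\mathcal{B}(q,t)$ a strict right $\mathcal{OS}(q,t)$-module category via $M\otimes C:=\mathbf{A}(C)(M)$. Empty products are identities. *)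

theory Defs
  imports Main "HOL-Library.FuncSet"
begin

text \<open>
  Ground rings range over the sort \<open>{comm_ring, comm_monoid_mult}\<close>: commutative rings with 1.
  Unlike \<open>comm_ring_1\<close> it does not exclude the zero ring.
\<close>

section \<open>Linear categories, linear functors and natural transformations\<close>

record ('o, 'm, 'k) lincat =
  Obj :: "'o set"
  Hom :: "'o \<Rightarrow> 'o \<Rightarrow> 'm set"
  Idm :: "'o \<Rightarrow> 'm"
  Comp :: "'m \<Rightarrow> 'm \<Rightarrow> 'm"  (infixr "\<odot>\<index>" 70)
  Zerom :: "'o \<Rightarrow> 'o \<Rightarrow> 'm"
  Plus :: "'m \<Rightarrow> 'm \<Rightarrow> 'm"  (infixl "\<oplus>\<index>" 65)
  Scale :: "'k \<Rightarrow> 'm \<Rightarrow> 'm"  (infixr "\<star>\<index>" 75)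

definition Mor :: "('o, 'm, 'k, 'z) lincat_scheme \<Rightarrow> 'm set" where
  "Mor C = (\<Union>a\<in>Obj C. \<Union>b\<in>Obj C. Hom C a b)"

text \<open>Additive inverses in the hom-modules are the scalar multiples by \<open>- 1\<close>; they exist by
  \<open>scale_one\<close>, \<open>scale_add_left\<close> and \<open>scale_zero\<close>.\<close>

locale linear_category =
  fixes C :: "('o, 'm, 'k::{comm_ring, comm_monoid_mult}, 'z) lincat_scheme" (structure)
  assumes Hom_disjoint:
      "\<lbrakk>a \<in> Obj C; b \<in> Obj C; a' \<in> Obj C; b' \<in> Obj C; f \<in> Hom C a b; f \<in> Hom C a' b'\<rbrakk>
        \<Longrightarrow> a = a' \<and> b = b'"
    and Idm_closed: "a \<in> Obj C \<Longrightarrow> Idm C a \<in> Hom C a a"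
    and Comp_closed:
      "\<lbrakk>a \<in> Obj C; b \<in> Obj C; c \<in> Obj C; f \<in> Hom C a b; g \<in> Hom C b c\<rbrakk> \<Longrightarrow> g \<odot> f \<in> Hom C a c"
    and Comp_Idm: "\<lbrakk>a \<in> Obj C; b \<in> Obj C; f \<in> Hom C a b\<rbrakk> \<Longrightarrow> f \<odot> Idm C a = f"
    and Idm_Comp: "\<lbrakk>a \<in> Obj C; b \<in> Obj C; f \<in> Hom C a b\<rbrakk> \<Longrightarrow> Idm C b \<odot> f = f"
    and Comp_assoc:
      "\<lbrakk>a \<in> Obj C; b \<in> Obj C; c \<in> Obj C; d \<in> Obj C;
        f \<in> Hom C a b; g \<in> Hom C b c; h \<in> Hom C c d\<rbrakk> \<Longrightarrow> (h \<odot> g) \<odot> f = h \<odot> (g \<odot> f)"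
    and Zerom_closed: "\<lbrakk>a \<in> Obj C; b \<in> Obj C\<rbrakk> \<Longrightarrow> Zerom C a b \<in> Hom C a b"
    and Plus_closed:
      "\<lbrakk>a \<in> Obj C; b \<in> Obj C; f \<in> Hom C a b; g \<in> Hom C a b\<rbrakk> \<Longrightarrow> f \<oplus> g \<in> Hom C a b"
    and Scale_closed: "\<lbrakk>a \<in> Obj C; b \<in> Obj C; f \<in> Hom C a b\<rbrakk> \<Longrightarrow> x \<star> f \<in> Hom C a b"
    and Plus_commute:
      "\<lbrakk>a \<in> Obj C; b \<in> Obj C; f \<in> Hom C a b; g \<in> Hom C a b\<rbrakk> \<Longrightarrow> f \<oplus> g = g \<oplus> f"
    and Plus_assoc:
      "\<lbrakk>a \<in> Obj C; b \<in> Obj C; f \<in> Hom C a b; g \<in> Hom C a b; h \<in> Hom C a b\<rbrakk>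
        \<Longrightarrow> (f \<oplus> g) \<oplus> h = f \<oplus> (g \<oplus> h)"
    and Plus_Zerom: "\<lbrakk>a \<in> Obj C; b \<in> Obj C; f \<in> Hom C a b\<rbrakk> \<Longrightarrow> f \<oplus> Zerom C a b = f"
    and scale_zero: "\<lbrakk>a \<in> Obj C; b \<in> Obj C; f \<in> Hom C a b\<rbrakk> \<Longrightarrow> 0 \<star> f = Zerom C a b"
    and scale_one: "\<lbrakk>a \<in> Obj C; b \<in> Obj C; f \<in> Hom C a b\<rbrakk> \<Longrightarrow> 1 \<star> f = f"
    and scale_mult:
      "\<lbrakk>a \<in> Obj C; b \<in> Obj C; f \<in> Hom C a b\<rbrakk> \<Longrightarrow> (x * y) \<star> f = x \<star> (y \<star> f)"
    and scale_add_left: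
      "\<lbrakk>a \<in> Obj C; b \<in> Obj C; f \<in> Hom C a b\<rbrakk> \<Longrightarrow> (x + y) \<star> f = x \<star> f \<oplus> y \<star> f"
    and scale_add_right:
      "\<lbrakk>a \<in> Obj C; b \<in> Obj C; f \<in> Hom C a b; g \<in> Hom C a b\<rbrakk>
        \<Longrightarrow> x \<star> (f \<oplus> g) = x \<star> f \<oplus> x \<star> g"
    and Comp_Plus_left:
      "\<lbrakk>a \<in> Obj C; b \<in> Obj C; c \<in> Obj C; f \<in> Hom C a b; g \<in> Hom C b c; g' \<in> Hom C b c\<rbrakk>
        \<Longrightarrow> (g \<oplus> g') \<odot> f = (g \<odot> f) \<oplus> (g' \<odot> f)"
    and Comp_Plus_right:
      "\<lbrakk>a \<in> Obj C; b \<in> Obj C; c \<in> Obj C; f \<in> Hom C a b; f' \<in> Hom C a b; g \<in> Hom C b c\<rbrakk>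
        \<Longrightarrow> g \<odot> (f \<oplus> f') = (g \<odot> f) \<oplus> (g \<odot> f')"
    and Comp_Scale_left:
      "\<lbrakk>a \<in> Obj C; b \<in> Obj C; c \<in> Obj C; f \<in> Hom C a b; g \<in> Hom C b c\<rbrakk>
        \<Longrightarrow> (x \<star> g) \<odot> f = x \<star> (g \<odot> f)"
    and Comp_Scale_right:
      "\<lbrakk>a \<in> Obj C; b \<in> Obj C; c \<in> Obj C; f \<in> Hom C a b; g \<in> Hom C b c\<rbrakk>
        \<Longrightarrow> g \<odot> (x \<star> f) = x \<star> (g \<odot> f)"

record ('o, 'm, 'p, 'n) fctr =
  FObj :: "'o \<Rightarrow> 'p"
  FMor :: "'m \<Rightarrow> 'n"

locale linear_functor = C: linear_category C + D: linear_category D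
  for C :: "('o, 'm, 'k::{comm_ring, comm_monoid_mult}, 'y) lincat_scheme"
    and D :: "('p, 'n, 'k, 'z) lincat_scheme" +
  fixes F :: "('o, 'm, 'p, 'n) fctr"
  assumes FObj_closed: "a \<in> Obj C \<Longrightarrow> FObj F a \<in> Obj D"
    and FMor_closed:
      "\<lbrakk>a \<in> Obj C; b \<in> Obj C; f \<in> Hom C a b\<rbrakk> \<Longrightarrow> FMor F f \<in> Hom D (FObj F a) (FObj F b)"
    and FMor_Idm: "a \<in> Obj C \<Longrightarrow> FMor F (Idm C a) = Idm D (FObj F a)"
    and FMor_Comp:
      "\<lbrakk>a \<in> Obj C; b \<in> Obj C; c \<in> Obj C; f \<in> Hom C a b; g \<in> Hom C b c\<rbrakk>
        \<Longrightarrow> FMor F (g \<odot>\<^bsub>C\<^esub> f) = FMor F g \<odot>\<^bsub>D\<^esub> FMor F f"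
    and FMor_Plus:
      "\<lbrakk>a \<in> Obj C; b \<in> Obj C; f \<in> Hom C a b; g \<in> Hom C a b\<rbrakk>
        \<Longrightarrow> FMor F (f \<oplus>\<^bsub>C\<^esub> g) = FMor F f \<oplus>\<^bsub>D\<^esub> FMor F g"
    and FMor_Scale:
      "\<lbrakk>a \<in> Obj C; b \<in> Obj C; f \<in> Hom C a b\<rbrakk> \<Longrightarrow> FMor F (x \<star>\<^bsub>C\<^esub> f) = x \<star>\<^bsub>D\<^esub> FMor F f"

text \<open>Endofunctors and natural transformations are taken extensional (\<open>undefined\<close> off the
  category), so that HOL equality is equality of functors and of natural transformations.\<close>

definition endofunctor ::
    "('o, 'm, 'k::{comm_ring, comm_monoid_mult}, 'z) lincat_scheme \<Rightarrow> ('o, 'm, 'o, 'm) fctr \<Rightarrow> bool" where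
  "endofunctor C F \<longleftrightarrow>
     linear_functor C C F \<and> FObj F \<in> extensional (Obj C) \<and> FMor F \<in> extensional (Mor C)"

definition id_fctr :: "('o, 'm, 'k, 'z) lincat_scheme \<Rightarrow> ('o, 'm, 'o, 'm) fctr" where
  "id_fctr C = \<lparr>FObj = (\<lambda>a\<in>Obj C. a), FMor = (\<lambda>f\<in>Mor C. f)\<rparr>"

definition comp_fctr ::
    "('o, 'm, 'k, 'z) lincat_scheme \<Rightarrow> ('o, 'm, 'o, 'm) fctr \<Rightarrow> ('o, 'm, 'o, 'm) fctr
      \<Rightarrow> ('o, 'm, 'o, 'm) fctr" where
  "comp_fctr C F G =
     \<lparr>FObj = (\<lambda>a\<in>Obj C. FObj F (FObj G a)), FMor = (\<lambda>f\<in>Mor C. FMor F (FMor G f))\<rparr>"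

record ('o, 'm) nattrans =
  NSrc :: "('o, 'm, 'o, 'm) fctr"
  NTgt :: "('o, 'm, 'o, 'm) fctr"
  At :: "'o \<Rightarrow> 'm"

definition natural :: "('o, 'm, 'k, 'z) lincat_scheme \<Rightarrow> ('o, 'm) nattrans \<Rightarrow> bool" where
  "natural C \<eta> \<longleftrightarrow>
     (\<forall>a\<in>Obj C. At \<eta> a \<in> Hom C (FObj (NSrc \<eta>) a) (FObj (NTgt \<eta>) a)) \<and>
     (\<forall>a\<in>Obj C. \<forall>b\<in>Obj C. \<forall>f\<in>Hom C a b.
        At \<eta> b \<odot>\<^bsub>C\<^esub> FMor (NSrc \<eta>) f = FMor (NTgt \<eta>) f \<odot>\<^bsub>C\<^esub> At \<eta> a)"

section \<open>Strict monoidal linear categories and functors\<close>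

record ('o, 'm, 'k) moncat = "('o, 'm, 'k) lincat" +
  Unit :: "'o"
  TObj :: "'o \<Rightarrow> 'o \<Rightarrow> 'o"  (infixr "\<boxtimes>\<index>" 72)
  TMor :: "'m \<Rightarrow> 'm \<Rightarrow> 'm"  (infixr "\<otimes>\<index>" 72)

locale strict_monoidal_category = linear_category C
  for C :: "('o, 'm, 'k::{comm_ring, comm_monoid_mult}, 'z) moncat_scheme" (structure) +
  assumes Unit_closed: "Unit C \<in> Obj C"
    and TObj_closed: "\<lbrakk>a \<in> Obj C; b \<in> Obj C\<rbrakk> \<Longrightarrow> a \<boxtimes> b \<in> Obj C"
    and TObj_assoc: "\<lbrakk>a \<in> Obj C; b \<in> Obj C; c \<in> Obj C\<rbrakk> \<Longrightarrow> (a \<boxtimes> b) \<boxtimes> c = a \<boxtimes> (b \<boxtimes> c)"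
    and Unit_TObj: "a \<in> Obj C \<Longrightarrow> Unit C \<boxtimes> a = a"
    and TObj_Unit: "a \<in> Obj C \<Longrightarrow> a \<boxtimes> Unit C = a"
    and TMor_closed:
      "\<lbrakk>a \<in> Obj C; b \<in> Obj C; c \<in> Obj C; d \<in> Obj C; f \<in> Hom C a b; g \<in> Hom C c d\<rbrakk>
        \<Longrightarrow> f \<otimes> g \<in> Hom C (a \<boxtimes> c) (b \<boxtimes> d)"
    and TMor_Idm: "\<lbrakk>a \<in> Obj C; b \<in> Obj C\<rbrakk> \<Longrightarrow> Idm C a \<otimes> Idm C b = Idm C (a \<boxtimes> b)"
    and interchange:
      "\<lbrakk>a \<in> Obj C; b \<in> Obj C; c \<in> Obj C; a' \<in> Obj C; b' \<in> Obj C; c' \<in> Obj C;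
        f \<in> Hom C a b; g \<in> Hom C b c; f' \<in> Hom C a' b'; g' \<in> Hom C b' c'\<rbrakk>
        \<Longrightarrow> (g \<odot> f) \<otimes> (g' \<odot> f') = (g \<otimes> g') \<odot> (f \<otimes> f')"
    and TMor_assoc:
      "\<lbrakk>a \<in> Obj C; b \<in> Obj C; c \<in> Obj C; a' \<in> Obj C; b' \<in> Obj C; c' \<in> Obj C;
        f \<in> Hom C a a'; g \<in> Hom C b b'; h \<in> Hom C c c'\<rbrakk> \<Longrightarrow> (f \<otimes> g) \<otimes> h = f \<otimes> (g \<otimes> h)"
    and Unit_TMor: "\<lbrakk>a \<in> Obj C; b \<in> Obj C; f \<in> Hom C a b\<rbrakk> \<Longrightarrow> Idm C (Unit C) \<otimes> f = f"
    and TMor_Unit: "\<lbrakk>a \<in> Obj C; b \<in> Obj C; f \<in> Hom C a b\<rbrakk> \<Longrightarrow> f \<otimes> Idm C (Unit C) = f"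
    and TMor_Plus_left:
      "\<lbrakk>a \<in> Obj C; b \<in> Obj C; c \<in> Obj C; d \<in> Obj C;
        f \<in> Hom C a b; f' \<in> Hom C a b; g \<in> Hom C c d\<rbrakk> \<Longrightarrow> (f \<oplus> f') \<otimes> g = (f \<otimes> g) \<oplus> (f' \<otimes> g)"
    and TMor_Plus_right:
      "\<lbrakk>a \<in> Obj C; b \<in> Obj C; c \<in> Obj C; d \<in> Obj C;
        f \<in> Hom C a b; g \<in> Hom C c d; g' \<in> Hom C c d\<rbrakk> \<Longrightarrow> f \<otimes> (g \<oplus> g') = (f \<otimes> g) \<oplus> (f \<otimes> g')"
    and TMor_Scale_left:
      "\<lbrakk>a \<in> Obj C; b \<in> Obj C; c \<in> Obj C; d \<in> Obj C; f \<in> Hom C a b; g \<in> Hom C c d\<rbrakk>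
        \<Longrightarrow> (x \<star> f) \<otimes> g = x \<star> (f \<otimes> g)"
    and TMor_Scale_right:
      "\<lbrakk>a \<in> Obj C; b \<in> Obj C; c \<in> Obj C; d \<in> Obj C; f \<in> Hom C a b; g \<in> Hom C c d\<rbrakk>
        \<Longrightarrow> f \<otimes> (x \<star> g) = x \<star> (f \<otimes> g)"

locale strict_monoidal_functor =
  C: strict_monoidal_category C + D: strict_monoidal_category D + linear_functor C D F
  for C :: "('o, 'm, 'k::{comm_ring, comm_monoid_mult}, 'y) moncat_scheme"
    and D :: "('p, 'n, 'k, 'z) moncat_scheme"
    and F :: "('o, 'm, 'p, 'n) fctr" +
  assumes FObj_Unit: "FObj F (Unit C) = Unit D"
    and FObj_TObj:
      "\<lbrakk>a \<in> Obj C; b \<in> Obj C\<rbrakk> \<Longrightarrow> FObj F (a \<boxtimes>\<^bsub>C\<^esub> b) = FObj F a \<boxtimes>\<^bsub>D\<^esub> FObj F b"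
    and FMor_TMor:
      "\<lbrakk>a \<in> Obj C; b \<in> Obj C; c \<in> Obj C; d \<in> Obj C; f \<in> Hom C a b; g \<in> Hom C c d\<rbrakk>
        \<Longrightarrow> FMor F (f \<otimes>\<^bsub>C\<^esub> g) = FMor F f \<otimes>\<^bsub>D\<^esub> FMor F g"

definition rev_tensor ::
    "('o, 'm, 'k) moncat \<Rightarrow> ('o, 'm, 'k) moncat" where
  "rev_tensor C = C\<lparr>TObj := (\<lambda>a b. b \<boxtimes>\<^bsub>C\<^esub> a), TMor := (\<lambda>f g. g \<otimes>\<^bsub>C\<^esub> f)\<rparr>"

text \<open>The tensor product of endofunctors is composition, that of natural transformations is
  horizontal composition:
  \<open>\<alpha> : F \<Rightarrow> F'\<close> and \<open>\<beta> : G \<Rightarrow> G'\<close> give \<open>\<alpha>\<^bsub>G' a\<^esub> F(\<beta>\<^bsub>a\<^esub>) : F (G a) \<rightarrow> F' (G' a)\<close>.\<close>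

definition End_cat ::
    "('o, 'm, 'k::{comm_ring, comm_monoid_mult}, 'z) lincat_scheme
      \<Rightarrow> (('o, 'm, 'o, 'm) fctr, ('o, 'm) nattrans, 'k) moncat" where
  "End_cat C =
    \<lparr>Obj = {F. endofunctor C F},
     Hom = (\<lambda>F G. {\<eta>. natural C \<eta> \<and> NSrc \<eta> = F \<and> NTgt \<eta> = G \<and> At \<eta> \<in> extensional (Obj C)}),
     Idm = (\<lambda>F. \<lparr>NSrc = F, NTgt = F, At = (\<lambda>a\<in>Obj C. Idm C (FObj F a))\<rparr>),
     Comp = (\<lambda>\<theta> \<eta>. \<lparr>NSrc = NSrc \<eta>, NTgt = NTgt \<theta>, At = (\<lambda>a\<in>Obj C. At \<theta> a \<odot>\<^bsub>C\<^esub> At \<eta> a)\<rparr>),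
     Zerom = (\<lambda>F G. \<lparr>NSrc = F, NTgt = G, At = (\<lambda>a\<in>Obj C. Zerom C (FObj F a) (FObj G a))\<rparr>),
     Plus = (\<lambda>\<eta> \<theta>. \<lparr>NSrc = NSrc \<eta>, NTgt = NTgt \<eta>, At = (\<lambda>a\<in>Obj C. At \<eta> a \<oplus>\<^bsub>C\<^esub> At \<theta> a)\<rparr>),
     Scale = (\<lambda>x \<eta>. \<lparr>NSrc = NSrc \<eta>, NTgt = NTgt \<eta>, At = (\<lambda>a\<in>Obj C. x \<star>\<^bsub>C\<^esub> At \<eta> a)\<rparr>),
     Unit = id_fctr C,
     TObj = comp_fctr C,
     TMor = (\<lambda>\<alpha> \<beta>.
       \<lparr>NSrc = comp_fctr C (NSrc \<alpha>) (NSrc \<beta>),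
        NTgt = comp_fctr C (NTgt \<alpha>) (NTgt \<beta>),
        At = (\<lambda>a\<in>Obj C. At \<alpha> (FObj (NTgt \<beta>) a) \<odot>\<^bsub>C\<^esub> FMor (NSrc \<alpha>) (At \<beta> a))\<rparr>)\<rparr>"

section \<open>Linear categories given by generators and relations\<close>

record ('o, 'g, 't) presentation =
  Gens :: "'g set"
  GSrc :: "'g \<Rightarrow> 'o"
  GTgt :: "'g \<Rightarrow> 'o"
  Rels :: "'t \<Rightarrow> 't \<Rightarrow> bool"

datatype ('o, 'g, 'k) lterm =
    LId 'o
  | LGen 'g
  | LComp "('o, 'g, 'k) lterm" "('o, 'g, 'k) lterm"  (infixr "\<cdot>" 70)
  | LZero 'o 'o
  | LPlus "('o, 'g, 'k) lterm" "('o, 'g, 'k) lterm"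
  | LScale 'k "('o, 'g, 'k) lterm"

type_synonym ('o, 'g, 'k) lpresentation = "('o, 'g, ('o, 'g, 'k) lterm) presentation"

primrec lsrc :: "('o, 'g, 'k) lpresentation \<Rightarrow> ('o, 'g, 'k) lterm \<Rightarrow> 'o" where
  "lsrc P (LId a) = a"
| "lsrc P (LGen g) = GSrc P g"
| "lsrc P (u \<cdot> v) = lsrc P v"
| "lsrc P (LZero a b) = a"
| "lsrc P (LPlus u v) = lsrc P u"
| "lsrc P (LScale x u) = lsrc P u"

primrec ltgt :: "('o, 'g, 'k) lpresentation \<Rightarrow> ('o, 'g, 'k) lterm \<Rightarrow> 'o" where
  "ltgt P (LId a) = a"
| "ltgt P (LGen g) = GTgt P g"
| "ltgt P (u \<cdot> v) = ltgt P u"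
| "ltgt P (LZero a b) = b"
| "ltgt P (LPlus u v) = ltgt P u"
| "ltgt P (LScale x u) = ltgt P u"

primrec lwf :: "('o, 'g, 'k) lpresentation \<Rightarrow> ('o, 'g, 'k) lterm \<Rightarrow> bool" where
  "lwf P (LId a) \<longleftrightarrow> True"
| "lwf P (LGen g) \<longleftrightarrow> g \<in> Gens P"
| "lwf P (u \<cdot> v) \<longleftrightarrow> lwf P u \<and> lwf P v \<and> lsrc P u = ltgt P v"
| "lwf P (LZero a b) \<longleftrightarrow> True"
| "lwf P (LPlus u v) \<longleftrightarrow> lwf P u \<and> lwf P v \<and> lsrc P u = lsrc P v \<and> ltgt P u = ltgt P v"
| "lwf P (LScale x u) \<longleftrightarrow> lwf P u"

definition lhom :: "('o, 'g, 'k) lpresentation \<Rightarrow> 'o \<Rightarrow> 'o \<Rightarrow> ('o, 'g, 'k) lterm set" where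
  "lhom P a b = {u. lwf P u \<and> lsrc P u = a \<and> ltgt P u = b}"

text \<open>The smallest congruence on well-formed terms that contains the relations and the axioms of
  a linear category. A relation is imposed only if both sides are well-formed and parallel
  (``whenever both sides make sense'').\<close>

inductive leq ::
    "('o, 'g, 'k::{comm_ring, comm_monoid_mult}) lpresentation
      \<Rightarrow> ('o, 'g, 'k) lterm \<Rightarrow> ('o, 'g, 'k) lterm \<Rightarrow> bool"
  for P where
  leq_rel: "\<lbrakk>Rels P u v; u \<in> lhom P a b; v \<in> lhom P a b\<rbrakk> \<Longrightarrow> leq P u v"
| leq_refl: "lwf P u \<Longrightarrow> leq P u u"
| leq_sym: "leq P u v \<Longrightarrow> leq P v u"
| leq_trans: "\<lbrakk>leq P u v; leq P v w\<rbrakk> \<Longrightarrow> leq P u w"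
| leq_Comp: "\<lbrakk>leq P u u'; leq P v v'; lwf P (u \<cdot> v)\<rbrakk> \<Longrightarrow> leq P (u \<cdot> v) (u' \<cdot> v')"
| leq_Plus: "\<lbrakk>leq P u u'; leq P v v'; lwf P (LPlus u v)\<rbrakk> \<Longrightarrow> leq P (LPlus u v) (LPlus u' v')"
| leq_Scale: "leq P u u' \<Longrightarrow> leq P (LScale x u) (LScale x u')"
| leq_Comp_Id: "u \<in> lhom P a b \<Longrightarrow> leq P (u \<cdot> LId a) u"
| leq_Id_Comp: "u \<in> lhom P a b \<Longrightarrow> leq P (LId b \<cdot> u) u"
| leq_Comp_assoc: "lwf P ((u \<cdot> v) \<cdot> w) \<Longrightarrow> leq P ((u \<cdot> v) \<cdot> w) (u \<cdot> (v \<cdot> w))"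
| leq_Plus_commute: "lwf P (LPlus u v) \<Longrightarrow> leq P (LPlus u v) (LPlus v u)"
| leq_Plus_assoc:
    "lwf P (LPlus (LPlus u v) w) \<Longrightarrow> leq P (LPlus (LPlus u v) w) (LPlus u (LPlus v w))"
| leq_Plus_Zero: "u \<in> lhom P a b \<Longrightarrow> leq P (LPlus u (LZero a b)) u"
| leq_Scale_zero: "u \<in> lhom P a b \<Longrightarrow> leq P (LScale 0 u) (LZero a b)"
| leq_Scale_one: "lwf P u \<Longrightarrow> leq P (LScale 1 u) u"
| leq_Scale_mult: "lwf P u \<Longrightarrow> leq P (LScale (x * y) u) (LScale x (LScale y u))"
| leq_Scale_add_left:
    "lwf P u \<Longrightarrow> leq P (LScale (x + y) u) (LPlus (LScale x u) (LScale y u))"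
| leq_Scale_add_right:
    "lwf P (LPlus u v) \<Longrightarrow> leq P (LScale x (LPlus u v)) (LPlus (LScale x u) (LScale x v))"
| leq_Comp_Plus_left:
    "lwf P (LPlus u u' \<cdot> v) \<Longrightarrow> leq P (LPlus u u' \<cdot> v) (LPlus (u \<cdot> v) (u' \<cdot> v))"
| leq_Comp_Plus_right:
    "lwf P (u \<cdot> LPlus v v') \<Longrightarrow> leq P (u \<cdot> LPlus v v') (LPlus (u \<cdot> v) (u \<cdot> v'))"
| leq_Comp_Scale_left: "lwf P (u \<cdot> v) \<Longrightarrow> leq P (LScale x u \<cdot> v) (LScale x (u \<cdot> v))"
| leq_Comp_Scale_right: "lwf P (u \<cdot> v) \<Longrightarrow> leq P (u \<cdot> LScale x v) (LScale x (u \<cdot> v))"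

definition lcls ::
    "('o, 'g, 'k::{comm_ring, comm_monoid_mult}) lpresentation
      \<Rightarrow> ('o, 'g, 'k) lterm \<Rightarrow> ('o, 'g, 'k) lterm set" where
  "lcls P u = {v. leq P u v}"

definition rep :: "'a set \<Rightarrow> 'a" where
  "rep X = (SOME u. u \<in> X)"

definition presented_lincat ::
    "('o, 'g, 'k::{comm_ring, comm_monoid_mult}) lpresentation
      \<Rightarrow> ('o, ('o, 'g, 'k) lterm set, 'k) lincat" where
  "presented_lincat P =
    \<lparr>Obj = UNIV,
     Hom = (\<lambda>a b. lcls P ` lhom P a b),
     Idm = (\<lambda>a. lcls P (LId a)),
     Comp = (\<lambda>X Y. lcls P (rep X \<cdot> rep Y)),
     Zerom = (\<lambda>a b. lcls P (LZero a b)),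
     Plus = (\<lambda>X Y. lcls P (LPlus (rep X) (rep Y))),
     Scale = (\<lambda>x X. lcls P (LScale x (rep X)))\<rparr>"

section \<open>Strict monoidal linear categories given by generators and relations\<close>

text \<open>Objects are words in the generating objects.\<close>

datatype ('a, 'g, 'k) mterm =
    MId "'a list"
  | MGen 'g
  | MComp "('a, 'g, 'k) mterm" "('a, 'g, 'k) mterm"  (infixr "\<bullet>" 70)
  | MTens "('a, 'g, 'k) mterm" "('a, 'g, 'k) mterm"  (infixr "\<otimes>\<^sub>m" 75)
  | MZero "'a list" "'a list"
  | MPlus "('a, 'g, 'k) mterm" "('a, 'g, 'k) mterm"
  | MScale 'k "('a, 'g, 'k) mterm"

type_synonym ('a, 'g, 'k) mpresentation = "('a list, 'g, ('a, 'g, 'k) mterm) presentation"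

primrec msrc :: "('a, 'g, 'k) mpresentation \<Rightarrow> ('a, 'g, 'k) mterm \<Rightarrow> 'a list" where
  "msrc P (MId a) = a"
| "msrc P (MGen g) = GSrc P g"
| "msrc P (u \<bullet> v) = msrc P v"
| "msrc P (u \<otimes>\<^sub>m v) = msrc P u @ msrc P v"
| "msrc P (MZero a b) = a"
| "msrc P (MPlus u v) = msrc P u"
| "msrc P (MScale x u) = msrc P u"

primrec mtgt :: "('a, 'g, 'k) mpresentation \<Rightarrow> ('a, 'g, 'k) mterm \<Rightarrow> 'a list" where
  "mtgt P (MId a) = a"
| "mtgt P (MGen g) = GTgt P g"
| "mtgt P (u \<bullet> v) = mtgt P u"
| "mtgt P (u \<otimes>\<^sub>m v) = mtgt P u @ mtgt P v"
| "mtgt P (MZero a b) = b"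
| "mtgt P (MPlus u v) = mtgt P u"
| "mtgt P (MScale x u) = mtgt P u"

primrec mwf :: "('a, 'g, 'k) mpresentation \<Rightarrow> ('a, 'g, 'k) mterm \<Rightarrow> bool" where
  "mwf P (MId a) \<longleftrightarrow> True"
| "mwf P (MGen g) \<longleftrightarrow> g \<in> Gens P"
| "mwf P (u \<bullet> v) \<longleftrightarrow> mwf P u \<and> mwf P v \<and> msrc P u = mtgt P v"
| "mwf P (u \<otimes>\<^sub>m v) \<longleftrightarrow> mwf P u \<and> mwf P v"
| "mwf P (MZero a b) \<longleftrightarrow> True"
| "mwf P (MPlus u v) \<longleftrightarrow> mwf P u \<and> mwf P v \<and> msrc P u = msrc P v \<and> mtgt P u = mtgt P v"
| "mwf P (MScale x u) \<longleftrightarrow> mwf P u"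

definition mhom ::
    "('a, 'g, 'k) mpresentation \<Rightarrow> 'a list \<Rightarrow> 'a list \<Rightarrow> ('a, 'g, 'k) mterm set" where
  "mhom P a b = {u. mwf P u \<and> msrc P u = a \<and> mtgt P u = b}"

inductive meq ::
    "('a, 'g, 'k::{comm_ring, comm_monoid_mult}) mpresentation
      \<Rightarrow> ('a, 'g, 'k) mterm \<Rightarrow> ('a, 'g, 'k) mterm \<Rightarrow> bool"
  for P where
  meq_rel: "\<lbrakk>Rels P u v; u \<in> mhom P a b; v \<in> mhom P a b\<rbrakk> \<Longrightarrow> meq P u v"
| meq_refl: "mwf P u \<Longrightarrow> meq P u u"
| meq_sym: "meq P u v \<Longrightarrow> meq P v u"
| meq_trans: "\<lbrakk>meq P u v; meq P v w\<rbrakk> \<Longrightarrow> meq P u w"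
| meq_Comp: "\<lbrakk>meq P u u'; meq P v v'; mwf P (u \<bullet> v)\<rbrakk> \<Longrightarrow> meq P (u \<bullet> v) (u' \<bullet> v')"
| meq_Tens: "\<lbrakk>meq P u u'; meq P v v'\<rbrakk> \<Longrightarrow> meq P (u \<otimes>\<^sub>m v) (u' \<otimes>\<^sub>m v')"
| meq_Plus: "\<lbrakk>meq P u u'; meq P v v'; mwf P (MPlus u v)\<rbrakk> \<Longrightarrow> meq P (MPlus u v) (MPlus u' v')"
| meq_Scale: "meq P u u' \<Longrightarrow> meq P (MScale x u) (MScale x u')"
| meq_Comp_Id: "u \<in> mhom P a b \<Longrightarrow> meq P (u \<bullet> MId a) u"
| meq_Id_Comp: "u \<in> mhom P a b \<Longrightarrow> meq P (MId b \<bullet> u) u"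
| meq_Comp_assoc: "mwf P ((u \<bullet> v) \<bullet> w) \<Longrightarrow> meq P ((u \<bullet> v) \<bullet> w) (u \<bullet> (v \<bullet> w))"
| meq_Plus_commute: "mwf P (MPlus u v) \<Longrightarrow> meq P (MPlus u v) (MPlus v u)"
| meq_Plus_assoc:
    "mwf P (MPlus (MPlus u v) w) \<Longrightarrow> meq P (MPlus (MPlus u v) w) (MPlus u (MPlus v w))"
| meq_Plus_Zero: "u \<in> mhom P a b \<Longrightarrow> meq P (MPlus u (MZero a b)) u"
| meq_Scale_zero: "u \<in> mhom P a b \<Longrightarrow> meq P (MScale 0 u) (MZero a b)"
| meq_Scale_one: "mwf P u \<Longrightarrow> meq P (MScale 1 u) u"
| meq_Scale_mult: "mwf P u \<Longrightarrow> meq P (MScale (x * y) u) (MScale x (MScale y u))"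
| meq_Scale_add_left:
    "mwf P u \<Longrightarrow> meq P (MScale (x + y) u) (MPlus (MScale x u) (MScale y u))"
| meq_Scale_add_right:
    "mwf P (MPlus u v) \<Longrightarrow> meq P (MScale x (MPlus u v)) (MPlus (MScale x u) (MScale x v))"
| meq_Comp_Plus_left:
    "mwf P (MPlus u u' \<bullet> v) \<Longrightarrow> meq P (MPlus u u' \<bullet> v) (MPlus (u \<bullet> v) (u' \<bullet> v))"
| meq_Comp_Plus_right:
    "mwf P (u \<bullet> MPlus v v') \<Longrightarrow> meq P (u \<bullet> MPlus v v') (MPlus (u \<bullet> v) (u \<bullet> v'))"
| meq_Comp_Scale_left: "mwf P (u \<bullet> v) \<Longrightarrow> meq P (MScale x u \<bullet> v) (MScale x (u \<bullet> v))"
| meq_Comp_Scale_right: "mwf P (u \<bullet> v) \<Longrightarrow> meq P (u \<bullet> MScale x v) (MScale x (u \<bullet> v))"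
| meq_Tens_Id: "meq P (MId a \<otimes>\<^sub>m MId b) (MId (a @ b))"
| meq_interchange:
    "\<lbrakk>mwf P (u \<bullet> v); mwf P (u' \<bullet> v')\<rbrakk>
      \<Longrightarrow> meq P ((u \<bullet> v) \<otimes>\<^sub>m (u' \<bullet> v')) ((u \<otimes>\<^sub>m u') \<bullet> (v \<otimes>\<^sub>m v'))"
| meq_Tens_assoc:
    "\<lbrakk>mwf P u; mwf P v; mwf P w\<rbrakk> \<Longrightarrow> meq P ((u \<otimes>\<^sub>m v) \<otimes>\<^sub>m w) (u \<otimes>\<^sub>m (v \<otimes>\<^sub>m w))"
| meq_Unit_Tens: "mwf P u \<Longrightarrow> meq P (MId [] \<otimes>\<^sub>m u) u"
| meq_Tens_Unit: "mwf P u \<Longrightarrow> meq P (u \<otimes>\<^sub>m MId []) u"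
| meq_Tens_Plus_left:
    "\<lbrakk>mwf P (MPlus u u'); mwf P v\<rbrakk> \<Longrightarrow> meq P (MPlus u u' \<otimes>\<^sub>m v) (MPlus (u \<otimes>\<^sub>m v) (u' \<otimes>\<^sub>m v))"
| meq_Tens_Plus_right:
    "\<lbrakk>mwf P u; mwf P (MPlus v v')\<rbrakk> \<Longrightarrow> meq P (u \<otimes>\<^sub>m MPlus v v') (MPlus (u \<otimes>\<^sub>m v) (u \<otimes>\<^sub>m v'))"
| meq_Tens_Scale_left:
    "\<lbrakk>mwf P u; mwf P v\<rbrakk> \<Longrightarrow> meq P (MScale x u \<otimes>\<^sub>m v) (MScale x (u \<otimes>\<^sub>m v))"
| meq_Tens_Scale_right:
    "\<lbrakk>mwf P u; mwf P v\<rbrakk> \<Longrightarrow> meq P (u \<otimes>\<^sub>m MScale x v) (MScale x (u \<otimes>\<^sub>m v))"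

definition mcls ::
    "('a, 'g, 'k::{comm_ring, comm_monoid_mult}) mpresentation
      \<Rightarrow> ('a, 'g, 'k) mterm \<Rightarrow> ('a, 'g, 'k) mterm set" where
  "mcls P u = {v. meq P u v}"

definition presented_moncat ::
    "('a, 'g, 'k::{comm_ring, comm_monoid_mult}) mpresentation
      \<Rightarrow> ('a list, ('a, 'g, 'k) mterm set, 'k) moncat" where
  "presented_moncat P =
    \<lparr>Obj = UNIV,
     Hom = (\<lambda>a b. mcls P ` mhom P a b),
     Idm = (\<lambda>a. mcls P (MId a)),
     Comp = (\<lambda>X Y. mcls P (rep X \<bullet> rep Y)),
     Zerom = (\<lambda>a b. mcls P (MZero a b)),
     Plus = (\<lambda>X Y. mcls P (MPlus (rep X) (rep Y))),
     Scale = (\<lambda>x X. mcls P (MScale x (rep X))),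
     Unit = [],
     TObj = (@),
     TMor = (\<lambda>X Y. mcls P (rep X \<otimes>\<^sub>m rep Y))\<rparr>"

section \<open>The oriented skein category\<close>

definition unit_inv :: "'k::{comm_ring, comm_monoid_mult} \<Rightarrow> 'k" where
  "unit_inv u = (THE v. u * v = 1)"

datatype arrow = Up (\<open>\<up>\<close>) | Down (\<open>\<down>\<close>)

text \<open>\<open>CupDU = c\<close>, \<open>CapUD = d\<close>, \<open>CupUD = c'\<close>, \<open>CapDU = d'\<close>.\<close>

datatype os_gen = Xpos | Xneg | CupDU | CapUD | CupUD | CapDU

fun os_src :: "os_gen \<Rightarrow> arrow list" where
  "os_src Xpos = [\<up>, \<up>]"
| "os_src Xneg = [\<up>, \<up>]"
| "os_src CupDU = []"
| "os_src CapUD = [\<up>, \<down>]"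
| "os_src CupUD = []"
| "os_src CapDU = [\<down>, \<up>]"

fun os_tgt :: "os_gen \<Rightarrow> arrow list" where
  "os_tgt Xpos = [\<up>, \<up>]"
| "os_tgt Xneg = [\<up>, \<up>]"
| "os_tgt CupDU = [\<down>, \<up>]"
| "os_tgt CapUD = []"
| "os_tgt CupUD = [\<up>, \<down>]"
| "os_tgt CapDU = []"

type_synonym 'k os_term = "(arrow, os_gen, 'k) mterm"

definition Rpos :: "'k os_term" where
  "Rpos = (MId [\<down>, \<up>] \<otimes>\<^sub>m MGen CapUD) \<bullet> (MId [\<down>] \<otimes>\<^sub>m MGen Xpos \<otimes>\<^sub>m MId [\<down>])
    \<bullet> (MGen CupDU \<otimes>\<^sub>m MId [\<up>, \<down>])"

definition Lneg :: "'k os_term" where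
  "Lneg = (MGen CapDU \<otimes>\<^sub>m MId [\<up>, \<down>]) \<bullet> (MId [\<down>] \<otimes>\<^sub>m MGen Xneg \<otimes>\<^sub>m MId [\<down>])
    \<bullet> (MId [\<down>, \<up>] \<otimes>\<^sub>m MGen CupUD)"

inductive os_rel ::
    "'k::{comm_ring, comm_monoid_mult} \<Rightarrow> 'k \<Rightarrow> 'k \<Rightarrow> 'k os_term \<Rightarrow> 'k os_term \<Rightarrow> bool"
  for q t \<delta> where
  "os_rel q t \<delta> (MGen Xpos \<bullet> MGen Xneg) (MId [\<up>, \<up>])"
| "os_rel q t \<delta> (MGen Xneg \<bullet> MGen Xpos) (MId [\<up>, \<up>])"
| "os_rel q t \<delta>
     ((MGen Xpos \<otimes>\<^sub>m MId [\<up>]) \<bullet> (MId [\<up>] \<otimes>\<^sub>m MGen Xpos) \<bullet> (MGen Xpos \<otimes>\<^sub>m MId [\<up>]))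
     ((MId [\<up>] \<otimes>\<^sub>m MGen Xpos) \<bullet> (MGen Xpos \<otimes>\<^sub>m MId [\<up>]) \<bullet> (MId [\<up>] \<otimes>\<^sub>m MGen Xpos))"
| "os_rel q t \<delta> (Lneg \<bullet> Rpos) (MId [\<up>, \<down>])"
| "os_rel q t \<delta> (Rpos \<bullet> Lneg) (MId [\<down>, \<up>])"
| "os_rel q t \<delta> (MPlus (MGen Xpos) (MScale (- 1) (MGen Xneg))) (MScale (q - unit_inv q) (MId [\<up>, \<up>]))"
| "os_rel q t \<delta>
     ((MGen CapDU \<otimes>\<^sub>m MId [\<up>]) \<bullet> (MId [\<down>] \<otimes>\<^sub>m MGen Xpos) \<bullet> (MGen CupDU \<otimes>\<^sub>m MId [\<up>]))
     (MScale t (MId [\<up>]))"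
| "os_rel q t \<delta>
     ((MId [\<up>] \<otimes>\<^sub>m MGen CapUD) \<bullet> (MGen Xpos \<otimes>\<^sub>m MId [\<down>]) \<bullet> (MId [\<up>] \<otimes>\<^sub>m MGen CupUD))
     (MScale t (MId [\<up>]))"
| "os_rel q t \<delta> (MGen CapUD \<bullet> MGen CupUD) (MScale \<delta> (MId []))"
| "os_rel q t \<delta> ((MGen CapUD \<otimes>\<^sub>m MId [\<up>]) \<bullet> (MId [\<up>] \<otimes>\<^sub>m MGen CupDU)) (MId [\<up>])"
| "os_rel q t \<delta> ((MId [\<down>] \<otimes>\<^sub>m MGen CapUD) \<bullet> (MGen CupDU \<otimes>\<^sub>m MId [\<down>])) (MId [\<down>])"

definition os_pres ::
    "'k::{comm_ring, comm_monoid_mult} \<Rightarrow> 'k \<Rightarrow> 'k \<Rightarrow> (arrow, os_gen, 'k) mpresentation" where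
  "os_pres q t \<delta> = \<lparr>Gens = UNIV, GSrc = os_src, GTgt = os_tgt, Rels = os_rel q t \<delta>\<rparr>"

definition OS ::
    "'k::{comm_ring, comm_monoid_mult} \<Rightarrow> 'k \<Rightarrow> 'k \<Rightarrow> (arrow list, 'k os_term set, 'k) moncat" where
  "OS q t \<delta> = presented_moncat (os_pres q t \<delta>)"

definition os_mor ::
    "'k::{comm_ring, comm_monoid_mult} \<Rightarrow> 'k \<Rightarrow> 'k \<Rightarrow> os_gen \<Rightarrow> 'k os_term set" where
  "os_mor q t \<delta> g = mcls (os_pres q t \<delta>) (MGen g)"

section \<open>The iquantum Brauer category\<close>

text \<open>The object \<open>B\<^sub>r\<close> is the number \<open>r\<close>. \<open>Sig n i\<close> and \<open>SigInv n i\<close> are the crossings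
  \<open>\<sigma>\<^sub>i\<close> and \<open>\<sigma>\<^sub>i\<^sup>-\<^sup>1\<close> on \<open>n\<close> strands, which are generators only for \<open>1 \<le> i < n\<close>.\<close>

datatype ib_gen = Cup nat | Cap nat | Sig nat nat | SigInv nat nat

definition ib_gens :: "ib_gen set" where
  "ib_gens = range Cup \<union> range Cap \<union> {Sig n i |n i. 1 \<le> i \<and> i < n} \<union> {SigInv n i |n i. 1 \<le> i \<and> i < n}"

fun ib_src :: "ib_gen \<Rightarrow> nat" where
  "ib_src (Cup r) = r"
| "ib_src (Cap r) = r + 2"
| "ib_src (Sig n i) = n"
| "ib_src (SigInv n i) = n"

fun ib_tgt :: "ib_gen \<Rightarrow> nat" where
  "ib_tgt (Cup r) = r + 2"
| "ib_tgt (Cap r) = r"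
| "ib_tgt (Sig n i) = n"
| "ib_tgt (SigInv n i) = n"

type_synonym 'k ib_term = "(nat, ib_gen, 'k) lterm"

abbreviation (input) sg :: "nat \<Rightarrow> nat \<Rightarrow> 'k ib_term" where "sg n i \<equiv> LGen (Sig n i)"
abbreviation (input) sgi :: "nat \<Rightarrow> nat \<Rightarrow> 'k ib_term" where "sgi n i \<equiv> LGen (SigInv n i)"
abbreviation (input) cup :: "nat \<Rightarrow> 'k ib_term" where "cup r \<equiv> LGen (Cup r)"
abbreviation (input) cap :: "nat \<Rightarrow> 'k ib_term" where "cap r \<equiv> LGen (Cap r)"

inductive ib_rel ::
    "'k::{comm_ring, comm_monoid_mult} \<Rightarrow> 'k \<Rightarrow> 'k \<Rightarrow> 'k ib_term \<Rightarrow> 'k ib_term \<Rightarrow> bool"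
  for q t \<delta> where
  "ib_rel q t \<delta> (sg n i \<cdot> sgi n i) (LId n)"
| "ib_rel q t \<delta> (sgi n i \<cdot> sg n i) (LId n)"
| "ib_rel q t \<delta> (sg n i \<cdot> sg n (i + 1) \<cdot> sg n i) (sg n (i + 1) \<cdot> sg n i \<cdot> sg n (i + 1))"
| "i + 1 < j \<or> j + 1 < i \<Longrightarrow> ib_rel q t \<delta> (sg n i \<cdot> sg n j) (sg n j \<cdot> sg n i)"
| "ib_rel q t \<delta> (LPlus (sg n i) (LScale (- 1) (sgi n i))) (LScale (q - unit_inv q) (LId n))"
| "ib_rel q t \<delta> (cup n \<cdot> sg n i) (sg (n + 2) (i + 2) \<cdot> cup n)"
| "ib_rel q t \<delta> (cap n \<cdot> sg (n + 2) (i + 2)) (sg n i \<cdot> cap n)"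
| "ib_rel q t \<delta> (cap n \<cdot> cup n) (LScale \<delta> (LId n))"
| "ib_rel q t \<delta> (cap n \<cdot> sg (n + 2) 1) (LScale q (cap n))"
| "ib_rel q t \<delta> (sg (n + 2) 1 \<cdot> cup n) (LScale q (cup n))"
| "n \<ge> 1 \<Longrightarrow> ib_rel q t \<delta> (cap n \<cdot> sg (n + 2) 2 \<cdot> cup n) (LScale t (LId n))"
| "n \<ge> 2 \<Longrightarrow> ib_rel q t \<delta>
     (cap n \<cdot> sg (n + 2) 2 \<cdot> sg (n + 2) 3 \<cdot> sgi (n + 2) 1 \<cdot> sgi (n + 2) 2 \<cdot> cup n)
     (cup (n - 2) \<cdot> cap (n - 2))"
| "ib_rel q t \<delta>
     (cap n \<cdot> cap (n + 2) \<cdot> sgi (n + 4) 2 \<cdot> sgi (n + 4) 3 \<cdot> sg (n + 4) 1 \<cdot> sg (n + 4) 2)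
     (cap n \<cdot> cap (n + 2))"
| "ib_rel q t \<delta>
     (sgi (n + 4) 2 \<cdot> sgi (n + 4) 1 \<cdot> sg (n + 4) 3 \<cdot> sg (n + 4) 2 \<cdot> cup (n + 2) \<cdot> cup n)
     (cup (n + 2) \<cdot> cup n)"

definition ib_pres ::
    "'k::{comm_ring, comm_monoid_mult} \<Rightarrow> 'k \<Rightarrow> 'k \<Rightarrow> (nat, ib_gen, 'k) lpresentation" where
  "ib_pres q t \<delta> = \<lparr>Gens = ib_gens, GSrc = ib_src, GTgt = ib_tgt, Rels = ib_rel q t \<delta>\<rparr>"

definition IB ::
    "'k::{comm_ring, comm_monoid_mult} \<Rightarrow> 'k \<Rightarrow> 'k \<Rightarrow> (nat, 'k ib_term set, 'k) lincat" where
  "IB q t \<delta> = presented_lincat (ib_pres q t \<delta>)"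

definition ib_mor ::
    "'k::{comm_ring, comm_monoid_mult} \<Rightarrow> 'k \<Rightarrow> 'k \<Rightarrow> ib_gen \<Rightarrow> 'k ib_term set" where
  "ib_mor q t \<delta> g = lcls (ib_pres q t \<delta>) (LGen g)"

text \<open>\<open>pos_word q t \<delta> n [i, \<dots>, j]\<close> is \<open>\<sigma>\<^sub>i \<cdots> \<sigma>\<^sub>j\<close> on \<open>n\<close> strands;
  \<open>neg_word q t \<delta> n [i, \<dots>, j]\<close> is \<open>\<sigma>\<^sub>i\<^sup>-\<^sup>1 \<cdots> \<sigma>\<^sub>j\<^sup>-\<^sup>1\<close> (the letters are inverted one by one,
  without reversing their order).\<close>

definition pos_word ::
    "'k::{comm_ring, comm_monoid_mult} \<Rightarrow> 'k \<Rightarrow> 'k \<Rightarrow> nat \<Rightarrow> nat list \<Rightarrow> 'k ib_term set" where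
  "pos_word q t \<delta> n is =
     foldr (\<lambda>i f. ib_mor q t \<delta> (Sig n i) \<odot>\<^bsub>IB q t \<delta>\<^esub> f) is (Idm (IB q t \<delta>) n)"

definition neg_word ::
    "'k::{comm_ring, comm_monoid_mult} \<Rightarrow> 'k \<Rightarrow> 'k \<Rightarrow> nat \<Rightarrow> nat list \<Rightarrow> 'k ib_term set" where
  "neg_word q t \<delta> n is =
     foldr (\<lambda>i f. ib_mor q t \<delta> (SigInv n i) \<odot>\<^bsub>IB q t \<delta>\<^esub> f) is (Idm (IB q t \<delta>) n)"

fun shift_gen :: "nat \<Rightarrow> ib_gen \<Rightarrow> ib_gen" where
  "shift_gen k (Cup r) = Cup (r + k)"
| "shift_gen k (Cap r) = Cap (r + k)"
| "shift_gen k (Sig n i) = Sig (n + k) i"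
| "shift_gen k (SigInv n i) = SigInv (n + k) i"

primrec shift :: "nat \<Rightarrow> 'k ib_term \<Rightarrow> 'k ib_term" where
  "shift k (LId r) = LId (r + k)"
| "shift k (LGen g) = LGen (shift_gen k g)"
| "shift k (u \<cdot> v) = shift k u \<cdot> shift k v"
| "shift k (LZero r s) = LZero (r + k) (s + k)"
| "shift k (LPlus u v) = LPlus (shift k u) (shift k v)"
| "shift k (LScale x u) = LScale x (shift k u)"

text \<open>The functor \<open>A\<^sub>k\<close> adding \<open>k\<close> strands on the right.\<close>

definition add_strands ::
    "'k::{comm_ring, comm_monoid_mult} \<Rightarrow> 'k \<Rightarrow> 'k \<Rightarrow> nat
      \<Rightarrow> (nat, 'k ib_term set, nat, 'k ib_term set) fctr" where
  "add_strands q t \<delta> k =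
    \<lparr>FObj = (\<lambda>r. r + k),
     FMor = (\<lambda>X\<in>Mor (IB q t \<delta>). lcls (ib_pres q t \<delta>) (shift k (rep X)))\<rparr>"

end

theory Submission
  imports Defs
begin

text \<open>
  By the universal property of a presented strict monoidal category it suffices to check that the
  prescribed components are natural and satisfy the relations of \<open>OS\<close>. The cup \<open>A(c)\<^bsub>r\<^esub>\<close> is the
  cup of \<open>B\<close> pulled to the right over and under \<open>r\<close> strands; sliding crossings through it reduces
  naturality to relations on at most four strands, and the sign patterns of these that are not
  imposed on \<open>B\<close> follow from the skein relation. In a relation of \<open>OS\<close> between a cup and a cap, the crossings
  of the two cancel by the braid relations until \<open>cap \<sigma>\<^sub>2\<^sup>\<plusminus>\<^sup>1 cup = t\<^sup>\<plusminus>\<^sup>1\<close> or \<open>cap cup = \<delta>\<close> applies.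
\<close>

section \<open>Categories given by generators and relations\<close>

text \<open>The presentation of B fixes signs asymmetrically, while naturality of both cups and both
  caps needs each four-strand relation in its mirror form too. The skein relation changes the sign
  of a crossing at the price of z times the word without it, so a sign may be flipped on both sides
  of an equation once the two words without the crossing agree; finding an order of flips in which
  these shorter equations are available is the delicate point. The scalar q^-1 t on A(c') and its
  inverse on A(d) have a geometric origin: the unscaled cap, joined to A(c) in a zigzag, gives q^-1
  t, where q^-1 is a curl absorbed by the cup or the cap of B and t is a loop left around a strand.
  Inverting every crossing exchanges A(c) with A(c') and A(d') with A(d) up to these scalars, hence
  one Boolean sign for crossings, cups and caps. Tensoring a morphism of OS with identity strands on
  its right adds strands to its component, so the cup to the right of r strands has to be studied on
  any number n of strands.\<close>

lemma leq_typed: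
  "leq P u v \<Longrightarrow> lwf P u \<and> lwf P v \<and> lsrc P u = lsrc P v \<and> ltgt P u = ltgt P v"
  by (induction rule: leq.induct) (auto simp: lhom_def)

lemma lcls_eqI: "leq P u v \<Longrightarrow> lcls P u = lcls P v"
  unfolding lcls_def by (blast intro: leq_sym leq_trans)

text \<open>One well-formed side suffices: \<open>u\<close> then lies in its own class, hence in
  that of \<open>v\<close>. Two ill-formed terms both have the empty class without being
  related.\<close>

lemma lcls_eq_iff: "lwf P u \<Longrightarrow> lcls P u = lcls P v \<longleftrightarrow> leq P u v"
  by (metis lcls_eqI lcls_def leq_refl leq_sym leq_typed mem_Collect_eq empty_iff)

lemma rep_lcls: "lwf P u \<Longrightarrow> leq P u (rep (lcls P u))"
  unfolding rep_def lcls_def by (rule someI2[of _ u]) (auto intro: leq_refl)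

lemma presented_Obj [simp]: "Obj (presented_lincat P) = UNIV"
  by (simp add: presented_lincat_def)

lemma presented_Hom: "Hom (presented_lincat P) a b = lcls P ` lhom P a b"
  by (simp add: presented_lincat_def)

lemma presented_Idm: "Idm (presented_lincat P) a = lcls P (LId a)"
  by (simp add: presented_lincat_def)

lemma presented_Zerom: "Zerom (presented_lincat P) a b = lcls P (LZero a b)"
  by (simp add: presented_lincat_def)

text \<open>Composition is defined through chosen representatives; the congruence rule makes the
  result independent of the choice. With this equation \<open>rep\<close> disappears from
  computations with classes of terms.\<close>

lemma presented_Comp:
  assumes "lwf P (u \<cdot> v)"
  shows "Comp (presented_lincat P) (lcls P u) (lcls P v) = lcls P (u \<cdot> v)"
proof -
  have "leq P (u \<cdot> v) (rep (lcls P u) \<cdot> rep (lcls P v))"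
    using assms by (intro leq_Comp rep_lcls) auto
  from lcls_eqI[OF this] show ?thesis by (simp add: presented_lincat_def)
qed

lemma presented_Plus:
  assumes "lwf P (LPlus u v)"
  shows "Plus (presented_lincat P) (lcls P u) (lcls P v) = lcls P (LPlus u v)"
proof -
  have "leq P (LPlus u v) (LPlus (rep (lcls P u)) (rep (lcls P v)))"
    using assms by (intro leq_Plus rep_lcls) auto
  from lcls_eqI[OF this] show ?thesis by (simp add: presented_lincat_def)
qed

lemma presented_Scale:
  assumes "lwf P u"
  shows "Scale (presented_lincat P) x (lcls P u) = lcls P (LScale x u)"
proof -
  have "leq P (LScale x u) (LScale x (rep (lcls P u)))"
    using assms by (intro leq_Scale rep_lcls)
  from lcls_eqI[OF this] show ?thesis by (simp add: presented_lincat_def)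
qed

lemmas presented_simps = presented_Hom presented_Idm presented_Zerom presented_Comp
  presented_Plus presented_Scale

lemmas leq_linear_axioms = leq_Comp_Id leq_Id_Comp leq_Comp_assoc leq_Plus_commute leq_Plus_assoc
  leq_Plus_Zero leq_Scale_zero leq_Scale_one leq_Scale_mult leq_Scale_add_left leq_Scale_add_right
  leq_Comp_Plus_left leq_Comp_Plus_right leq_Comp_Scale_left leq_Comp_Scale_right

lemma linear_category_presented: "linear_category (presented_lincat P)"
proof (unfold_locales, unfold presented_Obj, goal_cases)
  \<comment> \<open>The first goal is disjointness of hom-sets: terms with equal classes are related
    by \<open>leq\<close>, which preserves source and target.\<close>
  case 1 then show ?case
    by (auto simp: presented_simps lhom_def lcls_eq_iff dest: leq_typed)
qed (auto simp: presented_simps lhom_def intro!: imageI lcls_eqI leq_linear_axioms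
    del: equalityI subsetI)

section \<open>Presented strict monoidal categories\<close>

lemma meq_typed:
  "meq P u v \<Longrightarrow> mwf P u \<and> mwf P v \<and> msrc P u = msrc P v \<and> mtgt P u = mtgt P v"
  by (induction rule: meq.induct) (auto simp: mhom_def)

lemma mcls_eqI: "meq P u v \<Longrightarrow> mcls P u = mcls P v"
  unfolding mcls_def by (blast intro: meq_sym meq_trans)

lemma mcls_eq_iff: "mwf P u \<Longrightarrow> mcls P u = mcls P v \<longleftrightarrow> meq P u v"
  by (metis mcls_eqI mcls_def meq_refl meq_sym meq_typed mem_Collect_eq empty_iff)

lemma rep_mcls: "mwf P u \<Longrightarrow> meq P u (rep (mcls P u))"
  unfolding rep_def mcls_def by (rule someI2[of _ u]) (auto intro: meq_refl)

lemma presented_moncat_Obj [simp]: "Obj (presented_moncat P) = UNIV"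
  by (simp add: presented_moncat_def)

lemma presented_moncat_Hom: "Hom (presented_moncat P) a b = mcls P ` mhom P a b"
  by (simp add: presented_moncat_def)

lemma presented_moncat_Idm: "Idm (presented_moncat P) a = mcls P (MId a)"
  by (simp add: presented_moncat_def)

lemma presented_moncat_Zerom: "Zerom (presented_moncat P) a b = mcls P (MZero a b)"
  by (simp add: presented_moncat_def)

lemma presented_moncat_Unit: "Unit (presented_moncat P) = []"
  by (simp add: presented_moncat_def)

lemma presented_moncat_TObj: "TObj (presented_moncat P) = (@)"
  by (simp add: presented_moncat_def)

lemma presented_moncat_Comp:
  assumes "mwf P (u \<bullet> v)"
  shows "Comp (presented_moncat P) (mcls P u) (mcls P v) = mcls P (u \<bullet> v)"
proof -
  have "meq P (u \<bullet> v) (rep (mcls P u) \<bullet> rep (mcls P v))"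
    using assms by (intro meq_Comp rep_mcls) auto
  from mcls_eqI[OF this] show ?thesis by (simp add: presented_moncat_def)
qed

lemma presented_moncat_Plus:
  assumes "mwf P (MPlus u v)"
  shows "Plus (presented_moncat P) (mcls P u) (mcls P v) = mcls P (MPlus u v)"
proof -
  have "meq P (MPlus u v) (MPlus (rep (mcls P u)) (rep (mcls P v)))"
    using assms by (intro meq_Plus rep_mcls) auto
  from mcls_eqI[OF this] show ?thesis by (simp add: presented_moncat_def)
qed

lemma presented_moncat_Scale:
  assumes "mwf P u"
  shows "Scale (presented_moncat P) x (mcls P u) = mcls P (MScale x u)"
proof -
  have "meq P (MScale x u) (MScale x (rep (mcls P u)))"
    using assms by (intro meq_Scale rep_mcls)
  from mcls_eqI[OF this] show ?thesis by (simp add: presented_moncat_def)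
qed

lemma presented_moncat_TMor:
  assumes "mwf P (u \<otimes>\<^sub>m v)"
  shows "TMor (presented_moncat P) (mcls P u) (mcls P v) = mcls P (u \<otimes>\<^sub>m v)"
proof -
  have "meq P (u \<otimes>\<^sub>m v) (rep (mcls P u) \<otimes>\<^sub>m rep (mcls P v))"
    using assms by (intro meq_Tens rep_mcls) auto
  from mcls_eqI[OF this] show ?thesis by (simp add: presented_moncat_def)
qed

lemmas presented_moncat_simps = presented_moncat_Hom presented_moncat_Idm presented_moncat_Zerom
  presented_moncat_Unit presented_moncat_TObj presented_moncat_Comp presented_moncat_Plus
  presented_moncat_Scale presented_moncat_TMor

lemmas meq_monoidal_axioms = meq_Comp_Id meq_Id_Comp meq_Comp_assoc meq_Plus_commute
  meq_Plus_assoc meq_Plus_Zero meq_Scale_zero meq_Scale_one meq_Scale_mult meq_Scale_add_left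
  meq_Scale_add_right meq_Comp_Plus_left meq_Comp_Plus_right meq_Comp_Scale_left
  meq_Comp_Scale_right meq_Tens_Id meq_interchange meq_Tens_assoc meq_Unit_Tens meq_Tens_Unit
  meq_Tens_Plus_left meq_Tens_Plus_right meq_Tens_Scale_left meq_Tens_Scale_right

lemma strict_monoidal_category_presented: "strict_monoidal_category (presented_moncat P)"
proof (unfold_locales, unfold presented_moncat_Obj, goal_cases)
  case 1 then show ?case
    by (auto simp: presented_moncat_simps mhom_def mcls_eq_iff dest: meq_typed)
qed (auto simp: presented_moncat_simps mhom_def intro!: imageI mcls_eqI meq_monoidal_axioms
    del: equalityI subsetI)

section \<open>The universal property of a presented strict monoidal category\<close>

primrec tensor_objects :: "('p, 'n, 'k, 'z) moncat_scheme \<Rightarrow> ('a \<Rightarrow> 'p) \<Rightarrow> 'a list \<Rightarrow> 'p" where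
  "tensor_objects D fo [] = Unit D"
| "tensor_objects D fo (x # xs) = fo x \<boxtimes>\<^bsub>D\<^esub> tensor_objects D fo xs"

primrec mev :: "('p, 'n, 'k, 'z) moncat_scheme \<Rightarrow> ('a \<Rightarrow> 'p) \<Rightarrow> ('g \<Rightarrow> 'n)
    \<Rightarrow> ('a, 'g, 'k) mterm \<Rightarrow> 'n" where
  "mev D fo fg (MId a) = Idm D (tensor_objects D fo a)"
| "mev D fo fg (MGen g) = fg g"
| "mev D fo fg (u \<bullet> v) = mev D fo fg u \<odot>\<^bsub>D\<^esub> mev D fo fg v"
| "mev D fo fg (u \<otimes>\<^sub>m v) = mev D fo fg u \<otimes>\<^bsub>D\<^esub> mev D fo fg v"
| "mev D fo fg (MZero a b) = Zerom D (tensor_objects D fo a) (tensor_objects D fo b)"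
| "mev D fo fg (MPlus u v) = mev D fo fg u \<oplus>\<^bsub>D\<^esub> mev D fo fg v"
| "mev D fo fg (MScale x u) = x \<star>\<^bsub>D\<^esub> mev D fo fg u"

text \<open>This evaluates a chosen representative, so it is meaningful only when \<open>mev\<close>
  respects the relations; \<open>FMor_mfunctor\<close> then replaces the representative by any
  well-formed term.\<close>

definition mfunctor :: "('a, 'g, 'k) mpresentation \<Rightarrow> ('p, 'n, 'k, 'z) moncat_scheme
    \<Rightarrow> ('a \<Rightarrow> 'p) \<Rightarrow> ('g \<Rightarrow> 'n) \<Rightarrow> ('a list, ('a, 'g, 'k) mterm set, 'p, 'n) fctr" where
  "mfunctor P D fo fg = \<lparr>FObj = tensor_objects D fo, FMor = (\<lambda>X. mev D fo fg (rep X))\<rparr>"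

text \<open>The data of the universal property are typed images of the generators. The relations
  stay outside because their verification already uses that \<open>mev\<close> is well
  typed.\<close>

locale moncat_assignment = D: strict_monoidal_category D
  for P :: "('a, 'g, 'k::{comm_ring, comm_monoid_mult}) mpresentation"
    and D :: "('p, 'n, 'k, 'z) moncat_scheme"
    and fo :: "'a \<Rightarrow> 'p" and fg :: "'g \<Rightarrow> 'n" +
  assumes fo_closed: "fo a \<in> Obj D"
    and fg_closed: "g \<in> Gens P \<Longrightarrow>
      fg g \<in> Hom D (tensor_objects D fo (GSrc P g)) (tensor_objects D fo (GTgt P g))"
begin

lemma objects_closed: "tensor_objects D fo w \<in> Obj D"
  by (induction w) (auto intro: fo_closed D.Unit_closed D.TObj_closed)

lemma objects_append:
  "tensor_objects D fo (v @ w) = tensor_objects D fo v \<boxtimes>\<^bsub>D\<^esub> tensor_objects D fo w"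
  by (induction v) (auto simp: D.Unit_TObj D.TObj_assoc objects_closed fo_closed)

lemma mev_closed:
  "mwf P u \<Longrightarrow> mev D fo fg u
    \<in> Hom D (tensor_objects D fo (msrc P u)) (tensor_objects D fo (mtgt P u))"
proof (induction u)
  case (MComp u v)
  then show ?case using D.Comp_closed[OF objects_closed objects_closed objects_closed] by auto
qed (auto simp: objects_append objects_closed
     intro!: fg_closed D.Idm_closed D.TMor_closed D.Zerom_closed D.Plus_closed D.Scale_closed)

lemma mev_closed':
  "u \<in> mhom P a b \<Longrightarrow> mev D fo fg u \<in> Hom D (tensor_objects D fo a) (tensor_objects D fo b)"
  using mev_closed by (auto simp: mhom_def)

text \<open>Every rule of \<open>meq\<close> other than \<open>meq_rel\<close> mirrors an axiom of D
  or a property of equality, so by induction only the relations remain, and only for well-formed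
  parallel sides.\<close>

lemma mev_cong:
  assumes rels: "\<And>u v a b. \<lbrakk>Rels P u v; u \<in> mhom P a b; v \<in> mhom P a b\<rbrakk>
      \<Longrightarrow> mev D fo fg u = mev D fo fg v"
    and "meq P u v"
  shows "mev D fo fg u = mev D fo fg v"
  using assms(2)
proof (induction rule: meq.induct)
  case (meq_Comp_Id u a b) then show ?case
    by (simp add: D.Comp_Idm[OF objects_closed objects_closed mev_closed'])
next
  case (meq_Id_Comp u a b) then show ?case
    by (simp add: D.Idm_Comp[OF objects_closed objects_closed mev_closed'])
next
  case (meq_Plus_Zero u a b) then show ?case
    by (simp add: D.Plus_Zerom[OF objects_closed objects_closed mev_closed'])
next
  case (meq_Scale_zero u a b) then show ?case
    by (simp add: D.scale_zero[OF objects_closed objects_closed mev_closed'])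
next
  case (meq_Comp_assoc u v w)
  then have h: "mwf P u" "mwf P v" "mwf P w" "msrc P u = mtgt P v" "msrc P v = mtgt P w" by auto
  show ?case
    using h mev_closed[of u] mev_closed[of v] mev_closed[of w]
    by (simp add: D.Comp_assoc[OF objects_closed objects_closed objects_closed objects_closed])
next
  case (meq_Plus_commute u v)
  then show ?case using mev_closed[of u] mev_closed[of v]
    by (auto intro: D.Plus_commute[OF objects_closed objects_closed])
next
  case (meq_Plus_assoc u v w)
  then show ?case using mev_closed[of u] mev_closed[of v] mev_closed[of w]
    by (auto intro: D.Plus_assoc[OF objects_closed objects_closed])
next
  case (meq_Scale_one u)
  then show ?case using mev_closed[of u]
    by (auto intro: D.scale_one[OF objects_closed objects_closed])
next
  case (meq_Scale_mult u)
  then show ?case using mev_closed[of u]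
    by (auto intro: D.scale_mult[OF objects_closed objects_closed])
next
  case (meq_Scale_add_left u)
  then show ?case using mev_closed[of u]
    by (auto intro: D.scale_add_left[OF objects_closed objects_closed])
next
  case (meq_Scale_add_right u v)
  then show ?case using mev_closed[of u] mev_closed[of v]
    by (auto intro: D.scale_add_right[OF objects_closed objects_closed])
next
  case (meq_Comp_Plus_left u u' v)
  then show ?case using mev_closed[of u] mev_closed[of u'] mev_closed[of v]
    by (auto intro: D.Comp_Plus_left[OF objects_closed objects_closed objects_closed])
next
  case (meq_Comp_Plus_right u v v')
  then show ?case using mev_closed[of u] mev_closed[of v] mev_closed[of v']
    by (auto intro: D.Comp_Plus_right[OF objects_closed objects_closed objects_closed])
next
  case (meq_Comp_Scale_left u v)
  then show ?case using mev_closed[of u] mev_closed[of v]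
    by (auto intro: D.Comp_Scale_left[OF objects_closed objects_closed objects_closed])
next
  case (meq_Comp_Scale_right u v)
  then show ?case using mev_closed[of u] mev_closed[of v]
    by (auto intro: D.Comp_Scale_right[OF objects_closed objects_closed objects_closed])
next
  case (meq_Tens_Id a b)
  show ?case by (simp add: D.TMor_Idm objects_closed objects_append)
next
  case (meq_interchange u v u' v')
  then show ?case
    using mev_closed[of u] mev_closed[of v] mev_closed[of u'] mev_closed[of v']
    by (auto intro: D.interchange[OF objects_closed objects_closed objects_closed
        objects_closed objects_closed objects_closed])
next
  case (meq_Tens_assoc u v w)
  then show ?case using mev_closed[of u] mev_closed[of v] mev_closed[of w]
    by (auto intro: D.TMor_assoc[OF objects_closed objects_closed objects_closed
        objects_closed objects_closed objects_closed])
next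
  case (meq_Unit_Tens u)
  then show ?case using mev_closed[of u]
    by (auto intro: D.Unit_TMor[OF objects_closed objects_closed])
next
  case (meq_Tens_Unit u)
  then show ?case using mev_closed[of u]
    by (auto intro: D.TMor_Unit[OF objects_closed objects_closed])
next
  case (meq_Tens_Plus_left u u' v)
  then show ?case using mev_closed[of u] mev_closed[of u'] mev_closed[of v]
    by (auto intro: D.TMor_Plus_left[OF objects_closed objects_closed objects_closed objects_closed])
next
  case (meq_Tens_Plus_right u v v')
  then show ?case using mev_closed[of u] mev_closed[of v] mev_closed[of v']
    by (auto intro: D.TMor_Plus_right[OF objects_closed objects_closed objects_closed objects_closed])
next
  case (meq_Tens_Scale_left u v)
  then show ?case using mev_closed[of u] mev_closed[of v]
    by (auto intro: D.TMor_Scale_left[OF objects_closed objects_closed objects_closed objects_closed])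
next
  case (meq_Tens_Scale_right u v)
  then show ?case using mev_closed[of u] mev_closed[of v]
    by (auto intro: D.TMor_Scale_right[OF objects_closed objects_closed objects_closed objects_closed])
qed (auto intro: rels)

lemma FMor_mfunctor:
  assumes rels: "\<And>u v a b. \<lbrakk>Rels P u v; u \<in> mhom P a b; v \<in> mhom P a b\<rbrakk>
      \<Longrightarrow> mev D fo fg u = mev D fo fg v"
    and "mwf P u"
  shows "FMor (mfunctor P D fo fg) (mcls P u) = mev D fo fg u"
  using mev_cong[OF rels rep_mcls[OF assms(2)]] by (simp add: mfunctor_def)

lemma strict_monoidal_functor_mfunctor:
  assumes rels: "\<And>u v a b. \<lbrakk>Rels P u v; u \<in> mhom P a b; v \<in> mhom P a b\<rbrakk>
      \<Longrightarrow> mev D fo fg u = mev D fo fg v"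
  shows "strict_monoidal_functor (presented_moncat P) D (mfunctor P D fo fg)"
proof -
  interpret C: strict_monoidal_category "presented_moncat P"
    by (rule strict_monoidal_category_presented)
  have F: "FMor (mfunctor P D fo fg) (mcls P u) = mev D fo fg u" if "mwf P u" for u
    using FMor_mfunctor rels that by blast
  have O: "FObj (mfunctor P D fo fg) = tensor_objects D fo" by (simp add: mfunctor_def)
  show ?thesis
    by unfold_locales
      (auto simp: presented_moncat_simps mhom_def F O objects_closed objects_append mev_closed)
qed

end

section \<open>Endofunctor categories\<close>

text \<open>Reversal exchanges the left and right versions of the axioms; only the associativity
  laws have to be read backwards.\<close>

lemma strict_monoidal_category_rev_tensor:
  assumes "strict_monoidal_category C"
  shows "strict_monoidal_category (rev_tensor C)"
proof -
  interpret C: strict_monoidal_category C by (rule assms)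
  have sel: "Obj (rev_tensor C) = Obj C" "Hom (rev_tensor C) = Hom C" "Idm (rev_tensor C) = Idm C"
    "Comp (rev_tensor C) = Comp C" "Zerom (rev_tensor C) = Zerom C" "Plus (rev_tensor C) = Plus C"
    "Scale (rev_tensor C) = Scale C" "Unit (rev_tensor C) = Unit C"
    "TObj (rev_tensor C) = (\<lambda>a b. TObj C b a)" "TMor (rev_tensor C) = (\<lambda>f g. TMor C g f)"
    by (simp_all add: rev_tensor_def)
  show ?thesis
    apply (unfold_locales, unfold sel)
      apply (rule C.Hom_disjoint C.Idm_closed C.Comp_closed C.Comp_Idm C.Idm_Comp C.Comp_assoc
        C.Zerom_closed C.Plus_closed C.Scale_closed C.Plus_commute C.Plus_assoc C.Plus_Zerom
        C.scale_zero C.scale_one C.scale_mult C.scale_add_left C.scale_add_right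
        C.Comp_Plus_left C.Comp_Plus_right C.Comp_Scale_left C.Comp_Scale_right
        C.Unit_closed C.TObj_closed C.TObj_assoc[symmetric] C.Unit_TObj C.TObj_Unit
        C.TMor_closed C.TMor_Idm C.interchange C.TMor_assoc[symmetric] C.Unit_TMor C.TMor_Unit
        C.TMor_Plus_left C.TMor_Plus_right C.TMor_Scale_left C.TMor_Scale_right; assumption)+
  done
qed

section \<open>Endofunctors and their composition\<close>

lemma MorI: "a \<in> Obj C \<Longrightarrow> b \<in> Obj C \<Longrightarrow> f \<in> Hom C a b \<Longrightarrow> f \<in> Mor C"
  by (auto simp: Mor_def)

context linear_category
begin

text \<open>No axiom mentions composition with zero; it follows from writing the zero morphism as 0
  times itself and moving the scalar out.\<close>

lemma Comp_Zerom:
  assumes "a \<in> Obj C" "b \<in> Obj C" "c \<in> Obj C" "g \<in> Hom C b c"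
  shows "g \<odot> Zerom C a b = Zerom C a c"
proof -
  have z: "Zerom C a b \<in> Hom C a b" using assms by (intro Zerom_closed)
  have "g \<odot> Zerom C a b = g \<odot> (0 \<star> Zerom C a b)" using assms z by (simp add: scale_zero)
  also have "\<dots> = 0 \<star> (g \<odot> Zerom C a b)" using assms z by (intro Comp_Scale_right)
  also have "\<dots> = Zerom C a c" using assms(1,3) Comp_closed[OF assms(1-3) z assms(4)] by (rule scale_zero)
  finally show ?thesis .
qed

lemma Zerom_Comp:
  assumes "a \<in> Obj C" "b \<in> Obj C" "c \<in> Obj C" "f \<in> Hom C a b"
  shows "Zerom C b c \<odot> f = Zerom C a c"
proof -
  have z: "Zerom C b c \<in> Hom C b c" using assms by (intro Zerom_closed)
  have "Zerom C b c \<odot> f = (0 \<star> Zerom C b c) \<odot> f" using assms z by (simp add: scale_zero)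
  also have "\<dots> = 0 \<star> (Zerom C b c \<odot> f)" using assms z by (intro Comp_Scale_left)
  also have "\<dots> = Zerom C a c" using assms(1,3) Comp_closed[OF assms(1-4) z] by (rule scale_zero)
  finally show ?thesis .
qed

lemma endofunctorD:
  assumes "endofunctor C F"
  shows "a \<in> Obj C \<Longrightarrow> FObj F a \<in> Obj C"
    and "\<lbrakk>a \<in> Obj C; b \<in> Obj C; f \<in> Hom C a b\<rbrakk> \<Longrightarrow> FMor F f \<in> Hom C (FObj F a) (FObj F b)"
    and "a \<in> Obj C \<Longrightarrow> FMor F (Idm C a) = Idm C (FObj F a)"
    and "\<lbrakk>a \<in> Obj C; b \<in> Obj C; c \<in> Obj C; f \<in> Hom C a b; g \<in> Hom C b c\<rbrakk>
        \<Longrightarrow> FMor F (g \<odot> f) = FMor F g \<odot> FMor F f"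
    and "\<lbrakk>a \<in> Obj C; b \<in> Obj C; f \<in> Hom C a b; g \<in> Hom C a b\<rbrakk>
        \<Longrightarrow> FMor F (f \<oplus> g) = FMor F f \<oplus> FMor F g"
    and "\<lbrakk>a \<in> Obj C; b \<in> Obj C; f \<in> Hom C a b\<rbrakk> \<Longrightarrow> FMor F (x \<star> f) = x \<star> FMor F f"
    and "FObj F \<in> extensional (Obj C)" and "FMor F \<in> extensional (Mor C)"
proof -
  interpret F: linear_functor C C F using assms by (simp add: endofunctor_def)
  show "a \<in> Obj C \<Longrightarrow> FObj F a \<in> Obj C" by (rule F.FObj_closed)
  show "\<lbrakk>a \<in> Obj C; b \<in> Obj C; f \<in> Hom C a b\<rbrakk> \<Longrightarrow> FMor F f \<in> Hom C (FObj F a) (FObj F b)"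
    by (rule F.FMor_closed)
  show "a \<in> Obj C \<Longrightarrow> FMor F (Idm C a) = Idm C (FObj F a)" by (rule F.FMor_Idm)
  show "\<lbrakk>a \<in> Obj C; b \<in> Obj C; c \<in> Obj C; f \<in> Hom C a b; g \<in> Hom C b c\<rbrakk>
        \<Longrightarrow> FMor F (g \<odot> f) = FMor F g \<odot> FMor F f" by (rule F.FMor_Comp)
  show "\<lbrakk>a \<in> Obj C; b \<in> Obj C; f \<in> Hom C a b; g \<in> Hom C a b\<rbrakk>
        \<Longrightarrow> FMor F (f \<oplus> g) = FMor F f \<oplus> FMor F g" by (rule F.FMor_Plus)
  show "\<lbrakk>a \<in> Obj C; b \<in> Obj C; f \<in> Hom C a b\<rbrakk> \<Longrightarrow> FMor F (x \<star> f) = x \<star> FMor F f"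
    by (rule F.FMor_Scale)
qed (use assms in \<open>simp_all add: endofunctor_def\<close>)

lemma endofunctorI:
  assumes "\<And>a. a \<in> Obj C \<Longrightarrow> FObj F a \<in> Obj C"
    and "\<And>a b f. \<lbrakk>a \<in> Obj C; b \<in> Obj C; f \<in> Hom C a b\<rbrakk> \<Longrightarrow> FMor F f \<in> Hom C (FObj F a) (FObj F b)"
    and "\<And>a. a \<in> Obj C \<Longrightarrow> FMor F (Idm C a) = Idm C (FObj F a)"
    and "\<And>a b c f g. \<lbrakk>a \<in> Obj C; b \<in> Obj C; c \<in> Obj C; f \<in> Hom C a b; g \<in> Hom C b c\<rbrakk>
        \<Longrightarrow> FMor F (g \<odot> f) = FMor F g \<odot> FMor F f"
    and "\<And>a b f g. \<lbrakk>a \<in> Obj C; b \<in> Obj C; f \<in> Hom C a b; g \<in> Hom C a b\<rbrakk>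
        \<Longrightarrow> FMor F (f \<oplus> g) = FMor F f \<oplus> FMor F g"
    and "\<And>a b f x. \<lbrakk>a \<in> Obj C; b \<in> Obj C; f \<in> Hom C a b\<rbrakk> \<Longrightarrow> FMor F (x \<star> f) = x \<star> FMor F f"
    and "FObj F \<in> extensional (Obj C)" and "FMor F \<in> extensional (Mor C)"
  shows "endofunctor C F"
proof -
  have "linear_functor C C F" by unfold_locales (fact assms)+
  then show ?thesis using assms(7,8) by (simp add: endofunctor_def)
qed

lemma endofunctor_Mor: "endofunctor C F \<Longrightarrow> f \<in> Mor C \<Longrightarrow> FMor F f \<in> Mor C"
  unfolding Mor_def by clarify (rule UN_I[OF endofunctorD(1)], assumption+,
      rule UN_I[OF endofunctorD(1)], assumption+, rule endofunctorD(2))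

lemma comp_fctr_Mor' [simp]: "f \<in> Mor C \<Longrightarrow> FMor (comp_fctr C F G) f = FMor F (FMor G f)"
  by (simp add: comp_fctr_def)

lemma id_fctr_Mor' [simp]: "f \<in> Mor C \<Longrightarrow> FMor (id_fctr C) f = f"
  by (simp add: id_fctr_def)

lemma comp_fctr_Obj [simp]: "a \<in> Obj C \<Longrightarrow> FObj (comp_fctr C F G) a = FObj F (FObj G a)"
  by (simp add: comp_fctr_def)

lemma comp_fctr_Mor [simp]:
  "\<lbrakk>a \<in> Obj C; b \<in> Obj C; f \<in> Hom C a b\<rbrakk> \<Longrightarrow> FMor (comp_fctr C F G) f = FMor F (FMor G f)"
  using MorI[of a C b f] by (simp add: comp_fctr_def)

lemma id_fctr_Obj [simp]: "a \<in> Obj C \<Longrightarrow> FObj (id_fctr C) a = a"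
  by (simp add: id_fctr_def)

lemma id_fctr_Mor [simp]:
  "\<lbrakk>a \<in> Obj C; b \<in> Obj C; f \<in> Hom C a b\<rbrakk> \<Longrightarrow> FMor (id_fctr C) f = f"
  using MorI[of a C b f] by (simp add: id_fctr_def)

lemma endofunctor_id: "endofunctor C (id_fctr C)"
proof (rule endofunctorI, goal_cases)
  case (4 a b c f g)
  then show ?case using Comp_closed[OF 4] by (simp only: id_fctr_Mor)
next
  case (5 a b f g)
  then show ?case using Plus_closed[OF 5] by (simp only: id_fctr_Mor)
next
  case (6 a b f x)
  then show ?case using Scale_closed[OF 6, of x] by (simp only: id_fctr_Mor)
next
  case (3 a)
  then show ?case using Idm_closed[OF 3] by (simp only: id_fctr_Mor id_fctr_Obj)
qed (simp_all, simp_all add: id_fctr_def)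

lemma endofunctor_comp:
  assumes F: "endofunctor C F" and G: "endofunctor C G"
  shows "endofunctor C (comp_fctr C F G)"
proof (rule endofunctorI, goal_cases)
  case (1 a)
  then show ?case using endofunctorD(1)[OF F] endofunctorD(1)[OF G] by simp
next
  case (2 a b f)
  then show ?case
    using endofunctorD(2)[OF F endofunctorD(1,1,2)[OF G]] by simp
next
  case (3 a)
  then show ?case
    using endofunctorD(3)[OF F endofunctorD(1)[OF G]] endofunctorD(3)[OF G] Idm_closed[OF 3]
    by simp
next
  case (4 a b c f g)
  then show ?case
    using endofunctorD(4)[OF F endofunctorD(1,1,1,2,2)[OF G]] endofunctorD(4)[OF G 4] Comp_closed[OF 4]
    by simp
next
  case (5 a b f g)
  then show ?case
    using endofunctorD(5)[OF F endofunctorD(1,1,2,2)[OF G]] endofunctorD(5)[OF G 5] Plus_closed[OF 5]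
    by simp
next
  case (6 a b f x)
  then show ?case
    using endofunctorD(6)[OF F endofunctorD(1,1,2)[OF G]] endofunctorD(6)[OF G 6] Scale_closed[OF 6, of x]
    by simp
qed (simp_all add: comp_fctr_def)

text \<open>Extensionality turns agreement on the category into equality. The strict associativity
  and unit laws for functors under composition rest on this.\<close>

lemma fctr_eqI:
  assumes "endofunctor C F" "endofunctor C G"
    and "\<And>a. a \<in> Obj C \<Longrightarrow> FObj F a = FObj G a"
    and "\<And>f. f \<in> Mor C \<Longrightarrow> FMor F f = FMor G f"
  shows "F = G"
proof -
  have "FObj F = FObj G"
    using endofunctorD(7)[OF assms(1)] endofunctorD(7)[OF assms(2)] assms(3)
    by (rule extensionalityI)
  moreover have "FMor F = FMor G"
    using endofunctorD(8)[OF assms(1)] endofunctorD(8)[OF assms(2)] assms(4)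
    by (rule extensionalityI)
  ultimately show ?thesis by simp
qed


section \<open>Natural transformations and their operations\<close>

lemma End_sel [simp]:
  "Obj (End_cat C) = {F. endofunctor C F}"
  "NSrc (Idm (End_cat C) F) = F" "NTgt (Idm (End_cat C) F) = F"
  "NSrc (Comp (End_cat C) \<theta> \<eta>) = NSrc \<eta>" "NTgt (Comp (End_cat C) \<theta> \<eta>) = NTgt \<theta>"
  "NSrc (Zerom (End_cat C) F G) = F" "NTgt (Zerom (End_cat C) F G) = G"
  "NSrc (Plus (End_cat C) \<eta> \<theta>) = NSrc \<eta>" "NTgt (Plus (End_cat C) \<eta> \<theta>) = NTgt \<eta>"
  "NSrc (Scale (End_cat C) x \<eta>) = NSrc \<eta>" "NTgt (Scale (End_cat C) x \<eta>) = NTgt \<eta>"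
  "Unit (End_cat C) = id_fctr C"
  "TObj (End_cat C) = comp_fctr C"
  "NSrc (TMor (End_cat C) \<eta> \<theta>) = comp_fctr C (NSrc \<eta>) (NSrc \<theta>)"
  "NTgt (TMor (End_cat C) \<eta> \<theta>) = comp_fctr C (NTgt \<eta>) (NTgt \<theta>)"
  by (simp_all add: End_cat_def)

lemma End_At:
  assumes "a \<in> Obj C"
  shows "At (Idm (End_cat C) F) a = Idm C (FObj F a)"
    "At (Comp (End_cat C) \<theta> \<eta>) a = At \<theta> a \<odot> At \<eta> a"
    "At (Zerom (End_cat C) F G) a = Zerom C (FObj F a) (FObj G a)"
    "At (Plus (End_cat C) \<eta> \<theta>) a = At \<eta> a \<oplus> At \<theta> a"
    "At (Scale (End_cat C) x \<eta>) a = x \<star> At \<eta> a"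
    "At (TMor (End_cat C) \<eta> \<theta>) a = At \<eta> (FObj (NTgt \<theta>) a) \<odot> FMor (NSrc \<eta>) (At \<theta> a)"
  using assms by (simp_all add: End_cat_def)

lemma End_At_extensional [simp]:
  "At (Idm (End_cat C) F) \<in> extensional (Obj C)"
  "At (Comp (End_cat C) \<theta> \<eta>) \<in> extensional (Obj C)"
  "At (Zerom (End_cat C) F G) \<in> extensional (Obj C)"
  "At (Plus (End_cat C) \<eta> \<theta>) \<in> extensional (Obj C)"
  "At (Scale (End_cat C) x \<eta>) \<in> extensional (Obj C)"
  "At (TMor (End_cat C) \<eta> \<theta>) \<in> extensional (Obj C)"
  by (simp_all add: End_cat_def)

lemma End_HomD:
  assumes "\<eta> \<in> Hom (End_cat C) F G"
  shows "NSrc \<eta> = F" "NTgt \<eta> = G" "At \<eta> \<in> extensional (Obj C)"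
    "a \<in> Obj C \<Longrightarrow> At \<eta> a \<in> Hom C (FObj F a) (FObj G a)"
    "\<lbrakk>a \<in> Obj C; b \<in> Obj C; f \<in> Hom C a b\<rbrakk> \<Longrightarrow> At \<eta> b \<odot> FMor F f = FMor G f \<odot> At \<eta> a"
  using assms by (auto simp: End_cat_def natural_def)

lemma End_HomI:
  assumes "NSrc \<eta> = F" "NTgt \<eta> = G" "At \<eta> \<in> extensional (Obj C)"
    "\<And>a. a \<in> Obj C \<Longrightarrow> At \<eta> a \<in> Hom C (FObj F a) (FObj G a)"
    "\<And>a b f. \<lbrakk>a \<in> Obj C; b \<in> Obj C; f \<in> Hom C a b\<rbrakk> \<Longrightarrow> At \<eta> b \<odot> FMor F f = FMor G f \<odot> At \<eta> a"
  shows "\<eta> \<in> Hom (End_cat C) F G"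
  using assms by (simp add: End_cat_def natural_def)

lemma End_eqI:
  assumes "\<eta> \<in> Hom (End_cat C) F G" "\<theta> \<in> Hom (End_cat C) F G"
    and "\<And>a. a \<in> Obj C \<Longrightarrow> At \<eta> a = At \<theta> a"
  shows "\<eta> = \<theta>"
proof -
  have "At \<eta> = At \<theta>"
    using End_HomD(3)[OF assms(1)] End_HomD(3)[OF assms(2)] assms(3) by (rule extensionalityI)
  then show ?thesis using End_HomD(1,2)[OF assms(1)] End_HomD(1,2)[OF assms(2)] by simp
qed

lemma End_Idm_closed:
  assumes F: "endofunctor C F"
  shows "Idm (End_cat C) F \<in> Hom (End_cat C) F F"
proof (rule End_HomI)
  fix a b f assume h: "a \<in> Obj C" "b \<in> Obj C" "f \<in> Hom C a b"
  show "At (Idm (End_cat C) F) b \<odot> FMor F f = FMor F f \<odot> At (Idm (End_cat C) F) a"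
    using h endofunctorD(1)[OF F]
    by (simp add: End_At Comp_Idm[OF _ _ endofunctorD(2)[OF F h]] Idm_Comp[OF _ _ endofunctorD(2)[OF F h]])
qed (simp_all add: End_At Idm_closed endofunctorD(1)[OF F])

lemma End_Comp_closed:
  assumes F: "endofunctor C F" and G: "endofunctor C G" and H: "endofunctor C H"
    and \<eta>: "\<eta> \<in> Hom (End_cat C) F G" and \<theta>: "\<theta> \<in> Hom (End_cat C) G H"
  shows "Comp (End_cat C) \<theta> \<eta> \<in> Hom (End_cat C) F H"
proof (rule End_HomI)
  note F1 = endofunctorD(1)[OF F] and G1 = endofunctorD(1)[OF G] and H1 = endofunctorD(1)[OF H]
  note \<eta>1 = End_HomD(4)[OF \<eta>] and \<theta>1 = End_HomD(4)[OF \<theta>]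
  {
    fix a assume "a \<in> Obj C"
    then show "At (Comp (End_cat C) \<theta> \<eta>) a \<in> Hom C (FObj F a) (FObj H a)"
      by (simp add: End_At Comp_closed[OF F1 G1 H1 \<eta>1 \<theta>1])
  next
    fix a b f assume h: "a \<in> Obj C" "b \<in> Obj C" "f \<in> Hom C a b"
    note f = endofunctorD(2)[OF F h] endofunctorD(2)[OF G h] endofunctorD(2)[OF H h]
    have "(At \<theta> b \<odot> At \<eta> b) \<odot> FMor F f = At \<theta> b \<odot> (At \<eta> b \<odot> FMor F f)"
      by (rule Comp_assoc[OF F1[OF h(1)] F1[OF h(2)] G1[OF h(2)] H1[OF h(2)] f(1) \<eta>1[OF h(2)] \<theta>1[OF h(2)]])
    also have "\<dots> = At \<theta> b \<odot> (FMor G f \<odot> At \<eta> a)"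
      using End_HomD(5)[OF \<eta> h] by simp
    also have "\<dots> = (At \<theta> b \<odot> FMor G f) \<odot> At \<eta> a"
      by (rule Comp_assoc[OF F1[OF h(1)] G1[OF h(1)] G1[OF h(2)] H1[OF h(2)] \<eta>1[OF h(1)] f(2) \<theta>1[OF h(2)], symmetric])
    also have "\<dots> = (FMor H f \<odot> At \<theta> a) \<odot> At \<eta> a"
      using End_HomD(5)[OF \<theta> h] by simp
    also have "\<dots> = FMor H f \<odot> (At \<theta> a \<odot> At \<eta> a)"
      by (rule Comp_assoc[OF F1[OF h(1)] G1[OF h(1)] H1[OF h(1)] H1[OF h(2)] \<eta>1[OF h(1)] \<theta>1[OF h(1)] f(3)])
    finally show "At (Comp (End_cat C) \<theta> \<eta>) b \<odot> FMor F f = FMor H f \<odot> At (Comp (End_cat C) \<theta> \<eta>) a"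
      using h by (simp add: End_At)
  }
qed (use End_HomD(1,2)[OF \<eta>] End_HomD(1,2)[OF \<theta>] in simp_all)

lemma End_Zerom_closed:
  assumes F: "endofunctor C F" and G: "endofunctor C G"
  shows "Zerom (End_cat C) F G \<in> Hom (End_cat C) F G"
proof (rule End_HomI)
  note F1 = endofunctorD(1)[OF F] and G1 = endofunctorD(1)[OF G]
  fix a b f assume h: "a \<in> Obj C" "b \<in> Obj C" "f \<in> Hom C a b"
  show "At (Zerom (End_cat C) F G) b \<odot> FMor F f = FMor G f \<odot> At (Zerom (End_cat C) F G) a"
    using h by (simp add: End_At Comp_Zerom[OF F1 G1 G1 endofunctorD(2)[OF G]]
        Zerom_Comp[OF F1 F1 G1 endofunctorD(2)[OF F]])
qed (simp_all add: End_At Zerom_closed endofunctorD(1)[OF F] endofunctorD(1)[OF G])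

lemma End_Plus_closed:
  assumes F: "endofunctor C F" and G: "endofunctor C G"
    and \<eta>: "\<eta> \<in> Hom (End_cat C) F G" and \<theta>: "\<theta> \<in> Hom (End_cat C) F G"
  shows "Plus (End_cat C) \<eta> \<theta> \<in> Hom (End_cat C) F G"
proof (rule End_HomI)
  note F1 = endofunctorD(1)[OF F] and G1 = endofunctorD(1)[OF G]
  note \<eta>1 = End_HomD(4)[OF \<eta>] and \<theta>1 = End_HomD(4)[OF \<theta>]
  {
    fix a assume "a \<in> Obj C"
    then show "At (Plus (End_cat C) \<eta> \<theta>) a \<in> Hom C (FObj F a) (FObj G a)"
      by (simp add: End_At Plus_closed[OF F1 G1 \<eta>1 \<theta>1])
  next
    fix a b f assume h: "a \<in> Obj C" "b \<in> Obj C" "f \<in> Hom C a b"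
    show "At (Plus (End_cat C) \<eta> \<theta>) b \<odot> FMor F f = FMor G f \<odot> At (Plus (End_cat C) \<eta> \<theta>) a"
      using h Comp_Plus_left[OF F1[OF h(1)] F1[OF h(2)] G1[OF h(2)] endofunctorD(2)[OF F h]
          \<eta>1[OF h(2)] \<theta>1[OF h(2)]]
        Comp_Plus_right[OF F1[OF h(1)] G1[OF h(1)] G1[OF h(2)] \<eta>1[OF h(1)] \<theta>1[OF h(1)]
          endofunctorD(2)[OF G h]]
      by (simp add: End_At End_HomD(5)[OF \<eta> h] End_HomD(5)[OF \<theta> h])
  }
qed (use End_HomD(1,2)[OF \<eta>] in simp_all)

lemma End_Scale_closed:
  assumes F: "endofunctor C F" and G: "endofunctor C G" and \<eta>: "\<eta> \<in> Hom (End_cat C) F G"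
  shows "Scale (End_cat C) x \<eta> \<in> Hom (End_cat C) F G"
proof (rule End_HomI)
  note F1 = endofunctorD(1)[OF F] and G1 = endofunctorD(1)[OF G]
  note \<eta>1 = End_HomD(4)[OF \<eta>]
  {
    fix a assume "a \<in> Obj C"
    then show "At (Scale (End_cat C) x \<eta>) a \<in> Hom C (FObj F a) (FObj G a)"
      by (simp add: End_At Scale_closed[OF F1 G1 \<eta>1])
  next
    fix a b f assume h: "a \<in> Obj C" "b \<in> Obj C" "f \<in> Hom C a b"
    show "At (Scale (End_cat C) x \<eta>) b \<odot> FMor F f = FMor G f \<odot> At (Scale (End_cat C) x \<eta>) a"
      using h Comp_Scale_left[OF F1[OF h(1)] F1[OF h(2)] G1[OF h(2)] endofunctorD(2)[OF F h] \<eta>1[OF h(2)]]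
        Comp_Scale_right[OF F1[OF h(1)] G1[OF h(1)] G1[OF h(2)] \<eta>1[OF h(1)] endofunctorD(2)[OF G h]]
      by (simp add: End_At End_HomD(5)[OF \<eta> h])
  }
qed (use End_HomD(1,2)[OF \<eta>] in simp_all)

text \<open>Naturality of the horizontal composite: apply F to the naturality square of \<theta>,
  then paste the square of \<eta> at the image of the morphism under G'.\<close>

lemma End_TMor_closed:
  assumes F: "endofunctor C F" and F': "endofunctor C F'" and G: "endofunctor C G"
    and G': "endofunctor C G'"
    and \<eta>: "\<eta> \<in> Hom (End_cat C) F F'" and \<theta>: "\<theta> \<in> Hom (End_cat C) G G'"
  shows "TMor (End_cat C) \<eta> \<theta> \<in> Hom (End_cat C) (comp_fctr C F G) (comp_fctr C F' G')"
proof (rule End_HomI)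
  note F1 = endofunctorD(1)[OF F] and F'1 = endofunctorD(1)[OF F']
    and G1 = endofunctorD(1)[OF G] and G'1 = endofunctorD(1)[OF G']
  note F2 = endofunctorD(2)[OF F] and F'2 = endofunctorD(2)[OF F']
    and G2 = endofunctorD(2)[OF G] and G'2 = endofunctorD(2)[OF G']
  note \<eta>1 = End_HomD(4)[OF \<eta>] and \<theta>1 = End_HomD(4)[OF \<theta>]
  note \<eta>2 = End_HomD(5)[OF \<eta>] and \<theta>2 = End_HomD(5)[OF \<theta>]
  have S: "NSrc \<eta> = F" "NTgt \<theta> = G'"
    using End_HomD(1,2)[OF \<eta>] End_HomD(1,2)[OF \<theta>] by simp_all
  {
    fix a assume a: "a \<in> Obj C"
    show "At (TMor (End_cat C) \<eta> \<theta>) a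
        \<in> Hom C (FObj (comp_fctr C F G) a) (FObj (comp_fctr C F' G') a)"
      using Comp_closed[OF F1[OF G1[OF a]] F1[OF G'1[OF a]] F'1[OF G'1[OF a]]
          F2[OF G1[OF a] G'1[OF a] \<theta>1[OF a]] \<eta>1[OF G'1[OF a]]] a
      by (simp add: End_At S)
  next
    fix a b f assume h: "a \<in> Obj C" "b \<in> Obj C" "f \<in> Hom C a b"
    note a = h(1) and b = h(2)
    have "(At \<eta> (FObj G' b) \<odot> FMor F (At \<theta> b)) \<odot> FMor F (FMor G f)
        = At \<eta> (FObj G' b) \<odot> (FMor F (At \<theta> b) \<odot> FMor F (FMor G f))"
      by (rule Comp_assoc[OF F1[OF G1[OF a]] F1[OF G1[OF b]] F1[OF G'1[OF b]] F'1[OF G'1[OF b]]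
            F2[OF G1[OF a] G1[OF b] G2[OF h]] F2[OF G1[OF b] G'1[OF b] \<theta>1[OF b]] \<eta>1[OF G'1[OF b]]])
    also have "FMor F (At \<theta> b) \<odot> FMor F (FMor G f) = FMor F (At \<theta> b \<odot> FMor G f)"
      by (rule endofunctorD(4)[OF F G1[OF a] G1[OF b] G'1[OF b] G2[OF h] \<theta>1[OF b], symmetric])
    also have "At \<theta> b \<odot> FMor G f = FMor G' f \<odot> At \<theta> a"
      by (rule \<theta>2[OF h])
    also have "FMor F (FMor G' f \<odot> At \<theta> a) = FMor F (FMor G' f) \<odot> FMor F (At \<theta> a)"
      by (rule endofunctorD(4)[OF F G1[OF a] G'1[OF a] G'1[OF b] \<theta>1[OF a] G'2[OF h]])
    also have "At \<eta> (FObj G' b) \<odot> (FMor F (FMor G' f) \<odot> FMor F (At \<theta> a))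
        = (At \<eta> (FObj G' b) \<odot> FMor F (FMor G' f)) \<odot> FMor F (At \<theta> a)"
      by (rule Comp_assoc[OF F1[OF G1[OF a]] F1[OF G'1[OF a]] F1[OF G'1[OF b]] F'1[OF G'1[OF b]]
            F2[OF G1[OF a] G'1[OF a] \<theta>1[OF a]] F2[OF G'1[OF a] G'1[OF b] G'2[OF h]]
            \<eta>1[OF G'1[OF b]], symmetric])
    also have "At \<eta> (FObj G' b) \<odot> FMor F (FMor G' f) = FMor F' (FMor G' f) \<odot> At \<eta> (FObj G' a)"
      by (rule \<eta>2[OF G'1[OF a] G'1[OF b] G'2[OF h]])
    also have "(FMor F' (FMor G' f) \<odot> At \<eta> (FObj G' a)) \<odot> FMor F (At \<theta> a)
        = FMor F' (FMor G' f) \<odot> (At \<eta> (FObj G' a) \<odot> FMor F (At \<theta> a))"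
      by (rule Comp_assoc[OF F1[OF G1[OF a]] F1[OF G'1[OF a]] F'1[OF G'1[OF a]] F'1[OF G'1[OF b]]
            F2[OF G1[OF a] G'1[OF a] \<theta>1[OF a]] \<eta>1[OF G'1[OF a]] F'2[OF G'1[OF a] G'1[OF b] G'2[OF h]]])
    finally show "At (TMor (End_cat C) \<eta> \<theta>) b \<odot> FMor (comp_fctr C F G) f
        = FMor (comp_fctr C F' G') f \<odot> At (TMor (End_cat C) \<eta> \<theta>) a"
      using h by (simp add: End_At S)
  }
qed (use End_HomD(1,2)[OF \<eta>] End_HomD(1,2)[OF \<theta>] in simp_all)

lemma strict_monoidal_category_End: "strict_monoidal_category (End_cat C)"
proof (unfold_locales, goal_cases)
  case 1 then show ?case using End_HomD(1,2) by metis
next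
  case 2 then show ?case by (simp add: End_Idm_closed)
next
  case 3 then show ?case by (simp add: End_Comp_closed)
next
  case (4 F G f)
  then have F: "endofunctor C F" and G: "endofunctor C G" by simp_all
  note 1 = endofunctorD(1)[OF F] endofunctorD(1)[OF G] End_HomD(4)[OF 4(3)]
  show ?case
    by (rule End_eqI[OF End_Comp_closed[OF F F G End_Idm_closed[OF F] 4(3)] 4(3)])
      (simp add: End_At Comp_Idm[OF 1])
next
  case (5 F G f)
  then have F: "endofunctor C F" and G: "endofunctor C G" by simp_all
  note 1 = endofunctorD(1)[OF F] endofunctorD(1)[OF G] End_HomD(4)[OF 5(3)]
  show ?case
    by (rule End_eqI[OF End_Comp_closed[OF F G G 5(3) End_Idm_closed[OF G]] 5(3)])
      (simp add: End_At Idm_Comp[OF 1])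
next
  case (6 F G H K f g h)
  then have F: "endofunctor C F" and G: "endofunctor C G" and H: "endofunctor C H"
    and K: "endofunctor C K" by simp_all
  note 1 = endofunctorD(1)[OF F] endofunctorD(1)[OF G] endofunctorD(1)[OF H] endofunctorD(1)[OF K]
    End_HomD(4)[OF 6(5)] End_HomD(4)[OF 6(6)] End_HomD(4)[OF 6(7)]
  show ?case
    by (rule End_eqI[OF End_Comp_closed[OF F G K 6(5) End_Comp_closed[OF G H K 6(6,7)]]
        End_Comp_closed[OF F H K End_Comp_closed[OF F G H 6(5,6)] 6(7)]])
      (simp add: End_At Comp_assoc[OF 1])
next
  case 7 then show ?case by (simp add: End_Zerom_closed)
next
  case 8 then show ?case by (simp add: End_Plus_closed)
next
  case 9 then show ?case by (simp add: End_Scale_closed)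
next
  case (10 F G f g)
  then have F: "endofunctor C F" and G: "endofunctor C G" by simp_all
  note 1 = endofunctorD(1)[OF F] endofunctorD(1)[OF G] End_HomD(4)[OF 10(3)] End_HomD(4)[OF 10(4)]
  show ?case
    by (rule End_eqI[OF End_Plus_closed[OF F G 10(3,4)] End_Plus_closed[OF F G 10(4,3)]])
      (simp add: End_At, rule Plus_commute[OF 1])
next
  case (11 F G f g h)
  then have F: "endofunctor C F" and G: "endofunctor C G" by simp_all
  note 1 = endofunctorD(1)[OF F] endofunctorD(1)[OF G] End_HomD(4)[OF 11(3)] End_HomD(4)[OF 11(4)]
    End_HomD(4)[OF 11(5)]
  note p = End_Plus_closed[OF F G]
  show ?case
    by (rule End_eqI[OF p[OF p[OF 11(3,4)] 11(5)] p[OF 11(3) p[OF 11(4,5)]]])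
      (simp add: End_At Plus_assoc[OF 1])
next
  case (12 F G f)
  then have F: "endofunctor C F" and G: "endofunctor C G" by simp_all
  note 1 = endofunctorD(1)[OF F] endofunctorD(1)[OF G] End_HomD(4)[OF 12(3)]
  show ?case
    by (rule End_eqI[OF End_Plus_closed[OF F G 12(3) End_Zerom_closed[OF F G]] 12(3)])
      (simp add: End_At Plus_Zerom[OF 1])
next
  case (13 F G f)
  then have F: "endofunctor C F" and G: "endofunctor C G" by simp_all
  note 1 = endofunctorD(1)[OF F] endofunctorD(1)[OF G] End_HomD(4)[OF 13(3)]
  show ?case
    by (rule End_eqI[OF End_Scale_closed[OF F G 13(3)] End_Zerom_closed[OF F G]])
      (simp add: End_At scale_zero[OF 1])
next
  case (14 F G f)
  then have F: "endofunctor C F" and G: "endofunctor C G" by simp_all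
  note 1 = endofunctorD(1)[OF F] endofunctorD(1)[OF G] End_HomD(4)[OF 14(3)]
  show ?case
    by (rule End_eqI[OF End_Scale_closed[OF F G 14(3)] 14(3)])
      (simp add: End_At scale_one[OF 1])
next
  case (15 F G f x y)
  then have F: "endofunctor C F" and G: "endofunctor C G" by simp_all
  note 1 = endofunctorD(1)[OF F] endofunctorD(1)[OF G] End_HomD(4)[OF 15(3)]
  note s = End_Scale_closed[OF F G]
  show ?case
    by (rule End_eqI[OF s[OF 15(3)] s[OF s[OF 15(3)]]]) (simp add: End_At scale_mult[OF 1])
next
  case (16 F G f x y)
  then have F: "endofunctor C F" and G: "endofunctor C G" by simp_all
  note 1 = endofunctorD(1)[OF F] endofunctorD(1)[OF G] End_HomD(4)[OF 16(3)]
  note s = End_Scale_closed[OF F G]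
  show ?case
    by (rule End_eqI[OF s[OF 16(3)] End_Plus_closed[OF F G s[OF 16(3)] s[OF 16(3)]]])
      (simp add: End_At scale_add_left[OF 1])
next
  case (17 F G f g x)
  then have F: "endofunctor C F" and G: "endofunctor C G" by simp_all
  note 1 = endofunctorD(1)[OF F] endofunctorD(1)[OF G] End_HomD(4)[OF 17(3)] End_HomD(4)[OF 17(4)]
  note s = End_Scale_closed[OF F G] and p = End_Plus_closed[OF F G]
  show ?case
    by (rule End_eqI[OF s[OF p[OF 17(3,4)]] p[OF s[OF 17(3)] s[OF 17(4)]]])
      (simp add: End_At scale_add_right[OF 1])
next
  case (18 F G H f g g')
  then have F: "endofunctor C F" and G: "endofunctor C G" and H: "endofunctor C H" by simp_all
  note 1 = endofunctorD(1)[OF F] endofunctorD(1)[OF G] endofunctorD(1)[OF H]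
    End_HomD(4)[OF 18(4)] End_HomD(4)[OF 18(5)] End_HomD(4)[OF 18(6)]
  note c = End_Comp_closed[OF F G H 18(4)]
  show ?case
    by (rule End_eqI[OF c[OF End_Plus_closed[OF G H 18(5,6)]]
        End_Plus_closed[OF F H c[OF 18(5)] c[OF 18(6)]]])
      (simp add: End_At Comp_Plus_left[OF 1])
next
  case (19 F G H f f' g)
  then have F: "endofunctor C F" and G: "endofunctor C G" and H: "endofunctor C H" by simp_all
  note 1 = endofunctorD(1)[OF F] endofunctorD(1)[OF G] endofunctorD(1)[OF H]
    End_HomD(4)[OF 19(4)] End_HomD(4)[OF 19(5)] End_HomD(4)[OF 19(6)]
  note c = End_Comp_closed[OF F G H _ 19(6)]
  show ?case
    by (rule End_eqI[OF c[OF End_Plus_closed[OF F G 19(4,5)]]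
        End_Plus_closed[OF F H c[OF 19(4)] c[OF 19(5)]]])
      (simp add: End_At Comp_Plus_right[OF 1])
next
  case (20 F G H f g x)
  then have F: "endofunctor C F" and G: "endofunctor C G" and H: "endofunctor C H" by simp_all
  note 1 = endofunctorD(1)[OF F] endofunctorD(1)[OF G] endofunctorD(1)[OF H]
    End_HomD(4)[OF 20(4)] End_HomD(4)[OF 20(5)]
  note c = End_Comp_closed[OF F G H]
  show ?case
    by (rule End_eqI[OF c[OF 20(4) End_Scale_closed[OF G H 20(5)]]
        End_Scale_closed[OF F H c[OF 20(4,5)]]])
      (simp add: End_At Comp_Scale_left[OF 1])
next
  case (21 F G H f g x)
  then have F: "endofunctor C F" and G: "endofunctor C G" and H: "endofunctor C H" by simp_all
  note 1 = endofunctorD(1)[OF F] endofunctorD(1)[OF G] endofunctorD(1)[OF H]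
    End_HomD(4)[OF 21(4)] End_HomD(4)[OF 21(5)]
  note c = End_Comp_closed[OF F G H]
  show ?case
    by (rule End_eqI[OF c[OF End_Scale_closed[OF F G 21(4)] 21(5)]
        End_Scale_closed[OF F H c[OF 21(4,5)]]])
      (simp add: End_At Comp_Scale_right[OF 1])
next
  case 22 show ?case by (simp add: endofunctor_id)
next
  case 23 then show ?case by (simp add: endofunctor_comp)
next
  case (24 F G H)
  then have F: "endofunctor C F" and G: "endofunctor C G" and H: "endofunctor C H" by simp_all
  show ?case
    unfolding End_sel
    by (rule fctr_eqI[OF endofunctor_comp[OF endofunctor_comp[OF F G] H]
        endofunctor_comp[OF F endofunctor_comp[OF G H]]])
      (simp_all add: endofunctorD(1)[OF H] endofunctor_Mor[OF H])
next
  case (25 F)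
  then have F: "endofunctor C F" by simp
  show ?case
    unfolding End_sel
    by (rule fctr_eqI[OF endofunctor_comp[OF endofunctor_id F] F])
      (simp_all add: endofunctorD(1)[OF F] endofunctor_Mor[OF F])
next
  case (26 F)
  then have F: "endofunctor C F" by simp
  show ?case
    unfolding End_sel
    by (rule fctr_eqI[OF endofunctor_comp[OF F endofunctor_id] F]) simp_all
next
  case 27 then show ?case by (simp add: End_TMor_closed)
next
  case (28 F G)
  then have F: "endofunctor C F" and G: "endofunctor C G" by simp_all
  show ?case
    unfolding End_sel
    by (rule End_eqI[OF End_TMor_closed[OF F F G G End_Idm_closed[OF F] End_Idm_closed[OF G]]
        End_Idm_closed[OF endofunctor_comp[OF F G]]])
      (simp add: End_At endofunctorD(1)[OF G] endofunctorD(3)[OF F endofunctorD(1)[OF G]]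
        Comp_Idm[OF _ _ Idm_closed] endofunctorD(1)[OF F endofunctorD(1)[OF G]])
next
  case (29 F G H F' G' H' f g f' g')
  then have F: "endofunctor C F" and G: "endofunctor C G" and H: "endofunctor C H"
    and F': "endofunctor C F'" and G': "endofunctor C G'" and H': "endofunctor C H'" by simp_all
  note f = 29(7) and g = 29(8) and f' = 29(9) and g' = 29(10)
  note F1 = endofunctorD(1)[OF F] and G1 = endofunctorD(1)[OF G] and H1 = endofunctorD(1)[OF H]
    and F'1 = endofunctorD(1)[OF F'] and G'1 = endofunctorD(1)[OF G'] and H'1 = endofunctorD(1)[OF H']
  note F2 = endofunctorD(2)[OF F] and G2 = endofunctorD(2)[OF G]
  note f1 = End_HomD(4)[OF f] and g1 = End_HomD(4)[OF g] and f'1 = End_HomD(4)[OF f']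
    and g'1 = End_HomD(4)[OF g']
  have S: "NSrc f = F" "NSrc g = G" "NTgt f' = G'" "NTgt g' = H'"
    using End_HomD(1,2)[OF f] End_HomD(1,2)[OF g] End_HomD(1,2)[OF f'] End_HomD(1,2)[OF g'] by simp_all
  show ?case
    unfolding End_sel
  proof (rule End_eqI[OF End_TMor_closed[OF F H F' H' End_Comp_closed[OF F G H f g]
        End_Comp_closed[OF F' G' H' f' g']]
        End_Comp_closed[OF endofunctor_comp[OF F F'] endofunctor_comp[OF G G'] endofunctor_comp[OF H H']
          End_TMor_closed[OF F G F' G' f f'] End_TMor_closed[OF G H G' H' g g']]])
    fix a assume a: "a \<in> Obj C"
    let ?f' = "At f' a" and ?g' = "At g' a" and ?g = "At g (FObj H' a)"
    have "(?g \<odot> At f (FObj H' a)) \<odot> FMor F (?g' \<odot> ?f')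
        = (?g \<odot> At f (FObj H' a)) \<odot> (FMor F ?g' \<odot> FMor F ?f')"
      by (simp add: endofunctorD(4)[OF F F'1[OF a] G'1[OF a] H'1[OF a] f'1[OF a] g'1[OF a]])
    also have "\<dots> = ?g \<odot> (At f (FObj H' a) \<odot> (FMor F ?g' \<odot> FMor F ?f'))"
      by (rule Comp_assoc[OF F1[OF F'1[OF a]] F1[OF H'1[OF a]] G1[OF H'1[OF a]] H1[OF H'1[OF a]]
          Comp_closed[OF F1[OF F'1[OF a]] F1[OF G'1[OF a]] F1[OF H'1[OF a]]
            F2[OF F'1[OF a] G'1[OF a] f'1[OF a]] F2[OF G'1[OF a] H'1[OF a] g'1[OF a]]]
          f1[OF H'1[OF a]] g1[OF H'1[OF a]]])
    also have "At f (FObj H' a) \<odot> (FMor F ?g' \<odot> FMor F ?f')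
        = (At f (FObj H' a) \<odot> FMor F ?g') \<odot> FMor F ?f'"
      by (rule Comp_assoc[OF F1[OF F'1[OF a]] F1[OF G'1[OF a]] F1[OF H'1[OF a]] G1[OF H'1[OF a]]
          F2[OF F'1[OF a] G'1[OF a] f'1[OF a]] F2[OF G'1[OF a] H'1[OF a] g'1[OF a]]
          f1[OF H'1[OF a]], symmetric])
    \<comment> \<open>The interchange law comes down to naturality of \<open>f\<close> at the
      component of \<open>g'\<close>.\<close>
    also have "At f (FObj H' a) \<odot> FMor F ?g' = FMor G ?g' \<odot> At f (FObj G' a)"
      by (rule End_HomD(5)[OF f G'1[OF a] H'1[OF a] g'1[OF a]])
    also have "(FMor G ?g' \<odot> At f (FObj G' a)) \<odot> FMor F ?f'
        = FMor G ?g' \<odot> (At f (FObj G' a) \<odot> FMor F ?f')"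
      by (rule Comp_assoc[OF F1[OF F'1[OF a]] F1[OF G'1[OF a]] G1[OF G'1[OF a]] G1[OF H'1[OF a]]
          F2[OF F'1[OF a] G'1[OF a] f'1[OF a]] f1[OF G'1[OF a]] G2[OF G'1[OF a] H'1[OF a] g'1[OF a]]])
    also have "?g \<odot> (FMor G ?g' \<odot> (At f (FObj G' a) \<odot> FMor F ?f'))
        = (?g \<odot> FMor G ?g') \<odot> (At f (FObj G' a) \<odot> FMor F ?f')"
      by (rule Comp_assoc[OF F1[OF F'1[OF a]] G1[OF G'1[OF a]] G1[OF H'1[OF a]] H1[OF H'1[OF a]]
          Comp_closed[OF F1[OF F'1[OF a]] F1[OF G'1[OF a]] G1[OF G'1[OF a]]
            F2[OF F'1[OF a] G'1[OF a] f'1[OF a]] f1[OF G'1[OF a]]]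
          G2[OF G'1[OF a] H'1[OF a] g'1[OF a]] g1[OF H'1[OF a]], symmetric])
    finally show "At (TMor (End_cat C) (Comp (End_cat C) g f) (Comp (End_cat C) g' f')) a
        = At (Comp (End_cat C) (TMor (End_cat C) g g') (TMor (End_cat C) f f')) a"
      using a by (simp add: End_At S H'1)
  qed
next
  case (30 F G H F' G' H' f g h)
  then have F: "endofunctor C F" and G: "endofunctor C G" and H: "endofunctor C H"
    and F': "endofunctor C F'" and G': "endofunctor C G'" and H': "endofunctor C H'" by simp_all
  note f = 30(7) and g = 30(8) and h = 30(9)
  note F1 = endofunctorD(1)[OF F] and G1 = endofunctorD(1)[OF G] and H1 = endofunctorD(1)[OF H]
    and F'1 = endofunctorD(1)[OF F'] and G'1 = endofunctorD(1)[OF G'] and H'1 = endofunctorD(1)[OF H']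
  note F2 = endofunctorD(2)[OF F] and G2 = endofunctorD(2)[OF G]
  note f1 = End_HomD(4)[OF f] and g1 = End_HomD(4)[OF g] and h1 = End_HomD(4)[OF h]
  have S: "NSrc f = F" "NSrc g = G" "NSrc h = H" "NTgt f = F'" "NTgt g = G'" "NTgt h = H'"
    using End_HomD(1,2)[OF f] End_HomD(1,2)[OF g] End_HomD(1,2)[OF h] by simp_all
  \<comment> \<open>Components can be compared only inside one hom-set, so strict associativity of
    the functors comes first.\<close>
  have T: "comp_fctr C (comp_fctr C F G) H = comp_fctr C F (comp_fctr C G H)"
    if "endofunctor C F" "endofunctor C G" "endofunctor C H" for F G H
    by (rule fctr_eqI[OF endofunctor_comp[OF endofunctor_comp[OF that(1,2)] that(3)]
        endofunctor_comp[OF that(1) endofunctor_comp[OF that(2,3)]]])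
      (simp_all add: endofunctorD(1)[OF that(3)] endofunctor_Mor[OF that(3)])
  show ?case
  proof (rule End_eqI[OF End_TMor_closed[OF endofunctor_comp[OF F G] endofunctor_comp[OF F' G'] H H'
        End_TMor_closed[OF F F' G G' f g] h, unfolded T[OF F G H] T[OF F' G' H']]
        End_TMor_closed[OF F F' endofunctor_comp[OF G H] endofunctor_comp[OF G' H'] f
        End_TMor_closed[OF G G' H H' g h]]])
    fix a assume a: "a \<in> Obj C"
    let ?h = "At h a" and ?g = "At g (FObj H' a)" and ?f = "At f (FObj G' (FObj H' a))"
    note Gh = G2[OF H1[OF a] H'1[OF a] h1[OF a]] and g = g1[OF H'1[OF a]]
    have "(?f \<odot> FMor F ?g) \<odot> FMor F (FMor G ?h) = ?f \<odot> (FMor F ?g \<odot> FMor F (FMor G ?h))"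
      by (rule Comp_assoc[OF F1[OF G1[OF H1[OF a]]] F1[OF G1[OF H'1[OF a]]] F1[OF G'1[OF H'1[OF a]]]
          F'1[OF G'1[OF H'1[OF a]]] F2[OF G1[OF H1[OF a]] G1[OF H'1[OF a]] Gh]
          F2[OF G1[OF H'1[OF a]] G'1[OF H'1[OF a]] g] f1[OF G'1[OF H'1[OF a]]]])
    also have "FMor F ?g \<odot> FMor F (FMor G ?h) = FMor F (?g \<odot> FMor G ?h)"
      by (rule endofunctorD(4)[OF F G1[OF H1[OF a]] G1[OF H'1[OF a]] G'1[OF H'1[OF a]] Gh g, symmetric])
    finally show "At (TMor (End_cat C) (TMor (End_cat C) f g) h) a
        = At (TMor (End_cat C) f (TMor (End_cat C) g h)) a"
      using a comp_fctr_Mor[OF H1[OF a] H'1[OF a] h1[OF a], of F G]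
      by (simp add: End_At S H1 H'1 G1 G'1)
  qed
next
  case (31 F G f)
  then have F: "endofunctor C F" and G: "endofunctor C G" by simp_all
  note f = 31(3)
  have T: "comp_fctr C (id_fctr C) F = F" if "endofunctor C F" for F
    by (rule fctr_eqI[OF endofunctor_comp[OF endofunctor_id that] that])
      (simp_all add: endofunctorD(1)[OF that] endofunctor_Mor[OF that])
  note 1 = endofunctorD(1)[OF F] endofunctorD(1)[OF G] End_HomD(4)[OF f]
  show ?case
    unfolding End_sel
    by (rule End_eqI[OF End_TMor_closed[OF endofunctor_id endofunctor_id F G
        End_Idm_closed[OF endofunctor_id] f, unfolded T[OF F] T[OF G]] f])
      (simp add: End_At End_HomD(2)[OF f] 1 id_fctr_Mor[OF 1] Idm_Comp[OF 1])
next
  case (32 F G f)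
  then have F: "endofunctor C F" and G: "endofunctor C G" by simp_all
  note f = 32(3)
  have T: "comp_fctr C F (id_fctr C) = F" if "endofunctor C F" for F
    by (rule fctr_eqI[OF endofunctor_comp[OF that endofunctor_id] that]) simp_all
  note 1 = endofunctorD(1)[OF F] endofunctorD(1)[OF G] End_HomD(4)[OF f]
  show ?case
    unfolding End_sel
    by (rule End_eqI[OF End_TMor_closed[OF F G endofunctor_id endofunctor_id f
        End_Idm_closed[OF endofunctor_id], unfolded T[OF F] T[OF G]] f])
      (simp add: End_At End_HomD(1)[OF f] 1 endofunctorD(3)[OF F] Comp_Idm[OF 1])
next
  case (33 F G H K f f' g)
  then have F: "endofunctor C F" and G: "endofunctor C G" and H: "endofunctor C H"
    and K: "endofunctor C K" by simp_all
  note f = 33(5) and f' = 33(6) and g = 33(7)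
  note H1 = endofunctorD(1)[OF H] and K1 = endofunctorD(1)[OF K]
  note t = End_TMor_closed[OF F G H K _ g]
  show ?case
    by (rule End_eqI[OF t[OF End_Plus_closed[OF F G f f']]
        End_Plus_closed[OF endofunctor_comp[OF F H] endofunctor_comp[OF G K] t[OF f] t[OF f']]])
      (simp add: End_At End_HomD(1)[OF f] End_HomD(1)[OF f'] End_HomD(2)[OF g] K1
        Comp_Plus_left[OF endofunctorD(1)[OF F H1] endofunctorD(1)[OF F K1] endofunctorD(1)[OF G K1]
          endofunctorD(2)[OF F H1 K1 End_HomD(4)[OF g]] End_HomD(4)[OF f K1] End_HomD(4)[OF f' K1]])
next
  case (34 F G H K f g g')
  then have F: "endofunctor C F" and G: "endofunctor C G" and H: "endofunctor C H"
    and K: "endofunctor C K" by simp_all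
  note f = 34(5) and g = 34(6) and g' = 34(7)
  note H1 = endofunctorD(1)[OF H] and K1 = endofunctorD(1)[OF K]
  note t = End_TMor_closed[OF F G H K f]
  show ?case
    by (rule End_eqI[OF t[OF End_Plus_closed[OF H K g g']]
        End_Plus_closed[OF endofunctor_comp[OF F H] endofunctor_comp[OF G K] t[OF g] t[OF g']]])
      (simp add: End_At End_HomD(1)[OF f] End_HomD(2)[OF g] End_HomD(2)[OF g']
        endofunctorD(5)[OF F H1 K1 End_HomD(4)[OF g] End_HomD(4)[OF g']]
        Comp_Plus_right[OF endofunctorD(1)[OF F H1] endofunctorD(1)[OF F K1] endofunctorD(1)[OF G K1]
          endofunctorD(2)[OF F H1 K1 End_HomD(4)[OF g]] endofunctorD(2)[OF F H1 K1 End_HomD(4)[OF g']]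
          End_HomD(4)[OF f K1]])
next
  case (35 F G H K f g x)
  then have F: "endofunctor C F" and G: "endofunctor C G" and H: "endofunctor C H"
    and K: "endofunctor C K" by simp_all
  note f = 35(5) and g = 35(6)
  note H1 = endofunctorD(1)[OF H] and K1 = endofunctorD(1)[OF K]
  note t = End_TMor_closed[OF F G H K _ g]
  show ?case
    by (rule End_eqI[OF t[OF End_Scale_closed[OF F G f]]
        End_Scale_closed[OF endofunctor_comp[OF F H] endofunctor_comp[OF G K] t[OF f]]])
      (simp add: End_At End_HomD(1)[OF f] End_HomD(2)[OF g] K1
        Comp_Scale_left[OF endofunctorD(1)[OF F H1] endofunctorD(1)[OF F K1] endofunctorD(1)[OF G K1]
          endofunctorD(2)[OF F H1 K1 End_HomD(4)[OF g]] End_HomD(4)[OF f K1]])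
next
  case (36 F G H K f g x)
  then have F: "endofunctor C F" and G: "endofunctor C G" and H: "endofunctor C H"
    and K: "endofunctor C K" by simp_all
  note f = 36(5) and g = 36(6)
  note H1 = endofunctorD(1)[OF H] and K1 = endofunctorD(1)[OF K]
  note t = End_TMor_closed[OF F G H K f]
  show ?case
    by (rule End_eqI[OF t[OF End_Scale_closed[OF H K g]]
        End_Scale_closed[OF endofunctor_comp[OF F H] endofunctor_comp[OF G K] t[OF g]]])
      (simp add: End_At End_HomD(1)[OF f] End_HomD(2)[OF g]
        endofunctorD(6)[OF F H1 K1 End_HomD(4)[OF g]]
        Comp_Scale_right[OF endofunctorD(1)[OF F H1] endofunctorD(1)[OF F K1] endofunctorD(1)[OF G K1]
          endofunctorD(2)[OF F H1 K1 End_HomD(4)[OF g]] End_HomD(4)[OF f K1]])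
qed

end

section \<open>Total operations on classes\<close>

text \<open>An ill-typed composite is read as the empty class, which makes composition associative
  without typing conditions.\<close>

definition lcomp :: "('o, 'g, 'k::{comm_ring, comm_monoid_mult}) lpresentation
    \<Rightarrow> ('o, 'g, 'k) lterm set \<Rightarrow> ('o, 'g, 'k) lterm set \<Rightarrow> ('o, 'g, 'k) lterm set" where
  "lcomp P X Y = {w. \<exists>u\<in>X. \<exists>v\<in>Y. leq P (u \<cdot> v) w}"

definition lplus :: "('o, 'g, 'k::{comm_ring, comm_monoid_mult}) lpresentation
    \<Rightarrow> ('o, 'g, 'k) lterm set \<Rightarrow> ('o, 'g, 'k) lterm set \<Rightarrow> ('o, 'g, 'k) lterm set" where
  "lplus P X Y = {w. \<exists>u\<in>X. \<exists>v\<in>Y. leq P (LPlus u v) w}"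

definition lscale :: "('o, 'g, 'k::{comm_ring, comm_monoid_mult}) lpresentation
    \<Rightarrow> 'k \<Rightarrow> ('o, 'g, 'k) lterm set \<Rightarrow> ('o, 'g, 'k) lterm set" where
  "lscale P x X = {w. \<exists>u\<in>X. leq P (LScale x u) w}"

section \<open>Laws for arbitrary sets of terms\<close>

lemma lcls_empty: "\<not> lwf P u \<Longrightarrow> lcls P u = {}"
  by (auto simp: lcls_def dest: leq_typed)

text \<open>If \<open>u \<cdot> v\<close> is ill-formed, then so is every composite of terms
  equivalent to \<open>u\<close> and \<open>v\<close>, and both sides are empty; hence there is no
  typing condition.\<close>

lemma lcls_Comp: "lcls P (u \<cdot> v) = lcomp P (lcls P u) (lcls P v)"
proof (intro equalityI subsetI)
  fix w assume "w \<in> lcls P (u \<cdot> v)"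
  then have "leq P (u \<cdot> v) w" by (simp add: lcls_def)
  moreover from leq_typed[OF this] have "leq P u u" "leq P v v" by (auto intro: leq_refl)
  ultimately show "w \<in> lcomp P (lcls P u) (lcls P v)" by (auto simp: lcomp_def lcls_def)
next
  fix w assume "w \<in> lcomp P (lcls P u) (lcls P v)"
  then obtain u' v' where h: "leq P u u'" "leq P v v'" "leq P (u' \<cdot> v') w"
    by (auto simp: lcomp_def lcls_def)
  then have "leq P (u \<cdot> v) (u' \<cdot> v')"
    using leq_typed[OF h(1)] leq_typed[OF h(2)] leq_typed[OF h(3)] by (intro leq_Comp) auto
  with h(3) show "w \<in> lcls P (u \<cdot> v)" by (auto simp: lcls_def intro: leq_trans)
qed

lemma lcls_Plus: "lcls P (LPlus u v) = lplus P (lcls P u) (lcls P v)"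
proof (intro equalityI subsetI)
  fix w assume "w \<in> lcls P (LPlus u v)"
  then have "leq P (LPlus u v) w" by (simp add: lcls_def)
  moreover from leq_typed[OF this] have "leq P u u" "leq P v v" by (auto intro: leq_refl)
  ultimately show "w \<in> lplus P (lcls P u) (lcls P v)" by (auto simp: lplus_def lcls_def)
next
  fix w assume "w \<in> lplus P (lcls P u) (lcls P v)"
  then obtain u' v' where h: "leq P u u'" "leq P v v'" "leq P (LPlus u' v') w"
    by (auto simp: lplus_def lcls_def)
  then have "leq P (LPlus u v) (LPlus u' v')"
    using leq_typed[OF h(1)] leq_typed[OF h(2)] leq_typed[OF h(3)] by (intro leq_Plus) auto
  with h(3) show "w \<in> lcls P (LPlus u v)" by (auto simp: lcls_def intro: leq_trans)
qed

lemma lcls_Scale: "lcls P (LScale x u) = lscale P x (lcls P u)"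
proof (intro equalityI subsetI)
  fix w assume "w \<in> lcls P (LScale x u)"
  then have "leq P (LScale x u) w" by (simp add: lcls_def)
  moreover from leq_typed[OF this] have "leq P u u" by (auto intro: leq_refl)
  ultimately show "w \<in> lscale P x (lcls P u)" by (auto simp: lscale_def lcls_def)
next
  fix w assume "w \<in> lscale P x (lcls P u)"
  then show "w \<in> lcls P (LScale x u)"
    by (auto simp: lscale_def lcls_def intro: leq_trans leq_Scale)
qed

text \<open>All typing facts required by the associativity rule are read off from the given
  \<open>leq\<close> derivations, which relate only well-formed terms.\<close>

lemma lcomp_assoc: "lcomp P (lcomp P X Y) Z = lcomp P X (lcomp P Y Z)"
proof (intro equalityI subsetI)
  fix w assume "w \<in> lcomp P (lcomp P X Y) Z"
  then obtain x y z p where h: "x \<in> X" "y \<in> Y" "z \<in> Z" "leq P (x \<cdot> y) p" "leq P (p \<cdot> z) w"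
    by (auto simp: lcomp_def)
  note t = leq_typed[OF h(4)] leq_typed[OF h(5)]
  have "leq P ((x \<cdot> y) \<cdot> z) (p \<cdot> z)" using t by (intro leq_Comp h(4) leq_refl) auto
  moreover have "leq P ((x \<cdot> y) \<cdot> z) (x \<cdot> (y \<cdot> z))" using t by (intro leq_Comp_assoc) auto
  ultimately have "leq P (x \<cdot> (y \<cdot> z)) w" using h(5) by (meson leq_sym leq_trans)
  moreover have "leq P (y \<cdot> z) (y \<cdot> z)" using t by (intro leq_refl) auto
  ultimately show "w \<in> lcomp P X (lcomp P Y Z)" unfolding lcomp_def using h(1-3) by blast
next
  fix w assume "w \<in> lcomp P X (lcomp P Y Z)"
  then obtain x y z p where h: "x \<in> X" "y \<in> Y" "z \<in> Z" "leq P (y \<cdot> z) p" "leq P (x \<cdot> p) w"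
    by (auto simp: lcomp_def)
  note t = leq_typed[OF h(4)] leq_typed[OF h(5)]
  have "leq P (x \<cdot> (y \<cdot> z)) (x \<cdot> p)" using t by (intro leq_Comp h(4) leq_refl) auto
  moreover have "leq P ((x \<cdot> y) \<cdot> z) (x \<cdot> (y \<cdot> z))" using t by (intro leq_Comp_assoc) auto
  ultimately have "leq P ((x \<cdot> y) \<cdot> z) w" using h(5) by (meson leq_sym leq_trans)
  moreover have "leq P (x \<cdot> y) (x \<cdot> y)" using t by (intro leq_refl) auto
  ultimately show "w \<in> lcomp P (lcomp P X Y) Z" unfolding lcomp_def using h(1-3) by blast
qed

lemma lscale_lcomp: "lcomp P (lscale P x X) Y = lscale P x (lcomp P X Y)"
proof (intro equalityI subsetI)
  fix w assume "w \<in> lcomp P (lscale P x X) Y"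
  then obtain u v p where h: "u \<in> X" "v \<in> Y" "leq P (LScale x u) p" "leq P (p \<cdot> v) w"
    by (auto simp: lcomp_def lscale_def)
  note t = leq_typed[OF h(3)] leq_typed[OF h(4)]
  have "leq P (LScale x u \<cdot> v) (p \<cdot> v)" using t by (intro leq_Comp h(3) leq_refl) auto
  moreover have "leq P (LScale x u \<cdot> v) (LScale x (u \<cdot> v))"
    using t by (intro leq_Comp_Scale_left) auto
  ultimately have "leq P (LScale x (u \<cdot> v)) w" using h(4) by (meson leq_sym leq_trans)
  moreover have "leq P (u \<cdot> v) (u \<cdot> v)" using t by (intro leq_refl) auto
  ultimately show "w \<in> lscale P x (lcomp P X Y)"
    unfolding lcomp_def lscale_def using h(1,2) by blast
next
  fix w assume "w \<in> lscale P x (lcomp P X Y)"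
  then obtain u v p where h: "u \<in> X" "v \<in> Y" "leq P (u \<cdot> v) p" "leq P (LScale x p) w"
    by (auto simp: lcomp_def lscale_def)
  note t = leq_typed[OF h(3)]
  have "leq P (LScale x u \<cdot> v) (LScale x (u \<cdot> v))"
    using t by (intro leq_Comp_Scale_left) auto
  with leq_Scale[OF h(3)] h(4) have "leq P (LScale x u \<cdot> v) w" by (meson leq_trans)
  moreover have "leq P (LScale x u) (LScale x u)" using t by (intro leq_refl) auto
  ultimately show "w \<in> lcomp P (lscale P x X) Y"
    unfolding lcomp_def lscale_def using h(1,2) by blast
qed

lemma lcomp_lscale: "lcomp P X (lscale P x Y) = lscale P x (lcomp P X Y)"
proof (intro equalityI subsetI)
  fix w assume "w \<in> lcomp P X (lscale P x Y)"
  then obtain u v p where h: "u \<in> X" "v \<in> Y" "leq P (LScale x v) p" "leq P (u \<cdot> p) w"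
    by (auto simp: lcomp_def lscale_def)
  note t = leq_typed[OF h(3)] leq_typed[OF h(4)]
  have "leq P (u \<cdot> LScale x v) (u \<cdot> p)" using t by (intro leq_Comp h(3) leq_refl) auto
  moreover have "leq P (u \<cdot> LScale x v) (LScale x (u \<cdot> v))"
    using t by (intro leq_Comp_Scale_right) auto
  ultimately have "leq P (LScale x (u \<cdot> v)) w" using h(4) by (meson leq_sym leq_trans)
  moreover have "leq P (u \<cdot> v) (u \<cdot> v)" using t by (intro leq_refl) auto
  ultimately show "w \<in> lscale P x (lcomp P X Y)"
    unfolding lcomp_def lscale_def using h(1,2) by blast
next
  fix w assume "w \<in> lscale P x (lcomp P X Y)"
  then obtain u v p where h: "u \<in> X" "v \<in> Y" "leq P (u \<cdot> v) p" "leq P (LScale x p) w"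
    by (auto simp: lcomp_def lscale_def)
  note t = leq_typed[OF h(3)]
  have "leq P (u \<cdot> LScale x v) (LScale x (u \<cdot> v))"
    using t by (intro leq_Comp_Scale_right) auto
  with leq_Scale[OF h(3)] h(4) have "leq P (u \<cdot> LScale x v) w" by (meson leq_trans)
  moreover have "leq P (LScale x v) (LScale x v)" using t by (intro leq_refl) auto
  ultimately show "w \<in> lcomp P X (lscale P x Y)"
    unfolding lcomp_def lscale_def using h(1,2) by blast
qed

lemma lscale_lscale: "lscale P x (lscale P y X) = lscale P (x * y) X"
proof (intro equalityI subsetI)
  fix w assume "w \<in> lscale P x (lscale P y X)"
  then obtain u p where h: "u \<in> X" "leq P (LScale y u) p" "leq P (LScale x p) w"
    by (auto simp: lscale_def)
  have "leq P (LScale (x * y) u) (LScale x (LScale y u))"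
    using leq_typed[OF h(2)] by (intro leq_Scale_mult) auto
  with leq_Scale[OF h(2)] h(3) have "leq P (LScale (x * y) u) w" by (meson leq_trans)
  with h(1) show "w \<in> lscale P (x * y) X" by (auto simp: lscale_def)
next
  fix w assume "w \<in> lscale P (x * y) X"
  then obtain u where h: "u \<in> X" "leq P (LScale (x * y) u) w"
    by (auto simp: lscale_def)
  have "leq P (LScale (x * y) u) (LScale x (LScale y u))"
    using leq_typed[OF h(2)] by (intro leq_Scale_mult) auto
  with h(2) have "leq P (LScale x (LScale y u)) w" by (meson leq_sym leq_trans)
  moreover have "leq P (LScale y u) (LScale y u)"
    using leq_typed[OF h(2)] by (intro leq_refl) auto
  ultimately show "w \<in> lscale P x (lscale P y X)" unfolding lscale_def using h(1) by blast
qed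

lemma lcomp_empty [simp]: "lcomp P {} X = {}" "lcomp P X {} = {}"
  by (auto simp: lcomp_def)

lemma lcls_Comp_Id: "lsrc P u = a \<Longrightarrow> lcomp P (lcls P u) (lcls P (LId a)) = lcls P u"
  unfolding lcls_Comp[symmetric]
  by (cases "lwf P u") (auto simp: lcls_empty lhom_def intro!: lcls_eqI leq_Comp_Id del: equalityI)

lemma lcls_Id_Comp: "ltgt P u = a \<Longrightarrow> lcomp P (lcls P (LId a)) (lcls P u) = lcls P u"
  unfolding lcls_Comp[symmetric]
  by (cases "lwf P u") (auto simp: lcls_empty lhom_def intro!: lcls_eqI leq_Id_Comp del: equalityI)

section \<open>Laws for well-typed classes\<close>

abbreviation PHom :: "('o, 'g, 'k::{comm_ring, comm_monoid_mult}) lpresentation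
    \<Rightarrow> 'o \<Rightarrow> 'o \<Rightarrow> ('o, 'g, 'k) lterm set set" where
  "PHom P a b \<equiv> lcls P ` lhom P a b"

lemma lcomp_closed: "X \<in> PHom P b c \<Longrightarrow> Y \<in> PHom P a b \<Longrightarrow> lcomp P X Y \<in> PHom P a c"
  by (auto simp: lhom_def lcls_Comp[symmetric])

lemma lscale_closed: "X \<in> PHom P a b \<Longrightarrow> lscale P x X \<in> PHom P a b"
  by (auto simp: lhom_def lcls_Scale[symmetric])

lemma lcomp_lId: "X \<in> PHom P a b \<Longrightarrow> lcomp P X (lcls P (LId a)) = X"
  by (auto simp: lhom_def lcls_Comp_Id)

lemma lId_lcomp: "X \<in> PHom P a b \<Longrightarrow> lcomp P (lcls P (LId b)) X = X"
  by (auto simp: lhom_def lcls_Id_Comp)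

lemma Comp_eq_lcomp:
  "X \<in> PHom P b c \<Longrightarrow> Y \<in> PHom P a b \<Longrightarrow> Comp (presented_lincat P) X Y = lcomp P X Y"
  by (auto simp: lhom_def lcls_Comp[symmetric] presented_Comp)

lemma Scale_eq_lscale: "X \<in> PHom P a b \<Longrightarrow> Scale (presented_lincat P) x X = lscale P x X"
  by (auto simp: lhom_def lcls_Scale[symmetric] presented_Scale)

lemma Plus_eq_lplus:
  "X \<in> PHom P a b \<Longrightarrow> Y \<in> PHom P a b \<Longrightarrow> Plus (presented_lincat P) X Y = lplus P X Y"
  by (auto simp: lhom_def lcls_Plus[symmetric] presented_Plus)

lemma lscale_one: "X \<in> PHom P a b \<Longrightarrow> lscale P 1 X = X"
  by (auto simp: lhom_def lcls_Scale[symmetric] intro!: lcls_eqI leq_Scale_one del: equalityI)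

lemma lscale_add: "X \<in> PHom P a b \<Longrightarrow> lscale P (x + y) X = lplus P (lscale P x X) (lscale P y X)"
  by (auto simp: lhom_def lcls_Scale[symmetric] lcls_Plus[symmetric]
      intro!: lcls_eqI leq_Scale_add_left del: equalityI)

text \<open>\<open>X\<close> occurs twice on the right, where two different elements of an arbitrary
  set could be picked. Unlike associativity, distributivity is therefore stated for classes.\<close>

lemma lcomp_lplus:
  "\<lbrakk>X \<in> PHom P b c; Y \<in> PHom P a b; Z \<in> PHom P a b\<rbrakk>
    \<Longrightarrow> lcomp P X (lplus P Y Z) = lplus P (lcomp P X Y) (lcomp P X Z)"
  by (auto simp: lhom_def lcls_Comp[symmetric] lcls_Plus[symmetric]
      intro!: lcls_eqI leq_Comp_Plus_right del: equalityI)

lemma lplus_lcomp: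
  "\<lbrakk>X \<in> PHom P b c; Y \<in> PHom P b c; Z \<in> PHom P a b\<rbrakk>
    \<Longrightarrow> lcomp P (lplus P X Y) Z = lplus P (lcomp P X Z) (lcomp P Y Z)"
  by (auto simp: lhom_def lcls_Comp[symmetric] lcls_Plus[symmetric]
      intro!: lcls_eqI leq_Comp_Plus_left del: equalityI)

lemma lplus_assoc:
  "\<lbrakk>X \<in> PHom P a b; Y \<in> PHom P a b; Z \<in> PHom P a b\<rbrakk>
    \<Longrightarrow> lplus P (lplus P X Y) Z = lplus P X (lplus P Y Z)"
  by (auto simp: lhom_def lcls_Plus[symmetric] intro!: lcls_eqI leq_Plus_assoc del: equalityI)

lemma lplus_commute:
  "\<lbrakk>X \<in> PHom P a b; Y \<in> PHom P a b\<rbrakk> \<Longrightarrow> lplus P X Y = lplus P Y X"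
  by (auto simp: lhom_def lcls_Plus[symmetric] intro!: lcls_eqI leq_Plus_commute del: equalityI)

text \<open>The scalar -1 provides additive inverses: K + (-1) K = (1 - 1) K, which is the zero
  morphism.\<close>

lemma lplus_neg:
  assumes X: "X \<in> PHom P a b" and K: "K \<in> PHom P a b"
  shows "lplus P (lplus P X K) (lscale P (- 1) K) = X"
    and "lplus P (lplus P X (lscale P (- 1) K)) K = X"
proof -
  obtain x k where xk: "X = lcls P x" "K = lcls P k" "x \<in> lhom P a b" "k \<in> lhom P a b"
    using X K by blast
  have "leq P (LPlus x (LScale 0 k)) (LPlus x (LZero a b))"
    using xk(3,4) by (intro leq_Plus leq_refl leq_Scale_zero) (auto simp: lhom_def)
  from lcls_eqI[OF leq_trans[OF this leq_Plus_Zero[OF xk(3)]]]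
  have z: "lplus P X (lscale P 0 K) = X" by (simp add: xk(1,2) lcls_Plus lcls_Scale)
  have "lplus P K (lscale P (- 1) K) = lplus P (lscale P 1 K) (lscale P (- 1) K)"
    by (simp only: lscale_one[OF K])
  also have "\<dots> = lscale P 0 K" by (simp only: lscale_add[OF K, symmetric] add.right_inverse)
  finally have k: "lplus P K (lscale P (- 1) K) = lscale P 0 K" .
  note K' = lscale_closed[OF K, of "- 1"]
  show "lplus P (lplus P X K) (lscale P (- 1) K) = X"
    by (simp only: lplus_assoc[OF X K K'] k z)
  show "lplus P (lplus P X (lscale P (- 1) K)) K = X"
    by (simp only: lplus_assoc[OF X K' K] lplus_commute[OF K' K] k z)
qed

text \<open>This removes equal skein corrections from the two sides of an equation.\<close>

lemma lplus_cancel: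
  assumes "X \<in> PHom P a b" "Y \<in> PHom P a b" "K \<in> PHom P a b" "lplus P X K = lplus P Y K"
  shows "X = Y"
  by (rule trans[OF lplus_neg(1)[OF assms(1,3), symmetric]])
    (simp only: assms(4) lplus_neg(1)[OF assms(2,3)])

section \<open>Words in the crossings\<close>

text \<open>Uniqueness of inverses evaluates the definite description in \<open>unit_inv\<close>.
  Only laws of a commutative monoid enter, so the zero ring is covered.\<close>

lemma unit_inv_right:
  fixes u :: "'k::{comm_ring, comm_monoid_mult}"
  assumes "u dvd 1"
  shows "u * unit_inv u = 1"
proof -
  from assms obtain v where "1 = u * v" by (rule dvdE)
  then have v: "u * v = 1" by (rule sym)
  have "unit_inv u = v"
    unfolding unit_inv_def
  proof (rule the_equality)
    show "u * v = 1" by (rule v)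
  next
    fix w assume w: "u * w = 1"
    have "w = w * (u * v)" by (simp only: v mult.right_neutral)
    also have "\<dots> = (u * w) * v" by (simp only: mult.assoc mult.commute mult.left_commute)
    finally show "w = v" by (simp only: w mult.left_neutral)
  qed
  then show ?thesis by (simp only: v)
qed

text \<open>\<delta> is a parameter constrained by an equation, because t - t^-1 may have several
  quotients by z when z is a zero divisor.\<close>

locale iquantum_brauer =
  fixes q t \<delta> :: "'k::{comm_ring, comm_monoid_mult}"
  assumes q_unit: "q dvd 1" and t_unit: "t dvd 1"
    and \<delta>: "\<delta> * (q - unit_inv q) = t - unit_inv t"
begin

abbreviation P :: "(nat, ib_gen, 'k) lpresentation" where "P \<equiv> ib_pres q t \<delta>"

abbreviation comp :: "'k ib_term set \<Rightarrow> 'k ib_term set \<Rightarrow> 'k ib_term set"  (infixr "\<diamondop>" 70)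
  where "X \<diamondop> Y \<equiv> lcomp P X Y"

abbreviation sc :: "'k \<Rightarrow> 'k ib_term set \<Rightarrow> 'k ib_term set" where "sc \<equiv> lscale P"

abbreviation z :: 'k where "z \<equiv> q - unit_inv q"

definition E :: "nat \<Rightarrow> 'k ib_term set" where "E n = lcls P (LId n)"

text \<open>The Boolean sign lets one lemma cover a statement and its mirror image, in which every
  crossing is inverted. An index out of range gives the empty class.\<close>

definition S :: "nat \<Rightarrow> bool \<Rightarrow> nat \<Rightarrow> 'k ib_term set" where
  "S n e i = lcls P (LGen (if e then Sig n i else SigInv n i))"

definition CU :: "nat \<Rightarrow> 'k ib_term set" where "CU n = lcls P (LGen (Cup n))"
definition CA :: "nat \<Rightarrow> 'k ib_term set" where "CA n = lcls P (LGen (Cap n))"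

definition W :: "nat \<Rightarrow> bool \<Rightarrow> nat list \<Rightarrow> 'k ib_term set" where
  "W n e is = foldr (\<lambda>i f. S n e i \<diamondop> f) is (E n)"

lemma P_simps [simp]: "Gens P = ib_gens" "GSrc P = ib_src" "GTgt P = ib_tgt"
  "Rels P = ib_rel q t \<delta>"
  by (simp_all add: ib_pres_def)

lemma gens_simps [simp]:
  "Cup n \<in> ib_gens" "Cap n \<in> ib_gens"
  "Sig n i \<in> ib_gens \<longleftrightarrow> 1 \<le> i \<and> i < n" "SigInv n i \<in> ib_gens \<longleftrightarrow> 1 \<le> i \<and> i < n"
  by (auto simp: ib_gens_def)

lemma S_closed: "1 \<le> i \<Longrightarrow> i < n \<Longrightarrow> S n e i \<in> PHom P n n"
  by (auto simp: S_def lhom_def)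

lemma S_empty: "\<not> (1 \<le> i \<and> i < n) \<Longrightarrow> S n e i = {}"
  by (auto simp: S_def lcls_empty del: equalityI)

lemma CU_closed: "m = n + 2 \<Longrightarrow> CU n \<in> PHom P n m"
  by (auto simp: CU_def lhom_def)

lemma CA_closed: "m = n + 2 \<Longrightarrow> CA n \<in> PHom P m n"
  by (auto simp: CA_def lhom_def)

lemma E_closed: "E n \<in> PHom P n n"
  by (auto simp: E_def lhom_def)

lemma rel:
  assumes "ib_rel q t \<delta> u v" "lwf P u" "lwf P v" "lsrc P u = lsrc P v" "ltgt P u = ltgt P v"
  shows "lcls P u = lcls P v"
  using assms by (intro lcls_eqI leq_rel[of P u v "lsrc P u" "ltgt P u"]) (auto simp: lhom_def)

text \<open>Words are kept associated to the right, where the left side of a rewrite rule is no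
  subterm once further letters follow. \<open>ext2\<close> and \<open>ext3\<close> supply the rules
  with a tail \<open>Z\<close>.\<close>

lemma ext2: "X \<diamondop> Y = R \<Longrightarrow> X \<diamondop> (Y \<diamondop> Z) = R \<diamondop> Z"
  using lcomp_assoc[of P X Y Z] by simp

lemma ext3: "X \<diamondop> (Y \<diamondop> V) = R \<Longrightarrow> X \<diamondop> (Y \<diamondop> (V \<diamondop> Z)) = R \<diamondop> Z"
  using lcomp_assoc[of P X "Y \<diamondop> V" Z] lcomp_assoc[of P Y V Z] by simp

lemmas assocs = lcomp_assoc lscale_lcomp lcomp_lscale lscale_lscale

lemma E_left [simp]:
  "E n \<diamondop> E n = E n" "E n \<diamondop> S n e i = S n e i" "E n \<diamondop> CA n = CA n"
  by (simp_all add: E_def S_def CA_def lcls_Id_Comp)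

lemma E_left_CU [simp]: "m = n + 2 \<Longrightarrow> E m \<diamondop> CU n = CU n"
  by (simp add: E_def CU_def lcls_Id_Comp)

lemma E_right [simp]: "S n e i \<diamondop> E n = S n e i" "CU n \<diamondop> E n = CU n"
  by (simp_all add: E_def S_def CU_def lcls_Comp_Id)

lemma E_right_CA [simp]: "m = n + 2 \<Longrightarrow> CA n \<diamondop> E m = CA n"
  by (simp add: E_def CA_def lcls_Comp_Id)

lemmas E_ext [simp] = E_left[THEN ext2] E_left_CU[THEN ext2] E_right[THEN ext2] E_right_CA[THEN ext2]

section \<open>Braid relations with signs\<close>

lemma S_inverse: "1 \<le> i \<Longrightarrow> i < n \<Longrightarrow> e' = (\<not> e) \<Longrightarrow> S n e i \<diamondop> S n e' i = E n"
  using rel[OF ib_rel.intros(1), of n i] rel[OF ib_rel.intros(2), of n i]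
  by (cases e) (simp_all add: S_def E_def lcls_Comp)

lemmas S_inverse' = S_inverse[THEN ext2]

lemma S_commute:
  assumes "i + 1 < j \<or> j + 1 < i"
  shows "S n e i \<diamondop> S n e' j = S n e' j \<diamondop> S n e i"
proof (cases "1 \<le> i \<and> i < n \<and> 1 \<le> j \<and> j < n")
  case True
  then have i: "1 \<le> i" "i < n" and j: "1 \<le> j" "j < n" by auto
  have pp: "S n True i \<diamondop> S n True j = S n True j \<diamondop> S n True i"
    using rel[OF ib_rel.intros(4)[OF assms, of q t \<delta> n]] True by (simp add: S_def lcls_Comp)
  \<comment> \<open>What commutes with a positive crossing commutes with its inverse. Applied to one
    factor at a time, this turns the imposed positive case into all four sign patterns.\<close>
  have c1: "S n False a \<diamondop> X = X \<diamondop> S n False a"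
    if "S n True a \<diamondop> X = X \<diamondop> S n True a" "X \<diamondop> E n = X" "E n \<diamondop> X = X" "1 \<le> a" "a < n" for a X
  proof -
    have "S n False a \<diamondop> X = S n False a \<diamondop> (X \<diamondop> (S n True a \<diamondop> S n False a))"
      using that(2,4,5) by (simp add: S_inverse)
    also have "\<dots> = S n False a \<diamondop> ((S n True a \<diamondop> X) \<diamondop> S n False a)"
      by (simp only: that(1) lcomp_assoc)
    also have "\<dots> = X \<diamondop> S n False a"
      using that(4,5) by (simp add: lcomp_assoc S_inverse' that(3)[THEN ext2])
    finally show ?thesis .
  qed
  have mp: "S n False i \<diamondop> S n True j = S n True j \<diamondop> S n False i"
    by (rule c1[OF pp _ _ i]) simp_all
  have pm: "S n False j \<diamondop> S n True i = S n True i \<diamondop> S n False j"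
    by (rule c1[OF pp[symmetric] _ _ j]) simp_all
  have mm: "S n False j \<diamondop> S n False i = S n False i \<diamondop> S n False j"
    by (rule c1[OF mp[symmetric] _ _ j]) simp_all
  show ?thesis using pp mp pm mm by (cases e; cases e') simp_all
next
  case False
  then show ?thesis by (auto simp: S_empty del: equalityI)
qed

lemmas S_commute' = S_commute[THEN ext2, unfolded lcomp_assoc]

text \<open>Each variant is the braid relation multiplied by inverses. The letters are abstract so
  that \<open>S_braid\<close> can use the lemma with the two letters exchanged.\<close>

lemma braid_signs:
  assumes inv: "a \<diamondop> A = E n" "A \<diamondop> a = E n" "b \<diamondop> B = E n" "B \<diamondop> b = E n"
    and un: "E n \<diamondop> a = a" "E n \<diamondop> b = b" "E n \<diamondop> A = A" "E n \<diamondop> B = B"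
      "a \<diamondop> E n = a" "b \<diamondop> E n = b" "A \<diamondop> E n = A" "B \<diamondop> E n = B"
    and br: "a \<diamondop> b \<diamondop> a = b \<diamondop> a \<diamondop> b"
  shows "b \<diamondop> a \<diamondop> B = A \<diamondop> b \<diamondop> a" "A \<diamondop> B \<diamondop> A = B \<diamondop> A \<diamondop> B" "B \<diamondop> A \<diamondop> b = a \<diamondop> B \<diamondop> A"
proof -
  note simps = lcomp_assoc inv un inv[THEN ext2] un[THEN ext2]
  have "A \<diamondop> (a \<diamondop> b \<diamondop> a) \<diamondop> B = A \<diamondop> (b \<diamondop> a \<diamondop> b) \<diamondop> B" by (simp only: br)
  then show 1: "b \<diamondop> a \<diamondop> B = A \<diamondop> b \<diamondop> a" by (simp add: simps)
  have "(A \<diamondop> B) \<diamondop> (b \<diamondop> a \<diamondop> B) \<diamondop> A = (A \<diamondop> B) \<diamondop> (A \<diamondop> b \<diamondop> a) \<diamondop> A" by (simp only: 1)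
  then have 2: "B \<diamondop> A = A \<diamondop> B \<diamondop> A \<diamondop> b" by (simp add: simps)
  have "(B \<diamondop> A) \<diamondop> B = (A \<diamondop> B \<diamondop> A \<diamondop> b) \<diamondop> B" by (simp only: 2)
  then show "A \<diamondop> B \<diamondop> A = B \<diamondop> A \<diamondop> B" by (simp add: simps)
  have "a \<diamondop> (B \<diamondop> A) = a \<diamondop> (A \<diamondop> B \<diamondop> A \<diamondop> b)" by (simp only: 2)
  then show "B \<diamondop> A \<diamondop> b = a \<diamondop> B \<diamondop> A" by (simp add: simps)
qed

text \<open>Two neighbouring crossings of equal sign carry one strand entirely over or entirely
  under two others, so a crossing of these two, of any sign \<open>e'\<close>, passes
  through.\<close>

lemma S_braid:
  assumes "1 \<le> i" "i + 1 < n"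
  shows "S n e (i + 1) \<diamondop> S n e i \<diamondop> S n e' (i + 1) = S n e' i \<diamondop> S n e (i + 1) \<diamondop> S n e i"
    and "S n e i \<diamondop> S n e (i + 1) \<diamondop> S n e' i = S n e' (i + 1) \<diamondop> S n e i \<diamondop> S n e (i + 1)"
proof -
  have br: "S n True i \<diamondop> S n True (i + 1) \<diamondop> S n True i
      = S n True (i + 1) \<diamondop> S n True i \<diamondop> S n True (i + 1)"
    using rel[OF ib_rel.intros(3)[of q t \<delta> n i]] assms by (simp add: S_def lcls_Comp)
  note 1 = braid_signs[of "S n True i" "S n False i" n "S n True (i + 1)" "S n False (i + 1)", OF _ _ _ _ _ _ _ _ _ _ _ _ br]
  note 2 = braid_signs[of "S n True (i + 1)" "S n False (i + 1)" n "S n True i" "S n False i", OF _ _ _ _ _ _ _ _ _ _ _ _ br[symmetric]]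
  show "S n e (i + 1) \<diamondop> S n e i \<diamondop> S n e' (i + 1) = S n e' i \<diamondop> S n e (i + 1) \<diamondop> S n e i"
    using 1 br assms by (cases e; cases e') (simp_all add: S_inverse)
  show "S n e i \<diamondop> S n e (i + 1) \<diamondop> S n e' i = S n e' (i + 1) \<diamondop> S n e i \<diamondop> S n e (i + 1)"
    using 2 br assms by (cases e; cases e') (simp_all add: S_inverse)
qed

section \<open>Words of constant sign\<close>

lemma W_Nil [simp]: "W n e [] = E n"
  by (simp add: W_def)

lemma W_Cons [simp]: "W n e (i # is) = S n e i \<diamondop> W n e is"
  by (simp add: W_def)

lemma E_W [simp]: "E n \<diamondop> W n e is = W n e is"
  by (cases "is") simp_all

lemmas E_W' [simp] = E_W[THEN ext2]

lemma W_append: "W n e (is @ js) = W n e is \<diamondop> W n e js"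
  by (induction "is") (simp_all add: lcomp_assoc)

lemma W_E [simp]: "W n e is \<diamondop> E n = W n e is"
  using W_append[of n e "is" "[]"] by simp

lemma W_closed: "\<forall>i\<in>set is. 1 \<le> i \<and> i < n \<Longrightarrow> W n e is \<in> PHom P n n"
  by (induction "is") (auto simp: E_closed intro!: lcomp_closed S_closed)

lemma W_inverse:
  "\<forall>i\<in>set is. 1 \<le> i \<and> i < n \<Longrightarrow> e' = (\<not> e) \<Longrightarrow> W n e is \<diamondop> W n e' (rev is) = E n"
proof (induction "is")
  case (Cons i "is")
  have "W n e (i # is) \<diamondop> W n e' (rev (i # is))
      = S n e i \<diamondop> (W n e is \<diamondop> W n e' (rev is)) \<diamondop> S n e' i"
    by (simp add: W_append lcomp_assoc)
  also have "W n e is \<diamondop> W n e' (rev is) = E n" using Cons by simp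
  also have "S n e i \<diamondop> E n \<diamondop> S n e' i = E n" using Cons by (simp add: S_inverse)
  finally show ?case .
qed simp

lemma W_commute_S:
  "\<forall>i\<in>set is. i + 1 < j \<or> j + 1 < i \<Longrightarrow> W n e is \<diamondop> S n e' j = S n e' j \<diamondop> W n e is"
proof (induction "is")
  case (Cons i "is")
  then have "W n e (i # is) \<diamondop> S n e' j = S n e i \<diamondop> S n e' j \<diamondop> W n e is"
    by (simp add: lcomp_assoc)
  also have "\<dots> = S n e' j \<diamondop> S n e i \<diamondop> W n e is"
    using Cons.prems by (intro S_commute') simp
  finally show ?case by simp
qed simp

text \<open>\<open>U n e a b\<close> is \<open>\<sigma>\<^sub>a \<cdots> \<sigma>\<^bsub>b-1\<^esub>\<close> and \<open>D n e a b\<close> is \<open>\<sigma>\<^bsub>b-1\<^esub> \<cdots> \<sigma>\<^sub>a\<close>, with sign \<open>e\<close>.\<close>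

abbreviation U :: "nat \<Rightarrow> bool \<Rightarrow> nat \<Rightarrow> nat \<Rightarrow> 'k ib_term set" where "U n e a b \<equiv> W n e [a..<b]"
abbreviation D :: "nat \<Rightarrow> bool \<Rightarrow> nat \<Rightarrow> nat \<Rightarrow> 'k ib_term set" where "D n e a b \<equiv> W n e (rev [a..<b])"

lemma U_first: "a < b \<Longrightarrow> U n e a b = S n e a \<diamondop> U n e (Suc a) b"
  by (simp add: upt_conv_Cons)

lemma U_last: "a \<le> b \<Longrightarrow> U n e a (Suc b) = U n e a b \<diamondop> S n e b"
  by (simp add: W_append)

lemma D_last: "a < b \<Longrightarrow> D n e a b = D n e (Suc a) b \<diamondop> S n e a"
  by (simp add: upt_conv_Cons W_append)

lemma D_first: "a \<le> b \<Longrightarrow> D n e a (Suc b) = S n e b \<diamondop> D n e a b"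
  by simp

lemma U_inverse: "1 \<le> a \<Longrightarrow> b \<le> n \<Longrightarrow> e' = (\<not> e) \<Longrightarrow> U n e a b \<diamondop> D n e' a b = E n"
  by (rule W_inverse) auto

lemma D_inverse: "1 \<le> a \<Longrightarrow> b \<le> n \<Longrightarrow> e' = (\<not> e) \<Longrightarrow> D n e a b \<diamondop> U n e' a b = E n"
  using W_inverse[of "rev [a..<b]" n e' e] by auto

lemma upt_split3: "a \<le> i \<Longrightarrow> i + 1 < b \<Longrightarrow> [a..<b] = [a..<i] @ [i, i + 1] @ [i + 2..<b]"
  using upt_add_eq_append[of a i "b - i"] by (simp add: upt_conv_Cons[of i] upt_conv_Cons[of "Suc i"])

text \<open>The word carries one strand past the others with constant sign, so a crossing of those
  others slides through. Only the letters i + 1 and i interact with it, by a braid relation; the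
  lower letters commute with it before its index drops, the higher ones after.\<close>

lemma D_slide_S:
  assumes "1 \<le> a" "a \<le> i" "i + 1 < b" "b \<le> n"
  shows "D n e a b \<diamondop> S n e' (i + 1) = S n e' i \<diamondop> D n e a b"
proof -
  let ?X = "W n e (rev [i + 2..<b])" and ?Y = "W n e (rev [a..<i])"
  have D: "D n e a b = ?X \<diamondop> S n e (i + 1) \<diamondop> S n e i \<diamondop> ?Y"
    by (subst upt_split3[OF assms(2,3)]) (simp add: W_append lcomp_assoc)
  have "D n e a b \<diamondop> S n e' (i + 1) = ?X \<diamondop> S n e (i + 1) \<diamondop> S n e i \<diamondop> (?Y \<diamondop> S n e' (i + 1))"
    by (simp only: D lcomp_assoc)
  also have "?Y \<diamondop> S n e' (i + 1) = S n e' (i + 1) \<diamondop> ?Y" by (rule W_commute_S) auto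
  also have "S n e (i + 1) \<diamondop> S n e i \<diamondop> S n e' (i + 1) \<diamondop> ?Y
      = S n e' i \<diamondop> S n e (i + 1) \<diamondop> S n e i \<diamondop> ?Y"
    using S_braid(1)[of i n e e', THEN ext3] assms by (simp add: lcomp_assoc)
  also have "?X \<diamondop> S n e' i \<diamondop> S n e (i + 1) \<diamondop> S n e i \<diamondop> ?Y
      = S n e' i \<diamondop> ?X \<diamondop> S n e (i + 1) \<diamondop> S n e i \<diamondop> ?Y"
    using W_commute_S[of "rev [i + 2..<b]" i n e e', THEN ext2] by (simp add: lcomp_assoc)
  finally show ?thesis by (simp only: D)
qed

lemma U_slide_S:
  assumes "1 \<le> a" "a \<le> i" "i + 1 < b" "b \<le> n"
  shows "U n e a b \<diamondop> S n e' i = S n e' (i + 1) \<diamondop> U n e a b"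
proof -
  let ?X = "W n e [i + 2..<b]" and ?Y = "W n e [a..<i]"
  have D: "U n e a b = ?Y \<diamondop> S n e i \<diamondop> S n e (i + 1) \<diamondop> ?X"
    by (subst upt_split3[OF assms(2,3)]) (simp add: W_append lcomp_assoc)
  have "U n e a b \<diamondop> S n e' i = ?Y \<diamondop> S n e i \<diamondop> S n e (i + 1) \<diamondop> (?X \<diamondop> S n e' i)"
    by (simp only: D lcomp_assoc)
  also have "?X \<diamondop> S n e' i = S n e' i \<diamondop> ?X" by (rule W_commute_S) auto
  also have "S n e i \<diamondop> S n e (i + 1) \<diamondop> S n e' i \<diamondop> ?X
      = S n e' (i + 1) \<diamondop> S n e i \<diamondop> S n e (i + 1) \<diamondop> ?X"
    using S_braid(2)[of i n e e', THEN ext3] assms by (simp add: lcomp_assoc)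
  also have "?Y \<diamondop> S n e' (i + 1) \<diamondop> S n e i \<diamondop> S n e (i + 1) \<diamondop> ?X
      = S n e' (i + 1) \<diamondop> ?Y \<diamondop> S n e i \<diamondop> S n e (i + 1) \<diamondop> ?X"
    using W_commute_S[of "[a..<i]" "i + 1" n e e', THEN ext2] by (simp add: lcomp_assoc)
  finally show ?thesis by (simp only: D)
qed

lemma D_slide_W:
  assumes "1 \<le> a" "b \<le> n"
  shows "\<forall>i\<in>set is. a \<le> i \<and> i + 1 < b \<Longrightarrow> W n e' is \<diamondop> D n e a b = D n e a b \<diamondop> W n e' (map Suc is)"
proof (induction "is")
  case (Cons i "is")
  then have "W n e' (i # is) \<diamondop> D n e a b = (S n e' i \<diamondop> D n e a b) \<diamondop> W n e' (map Suc is)"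
    by (simp add: lcomp_assoc)
  also have "S n e' i \<diamondop> D n e a b = D n e a b \<diamondop> S n e' (i + 1)"
    using D_slide_S[of a i b n e e'] Cons.prems assms by simp
  finally show ?case by (simp add: lcomp_assoc)
qed simp

lemma U_slide_W:
  assumes "1 \<le> a" "b \<le> n"
  shows "\<forall>i\<in>set is. a \<le> i \<and> i + 1 < b \<Longrightarrow> U n e a b \<diamondop> W n e' is = W n e' (map Suc is) \<diamondop> U n e a b"
proof (induction "is")
  case (Cons i "is")
  then have "U n e a b \<diamondop> W n e' (i # is) = S n e' (Suc i) \<diamondop> U n e a b \<diamondop> W n e' is"
    using U_slide_S[of a i b n e e', THEN ext2] assms by (simp add: lcomp_assoc)
  also have "U n e a b \<diamondop> W n e' is = W n e' (map Suc is) \<diamondop> U n e a b"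
    using Cons by simp
  finally show ?case by (simp add: lcomp_assoc)
qed simp

text \<open>Interval form of the slides. The bound \<open>d + 1 \<le> b\<close> leaves room for the
  letters shifted up by one.\<close>

lemma U_D_slide:
  assumes "1 \<le> a" "a \<le> c" "d + 1 \<le> b" "b \<le> n"
  shows "U n e' c d \<diamondop> D n e a b = D n e a b \<diamondop> U n e' (Suc c) (Suc d)"
    and "D n e' c d \<diamondop> D n e a b = D n e a b \<diamondop> D n e' (Suc c) (Suc d)"
    and "U n e a b \<diamondop> U n e' c d = U n e' (Suc c) (Suc d) \<diamondop> U n e a b"
    and "U n e a b \<diamondop> D n e' c d = D n e' (Suc c) (Suc d) \<diamondop> U n e a b"
  using assms D_slide_W[of a b n "[c..<d]"] D_slide_W[of a b n "rev [c..<d]"]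
    U_slide_W[of a b n "[c..<d]"] U_slide_W[of a b n "rev [c..<d]"]
  by (simp_all add: map_Suc_upt rev_map[symmetric])

section \<open>Crossings passing the cup and the cap of B\<close>

lemma CU_S: "N = n + 2 \<Longrightarrow> j = i + 2 \<Longrightarrow> 1 \<le> i \<Longrightarrow> S N e j \<diamondop> CU n = CU n \<diamondop> S n e i"
proof (cases "i < n")
  case True
  assume h: "N = n + 2" "j = i + 2" "1 \<le> i"
  have p: "S N True j \<diamondop> CU n = CU n \<diamondop> S n True i"
    using rel[OF ib_rel.intros(6)[of q t \<delta> n i]] True h by (simp add: S_def CU_def lcls_Comp)
  \<comment> \<open>Conjugation with inverse letters gives the negative sign. For i at least n both
    sides of the claim are empty, which is the remaining case.\<close>
  have "S N False j \<diamondop> (CU n \<diamondop> S n True i) \<diamondop> S n False i = CU n \<diamondop> S n False i"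
    using h True by (simp only: p[symmetric]) (simp add: lcomp_assoc S_inverse' )
  then have "S N False j \<diamondop> CU n = CU n \<diamondop> S n False i"
    using h True by (simp add: lcomp_assoc S_inverse)
  with p show ?thesis by (cases e) simp_all
qed (simp add: S_empty)

lemma CA_S: "N = n + 2 \<Longrightarrow> j = i + 2 \<Longrightarrow> 1 \<le> i \<Longrightarrow> CA n \<diamondop> S N e j = S n e i \<diamondop> CA n"
proof (cases "i < n")
  case True
  assume h: "N = n + 2" "j = i + 2" "1 \<le> i"
  have p: "CA n \<diamondop> S N True j = S n True i \<diamondop> CA n"
    using rel[OF ib_rel.intros(7)[of q t \<delta> n i]] True h by (simp add: S_def CA_def lcls_Comp)
  have "S n False i \<diamondop> (S n True i \<diamondop> CA n) \<diamondop> S N False j = S n False i \<diamondop> CA n"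
    using h True by (simp only: p[symmetric]) (simp add: lcomp_assoc S_inverse)
  then have "CA n \<diamondop> S N False j = S n False i \<diamondop> CA n"
    using h True by (simp add: lcomp_assoc S_inverse')
  with p show ?thesis by (cases e) simp_all
qed (simp add: S_empty)

lemma CU_W: "N = n + 2 \<Longrightarrow> \<forall>i\<in>set is. 1 \<le> i \<Longrightarrow> W N e (map (\<lambda>i. i + 2) is) \<diamondop> CU n = CU n \<diamondop> W n e is"
proof (induction "is")
  case (Cons i "is")
  then have "W N e (map (\<lambda>i. i + 2) (i # is)) \<diamondop> CU n = (S N e (i + 2) \<diamondop> CU n) \<diamondop> W n e is"
    by (simp add: lcomp_assoc)
  also have "S N e (i + 2) \<diamondop> CU n = CU n \<diamondop> S n e i" using Cons.prems by (intro CU_S) auto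
  finally show ?case by (simp add: lcomp_assoc)
qed simp

lemma CA_W: "N = n + 2 \<Longrightarrow> \<forall>i\<in>set is. 1 \<le> i \<Longrightarrow> CA n \<diamondop> W N e (map (\<lambda>i. i + 2) is) = W n e is \<diamondop> CA n"
proof (induction "is")
  case (Cons i "is")
  then have "CA n \<diamondop> W N e (map (\<lambda>i. i + 2) (i # is)) = S n e i \<diamondop> CA n \<diamondop> W N e (map (\<lambda>i. i + 2) is)"
    using CA_S[of N n "i + 2" i e, THEN ext2] by (simp add: lcomp_assoc)
  also have "CA n \<diamondop> W N e (map (\<lambda>i. i + 2) is) = W n e is \<diamondop> CA n" using Cons by simp
  finally show ?case by (simp add: lcomp_assoc)
qed simp

lemma map_add2_upt: "map (\<lambda>i. i + 2) [a..<b] = [a + 2..<b + 2]"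
proof -
  have "map (\<lambda>i. i + 2) [a..<b] = map Suc (map Suc [a..<b])" by simp
  also have "\<dots> = [a + 2..<b + 2]" by (simp only: map_Suc_upt) simp
  finally show ?thesis .
qed

lemma cup_cap_UD:
  assumes "N = n + 2" "a' = a + 2" "b' = b + 2" "1 \<le> a"
  shows "U N e a' b' \<diamondop> CU n = CU n \<diamondop> U n e a b" "D N e a' b' \<diamondop> CU n = CU n \<diamondop> D n e a b"
    "CA n \<diamondop> U N e a' b' = U n e a b \<diamondop> CA n" "CA n \<diamondop> D N e a' b' = D n e a b \<diamondop> CA n"
  unfolding assms(1-3) map_add2_upt[symmetric] rev_map
  using assms(4) by (intro CU_W CA_W refl; force)+

section \<open>Derived relations in the iquantum Brauer category\<close>

abbreviation qs :: "bool \<Rightarrow> 'k" where "qs e \<equiv> if e then q else unit_inv q"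
abbreviation ts :: "bool \<Rightarrow> 'k" where "ts e \<equiv> if e then t else unit_inv t"

lemma q_inv: "q * unit_inv q = 1" "unit_inv q * q = 1"
  using unit_inv_right[OF q_unit] by (simp_all add: mult.commute)

lemma t_inv: "t * unit_inv t = 1" "unit_inv t * t = 1"
  using unit_inv_right[OF t_unit] by (simp_all add: mult.commute)

section \<open>Curls, the skein relation and loops\<close>

lemma S1_CU: "N = n + 2 \<Longrightarrow> S N e 1 \<diamondop> CU n = sc (qs e) (CU n)"
proof -
  assume N: "N = n + 2"
  have p: "S N True 1 \<diamondop> CU n = sc q (CU n)"
    using rel[OF ib_rel.intros(10)[of q t \<delta> n]] N
    by (simp add: S_def CU_def lcls_Comp lcls_Scale)
  have "CU n = S N False 1 \<diamondop> (S N True 1 \<diamondop> CU n)"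
    using N by (simp add: S_inverse')
  also have "\<dots> = sc q (S N False 1 \<diamondop> CU n)" by (simp only: p lcomp_lscale)
  \<comment> \<open>Applying the inverse crossing to the imposed curl relation gives cup = q times
    the negative curl, and q is a unit.\<close>
  finally have "sc (unit_inv q) (CU n) = sc (unit_inv q) (sc q (S N False 1 \<diamondop> CU n))" by (rule arg_cong)
  also have "\<dots> = sc 1 (S N False 1 \<diamondop> CU n)" by (simp only: lscale_lscale q_inv)
  also have "\<dots> = S N False 1 \<diamondop> CU n"
    using N by (intro lscale_one[of _ P n N] lcomp_closed[OF S_closed CU_closed]) simp_all
  finally show ?thesis using p by (cases e) simp_all
qed

lemma CA_S1: "N = n + 2 \<Longrightarrow> CA n \<diamondop> S N e 1 = sc (qs e) (CA n)"
proof -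
  assume N: "N = n + 2"
  have p: "CA n \<diamondop> S N True 1 = sc q (CA n)"
    using rel[OF ib_rel.intros(9)[of q t \<delta> n]] N
    by (simp add: S_def CA_def lcls_Comp lcls_Scale)
  have "CA n = (CA n \<diamondop> S N True 1) \<diamondop> S N False 1"
    using N by (simp add: lcomp_assoc S_inverse)
  also have "\<dots> = sc q (CA n \<diamondop> S N False 1)" by (simp only: p lscale_lcomp)
  finally have "sc (unit_inv q) (CA n) = sc (unit_inv q) (sc q (CA n \<diamondop> S N False 1))" by (rule arg_cong)
  also have "\<dots> = sc 1 (CA n \<diamondop> S N False 1)" by (simp only: lscale_lscale q_inv)
  also have "\<dots> = CA n \<diamondop> S N False 1"
    using N by (intro lscale_one[of _ P N n] lcomp_closed[OF CA_closed S_closed]) simp_all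
  finally show ?thesis using p by (cases e) simp_all
qed

lemma skein:
  assumes "1 \<le> i" "i < n"
  shows "S n True i = lplus P (S n False i) (sc z (E n))"
proof -
  have r: "lplus P (S n True i) (sc (- 1) (S n False i)) = sc z (E n)"
    using rel[OF ib_rel.intros(5)[of q t \<delta> n i]] assms
    by (simp add: S_def E_def lcls_Plus lcls_Scale)
  have "S n True i = lplus P (sc z (E n)) (S n False i)"
    using lplus_neg(2)[OF S_closed[OF assms, of True] S_closed[OF assms, of False]] by (simp only: r)
  also have "\<dots> = lplus P (S n False i) (sc z (E n))"
    by (rule lplus_commute[OF lscale_closed[OF E_closed] S_closed[OF assms]])
  finally show ?thesis .
qed

text \<open>The correction term is the same word with the crossing deleted, so every later change of
  sign requires a comparison of such shorter words.\<close>

lemma skein_insert: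
  assumes X: "X \<in> PHom P n m" and Y: "Y \<in> PHom P l n" and i: "1 \<le> i" "i < n"
  shows "X \<diamondop> S n True i \<diamondop> Y = lplus P (X \<diamondop> S n False i \<diamondop> Y) (sc z (X \<diamondop> Y))"
proof -
  note Si = S_closed[OF i, of False] and zE = lscale_closed[OF E_closed, of z n]
  have "X \<diamondop> S n True i \<diamondop> Y = X \<diamondop> lplus P (S n False i \<diamondop> Y) (sc z (E n) \<diamondop> Y)"
    by (simp only: skein[OF i] lplus_lcomp[OF Si zE Y])
  also have "\<dots> = lplus P (X \<diamondop> S n False i \<diamondop> Y) (X \<diamondop> sc z (E n) \<diamondop> Y)"
    by (rule lcomp_lplus[OF X lcomp_closed[OF Si Y] lcomp_closed[OF zE Y]])
  also have "X \<diamondop> sc z (E n) \<diamondop> Y = sc z (X \<diamondop> Y)"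
    by (simp only: lscale_lcomp lcomp_lscale E_def lId_lcomp[OF Y])
  finally show ?thesis .
qed

text \<open>Interchanging the signs of two crossings produces the same correction term \<open>z\<close> on both sides.\<close>

lemma skein_swap:
  assumes X: "X \<in> PHom P n m" and M: "M \<in> PHom P n n" and Y: "Y \<in> PHom P l n"
    and i: "1 \<le> i" "i < n" and j: "1 \<le> j" "j < n"
    and eq: "X \<diamondop> S n True i \<diamondop> M \<diamondop> Y = X \<diamondop> M \<diamondop> S n True j \<diamondop> Y"
  shows "X \<diamondop> S n False i \<diamondop> M \<diamondop> S n True j \<diamondop> Y = X \<diamondop> S n True i \<diamondop> M \<diamondop> S n False j \<diamondop> Y"
proof (rule lplus_cancel)
  note Si = S_closed[OF i] and Sj = S_closed[OF j]
  show "X \<diamondop> S n False i \<diamondop> M \<diamondop> S n True j \<diamondop> Y \<in> PHom P l m"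
    "X \<diamondop> S n True i \<diamondop> M \<diamondop> S n False j \<diamondop> Y \<in> PHom P l m"
    "sc z (X \<diamondop> M \<diamondop> S n True j \<diamondop> Y) \<in> PHom P l m"
    by (intro lscale_closed lcomp_closed[OF X] lcomp_closed[OF Si] lcomp_closed[OF M]
        lcomp_closed[OF Sj] Y)+
  have "lplus P (X \<diamondop> S n False i \<diamondop> M \<diamondop> S n True j \<diamondop> Y) (sc z (X \<diamondop> M \<diamondop> S n True j \<diamondop> Y))
      = X \<diamondop> S n True i \<diamondop> M \<diamondop> S n True j \<diamondop> Y"
    by (rule skein_insert[OF X lcomp_closed[OF M lcomp_closed[OF Sj Y]] i, symmetric])
  also have "\<dots> = (X \<diamondop> S n True i \<diamondop> M) \<diamondop> S n True j \<diamondop> Y"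
    by (simp only: lcomp_assoc)
  also have "\<dots> = lplus P ((X \<diamondop> S n True i \<diamondop> M) \<diamondop> S n False j \<diamondop> Y) (sc z ((X \<diamondop> S n True i \<diamondop> M) \<diamondop> Y))"
    by (rule skein_insert[OF lcomp_closed[OF X lcomp_closed[OF Si M]] Y j])
  also have "\<dots> = lplus P (X \<diamondop> S n True i \<diamondop> M \<diamondop> S n False j \<diamondop> Y) (sc z (X \<diamondop> M \<diamondop> S n True j \<diamondop> Y))"
    by (simp only: lcomp_assoc eq)
  finally show "lplus P (X \<diamondop> S n False i \<diamondop> M \<diamondop> S n True j \<diamondop> Y) (sc z (X \<diamondop> M \<diamondop> S n True j \<diamondop> Y))
    = lplus P (X \<diamondop> S n True i \<diamondop> M \<diamondop> S n False j \<diamondop> Y) (sc z (X \<diamondop> M \<diamondop> S n True j \<diamondop> Y))" .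
qed

lemma CA_CU: "CA n \<diamondop> CU n = sc \<delta> (E n)"
  using rel[OF ib_rel.intros(8)[of q t \<delta> n]] by (simp add: CA_def CU_def E_def lcls_Comp lcls_Scale)

lemma CA_S2_CU:
  assumes N: "N = n + 2" and n: "1 \<le> n"
  shows "CA n \<diamondop> S N e 2 \<diamondop> CU n = sc (ts e) (E n)"
proof -
  have p: "CA n \<diamondop> S N True 2 \<diamondop> CU n = sc t (E n)"
    using rel[OF ib_rel.intros(11)[OF n, of q t \<delta>]] N n
    by (simp add: S_def CA_def CU_def E_def lcls_Comp lcls_Scale)
  have 2: "1 \<le> (2::nat)" "2 < N" using N n by simp_all
  \<comment> \<open>The divisibility hypothesis, read as t^-1 = t - z \<delta>, makes the negative
    loop equal to t^-1: the skein correction is z times cap cup = \<delta>.\<close>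
  have d: "t = unit_inv t + z * \<delta>" using \<delta> by (simp add: mult.commute)
  have "CA n \<diamondop> S N False 2 \<diamondop> CU n = sc (unit_inv t) (E n)"
  proof (rule lplus_cancel)
    show "CA n \<diamondop> S N False 2 \<diamondop> CU n \<in> PHom P n n"
      by (rule lcomp_closed[OF CA_closed[OF N] lcomp_closed[OF S_closed[OF 2] CU_closed[OF N]]])
    show "sc (unit_inv t) (E n) \<in> PHom P n n" "sc z (CA n \<diamondop> CU n) \<in> PHom P n n"
      by (intro lscale_closed E_closed lcomp_closed[OF CA_closed[OF N] CU_closed[OF N]])+
    have "lplus P (CA n \<diamondop> S N False 2 \<diamondop> CU n) (sc z (CA n \<diamondop> CU n)) = sc t (E n)"
      by (simp only: skein_insert[OF CA_closed[OF N] CU_closed[OF N] 2, symmetric] p)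
    also have "\<dots> = lplus P (sc (unit_inv t) (E n)) (sc z (CA n \<diamondop> CU n))"
      by (subst d) (simp only: lscale_add[OF E_closed] CA_CU lscale_lscale)
    finally show "lplus P (CA n \<diamondop> S N False 2 \<diamondop> CU n) (sc z (CA n \<diamondop> CU n))
      = lplus P (sc (unit_inv t) (E n)) (sc z (CA n \<diamondop> CU n))" .
  qed
  with p show ?thesis by (cases e) simp_all
qed

section \<open>Four-strand relations in all sign patterns\<close>

lemma S_3_CU: "N = n + 2 \<Longrightarrow> S N e 3 \<diamondop> CU n = CU n \<diamondop> S n e 1"
  by (rule CU_S) simp_all

lemma CA_S_3: "N = n + 2 \<Longrightarrow> CA n \<diamondop> S N e 3 = S n e 1 \<diamondop> CA n"
  by (rule CA_S) simp_all

lemma S_braid_123: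
  assumes "4 \<le> N"
  shows "S N e 2 \<diamondop> S N e 1 \<diamondop> S N e' 2 = S N e' 1 \<diamondop> S N e 2 \<diamondop> S N e 1"
    "S N e 1 \<diamondop> S N e 2 \<diamondop> S N e' 1 = S N e' 2 \<diamondop> S N e 1 \<diamondop> S N e 2"
    "S N e 3 \<diamondop> S N e 2 \<diamondop> S N e' 3 = S N e' 2 \<diamondop> S N e 3 \<diamondop> S N e 2"
    "S N e 2 \<diamondop> S N e 3 \<diamondop> S N e' 2 = S N e' 3 \<diamondop> S N e 2 \<diamondop> S N e 3"
  using S_braid[of 1 N] S_braid[of 2 N] assms by (simp_all add: eval_nat_numeral)

text \<open>Rewriting the conjugate of a crossing by \<sigma>_2 as a conjugate of \<sigma>_2 brings
  the outer letters next to the cup and the cap, where they cancel as crossings on n strands or as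
  the scalars q and q^-1. Both words having the same value is what permits exchanging the signs of
  crossings 1 and 3 in \<open>cap_twist_cup\<close>.\<close>

lemma CA_braid_CU:
  assumes N: "N = n + 2" and n: "2 \<le> n"
  shows "CA n \<diamondop> S N e 2 \<diamondop> S N e' 3 \<diamondop> S N (\<not> e) 2 \<diamondop> CU n = sc (ts e') (E n)"
    and "CA n \<diamondop> S N e 2 \<diamondop> S N e' 1 \<diamondop> S N (\<not> e) 2 \<diamondop> CU n = sc (ts e') (E n)"
proof -
  have i: "1 \<le> (1::nat)" "1 < n" using n by simp_all
  \<comment> \<open>The sign of the middle letter equals that of one of its neighbours, so for
    either value of \<open>e'\<close> one of the two signed braid relations applies.\<close>
  have b3: "S N e 2 \<diamondop> S N e' 3 \<diamondop> S N (\<not> e) 2 = S N (\<not> e) 3 \<diamondop> S N e' 2 \<diamondop> S N e 3"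
    using S_braid_123(4)[of N e "\<not> e"] S_braid_123(3)[of N "\<not> e" e] N n
    by (cases "e' = e") auto
  have b1: "S N e 2 \<diamondop> S N e' 1 \<diamondop> S N (\<not> e) 2 = S N (\<not> e) 1 \<diamondop> S N e' 2 \<diamondop> S N e 1"
    using S_braid_123(1)[of N e "\<not> e"] S_braid_123(2)[of N "\<not> e" e] N n
    by (cases "e' = e") auto
  have "CA n \<diamondop> S N e 2 \<diamondop> S N e' 3 \<diamondop> S N (\<not> e) 2 \<diamondop> CU n
      = CA n \<diamondop> S N (\<not> e) 3 \<diamondop> S N e' 2 \<diamondop> S N e 3 \<diamondop> CU n"
    using b3[THEN ext3] by (simp only: lcomp_assoc)
  also have "\<dots> = S n (\<not> e) 1 \<diamondop> (CA n \<diamondop> S N e' 2 \<diamondop> CU n) \<diamondop> S n e 1"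
    by (simp only: S_3_CU[OF N] CA_S_3[OF N, THEN ext2] lcomp_assoc)
  also have "\<dots> = sc (ts e') (S n (\<not> e) 1 \<diamondop> S n e 1)"
    using n by (simp only: CA_S2_CU[OF N] lscale_lcomp lcomp_lscale E_left)
  also have "S n (\<not> e) 1 \<diamondop> S n e 1 = E n" using i by (simp add: S_inverse)
  finally show "CA n \<diamondop> S N e 2 \<diamondop> S N e' 3 \<diamondop> S N (\<not> e) 2 \<diamondop> CU n = sc (ts e') (E n)" .
  have "CA n \<diamondop> S N e 2 \<diamondop> S N e' 1 \<diamondop> S N (\<not> e) 2 \<diamondop> CU n
      = CA n \<diamondop> S N (\<not> e) 1 \<diamondop> S N e' 2 \<diamondop> S N e 1 \<diamondop> CU n"
    using b1[THEN ext3] by (simp only: lcomp_assoc)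
  also have "\<dots> = sc (qs (\<not> e) * qs e) (CA n \<diamondop> S N e' 2 \<diamondop> CU n)"
    by (simp only: S1_CU[OF N] CA_S1[OF N, THEN ext2] assocs mult.commute)
  also have "qs (\<not> e) * qs e = 1" using q_inv by simp
  also have "sc 1 (CA n \<diamondop> S N e' 2 \<diamondop> CU n) = sc (ts e') (E n)"
    using n by (simp only: CA_S2_CU[OF N] lscale_lscale mult_1)
  finally show "CA n \<diamondop> S N e 2 \<diamondop> S N e' 1 \<diamondop> S N (\<not> e) 2 \<diamondop> CU n = sc (ts e') (E n)" .
qed

lemma S13: "S N e 1 \<diamondop> S N e' 3 = S N e' 3 \<diamondop> S N e 1"
  by (rule S_commute) simp

text \<open>The single relation with \<open>\<sigma>\<^sub>2\<sigma>\<^sub>3\<sigma>\<^sub>1\<^sup>-\<^sup>1\<sigma>\<^sub>2\<^sup>-\<^sup>1\<close> imposed in the presentation yields all four sign patterns.\<close>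

lemma cap_twist_cup:
  assumes N: "N = n + 2" and n: "n = m + 2"
  shows "CA n \<diamondop> S N (\<not> e) 2 \<diamondop> S N (\<not> e) 3 \<diamondop> S N e 1 \<diamondop> S N e 2 \<diamondop> CU n = CU m \<diamondop> CA m" (is ?up)
    and "CA n \<diamondop> S N (\<not> e) 2 \<diamondop> S N (\<not> e) 1 \<diamondop> S N e 3 \<diamondop> S N e 2 \<diamondop> CU n = CU m \<diamondop> CA m" (is ?down)
proof -
  have n2: "2 \<le> n" and n1: "1 \<le> n" using n by simp_all
  have 1: "1 \<le> (1::nat)" "1 < N" and 2: "1 \<le> (2::nat)" "2 < N" and 3: "1 \<le> (3::nat)" "3 < N"
    using N n by simp_all
  note CA = CA_closed[OF N] and CU = CU_closed[OF N]
  note S1 = S_closed[OF 1] and S2 = S_closed[OF 2] and S3 = S_closed[OF 3]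
  have G: "CA n \<diamondop> S N True 2 \<diamondop> S N True 3 \<diamondop> S N False 1 \<diamondop> S N False 2 \<diamondop> CU n = CU m \<diamondop> CA m"
    using rel[OF ib_rel.intros(12)[OF n2, of q t \<delta>]] N n
    by (simp add: S_def CA_def CU_def lcls_Comp)
  \<comment> \<open>Exchange the signs of the two letters \<sigma>_2. With either of them deleted,
    \<sigma>_1^-1 is absorbed as q^-1, \<sigma>_3 leaves through the cup or the cap as \<sigma>_1,
    and the remaining cap \<sigma>_2 cup is the scalar t, which commutes with it.\<close>
  have down: "CA n \<diamondop> S N False 2 \<diamondop> (S N True 3 \<diamondop> S N False 1) \<diamondop> S N True 2 \<diamondop> CU n
      = CA n \<diamondop> S N True 2 \<diamondop> (S N True 3 \<diamondop> S N False 1) \<diamondop> S N False 2 \<diamondop> CU n"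
  proof (rule skein_swap[OF CA lcomp_closed[OF S3 S1] CU 2 2])
    have "CA n \<diamondop> S N True 2 \<diamondop> (S N True 3 \<diamondop> S N False 1) \<diamondop> CU n
        = sc (unit_inv q) ((CA n \<diamondop> S N True 2 \<diamondop> CU n) \<diamondop> S n True 1)"
      by (simp only: lcomp_assoc S1_CU[OF N] lcomp_lscale S_3_CU[OF N] if_False)
    also have "(CA n \<diamondop> S N True 2 \<diamondop> CU n) \<diamondop> S n True 1 = S n True 1 \<diamondop> (CA n \<diamondop> S N True 2 \<diamondop> CU n)"
      by (simp only: CA_S2_CU[OF N n1] lscale_lcomp lcomp_lscale E_left E_right)
    also have "sc (unit_inv q) (S n True 1 \<diamondop> (CA n \<diamondop> S N True 2 \<diamondop> CU n))
        = CA n \<diamondop> (S N True 3 \<diamondop> S N False 1) \<diamondop> S N True 2 \<diamondop> CU n"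
      by (simp only: S13[symmetric] lcomp_assoc CA_S1[OF N, THEN ext2] CA_S_3[OF N, THEN ext2]
          lscale_lcomp lcomp_lscale if_False)
    finally show "CA n \<diamondop> S N True 2 \<diamondop> (S N True 3 \<diamondop> S N False 1) \<diamondop> CU n
      = CA n \<diamondop> (S N True 3 \<diamondop> S N False 1) \<diamondop> S N True 2 \<diamondop> CU n" .
  qed
  then have D1: "CA n \<diamondop> S N False 2 \<diamondop> S N True 3 \<diamondop> S N False 1 \<diamondop> S N True 2 \<diamondop> CU n = CU m \<diamondop> CA m"
    by (simp only: lcomp_assoc G)
  \<comment> \<open>Exchange the signs of the crossings 3 and 1. With either one deleted, a
    conjugated positive crossing between cap and cup remains, and both have the value t.\<close>
  have sw: "CA n \<diamondop> S N e 2 \<diamondop> S N False 3 \<diamondop> S N True 1 \<diamondop> S N (\<not> e) 2 \<diamondop> CU n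
      = CA n \<diamondop> S N e 2 \<diamondop> S N True 3 \<diamondop> S N False 1 \<diamondop> S N (\<not> e) 2 \<diamondop> CU n" for e
  proof -
    have "(CA n \<diamondop> S N e 2) \<diamondop> S N False 3 \<diamondop> E N \<diamondop> S N True 1 \<diamondop> (S N (\<not> e) 2 \<diamondop> CU n)
      = (CA n \<diamondop> S N e 2) \<diamondop> S N True 3 \<diamondop> E N \<diamondop> S N False 1 \<diamondop> (S N (\<not> e) 2 \<diamondop> CU n)"
    proof (rule skein_swap[OF lcomp_closed[OF CA S2] E_closed lcomp_closed[OF S2 CU] 3 1])
      show "(CA n \<diamondop> S N e 2) \<diamondop> S N True 3 \<diamondop> E N \<diamondop> (S N (\<not> e) 2 \<diamondop> CU n)
        = (CA n \<diamondop> S N e 2) \<diamondop> E N \<diamondop> S N True 1 \<diamondop> (S N (\<not> e) 2 \<diamondop> CU n)"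
        by (simp only: lcomp_assoc E_ext E_left CA_braid_CU[OF N n2])
    qed
    then show ?thesis by (simp only: lcomp_assoc E_ext E_left)
  qed
  have D2: "CA n \<diamondop> S N False 2 \<diamondop> S N False 3 \<diamondop> S N True 1 \<diamondop> S N True 2 \<diamondop> CU n = CU m \<diamondop> CA m"
    using sw[of False] D1 by simp
  have D3: "CA n \<diamondop> S N True 2 \<diamondop> S N False 3 \<diamondop> S N True 1 \<diamondop> S N False 2 \<diamondop> CU n = CU m \<diamondop> CA m"
    using sw[of True] G by simp
  show ?up using G D2 by (cases e) simp_all
  have "S N (\<not> e) 1 \<diamondop> S N e 3 \<diamondop> S N e 2 \<diamondop> CU n = S N e 3 \<diamondop> S N (\<not> e) 1 \<diamondop> S N e 2 \<diamondop> CU n"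
    by (simp only: S13[THEN ext2] lcomp_assoc)
  then show ?down using D1 D3 by (cases e) simp_all
qed

text \<open>Moving the two leftmost inverse letters across turns the imposed relation into
  \<sigma>_3 \<sigma>_2 Y = \<sigma>_1 \<sigma>_2 Y. In this form the signs can be flipped one at a
  time: flipping \<sigma>_2 leaves \<sigma>_3 Y = \<sigma>_1 Y, where both sides are q Y, and
  flipping the outer letters leaves the same \<sigma>_2^-1 Y on both sides.\<close>

lemma twist_cup_cup:
  assumes n': "n' = n + 2" and N: "N = n + 4"
  shows "S N (\<not> e) 2 \<diamondop> S N (\<not> e) 1 \<diamondop> S N e 3 \<diamondop> S N e 2 \<diamondop> CU n' \<diamondop> CU n = CU n' \<diamondop> CU n"
proof -
  let ?Y = "CU n' \<diamondop> CU n"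
  have N': "N = n' + 2" using n' N by simp
  have 1: "1 \<le> (1::nat)" "1 < N" and 2: "1 \<le> (2::nat)" "2 < N" and 3: "1 \<le> (3::nat)" "3 < N"
    using N by simp_all
  have Y: "?Y \<in> PHom P n N"
    by (rule lcomp_closed[OF CU_closed[OF N'] CU_closed[OF n']])
  have G: "S N False 2 \<diamondop> S N False 1 \<diamondop> S N True 3 \<diamondop> S N True 2 \<diamondop> ?Y = ?Y"
    using rel[OF ib_rel.intros(14)[of q t \<delta> n]] N n'
    by (simp add: S_def CU_def lcls_Comp)
  have "S N True 1 \<diamondop> S N True 2 \<diamondop> (S N False 2 \<diamondop> S N False 1 \<diamondop> S N True 3 \<diamondop> S N True 2 \<diamondop> ?Y)
      = S N True 1 \<diamondop> S N True 2 \<diamondop> ?Y" by (simp only: G)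
  then have pp: "S N True 3 \<diamondop> S N True 2 \<diamondop> ?Y = S N True 1 \<diamondop> S N True 2 \<diamondop> ?Y"
    using 1 2 by (simp add: S_inverse')
  have h: "S N True 3 \<diamondop> ?Y = S N True 1 \<diamondop> ?Y"
    by (simp only: S_3_CU[OF N', THEN ext2] S1_CU[OF n'] S1_CU[OF N', THEN ext2] lcomp_assoc
        lcomp_lscale lscale_lcomp)
  have pm: "S N True 3 \<diamondop> S N False 2 \<diamondop> ?Y = S N True 1 \<diamondop> S N False 2 \<diamondop> ?Y"
  proof (rule lplus_cancel)
    show "S N True 3 \<diamondop> S N False 2 \<diamondop> ?Y \<in> PHom P n N" "S N True 1 \<diamondop> S N False 2 \<diamondop> ?Y \<in> PHom P n N"
      "sc z (S N True 1 \<diamondop> ?Y) \<in> PHom P n N"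
      using lcomp_closed[OF S_closed[OF 3] lcomp_closed[OF S_closed[OF 2] Y]]
        lcomp_closed[OF S_closed[OF 1] lcomp_closed[OF S_closed[OF 2] Y]]
        lscale_closed[OF lcomp_closed[OF S_closed[OF 1] Y]] by blast+
    show "lplus P (S N True 3 \<diamondop> S N False 2 \<diamondop> ?Y) (sc z (S N True 1 \<diamondop> ?Y))
      = lplus P (S N True 1 \<diamondop> S N False 2 \<diamondop> ?Y) (sc z (S N True 1 \<diamondop> ?Y))"
      using skein_insert[OF S_closed[OF 3] Y 2, of True] skein_insert[OF S_closed[OF 1] Y 2, of True]
      by (simp only: pp h)
  qed
  have mm: "S N False 3 \<diamondop> S N False 2 \<diamondop> ?Y = S N False 1 \<diamondop> S N False 2 \<diamondop> ?Y"
  proof (rule lplus_cancel)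
    note Y' = lcomp_closed[OF S_closed[OF 2] Y, of False]
    show "S N False 3 \<diamondop> S N False 2 \<diamondop> ?Y \<in> PHom P n N" "S N False 1 \<diamondop> S N False 2 \<diamondop> ?Y \<in> PHom P n N"
      "sc z (S N False 2 \<diamondop> ?Y) \<in> PHom P n N"
      using lcomp_closed[OF S_closed[OF 3] Y'] lcomp_closed[OF S_closed[OF 1] Y']
        lscale_closed[OF Y'] by blast+
    show "lplus P (S N False 3 \<diamondop> S N False 2 \<diamondop> ?Y) (sc z (S N False 2 \<diamondop> ?Y))
      = lplus P (S N False 1 \<diamondop> S N False 2 \<diamondop> ?Y) (sc z (S N False 2 \<diamondop> ?Y))"
    proof -
      have "S N True i \<diamondop> S N False 2 \<diamondop> ?Y
        = lplus P (S N False i \<diamondop> S N False 2 \<diamondop> ?Y) (sc z (S N False 2 \<diamondop> ?Y))"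
        if "1 \<le> i" "i < N" for i
        using skein_insert[OF E_closed Y' that] by (simp only: E_ext E_left)
      from this[OF 3] this[OF 1] pm show ?thesis by (simp only:)
    qed
  qed
  have "S N True 2 \<diamondop> S N True 1 \<diamondop> S N False 3 \<diamondop> S N False 2 \<diamondop> ?Y = ?Y"
    unfolding mm using 1 2 N' by (simp add: S_inverse')
  with G show ?thesis by (cases e) simp_all
qed

text \<open>The dual argument starts from the negative pattern, since the imposed relation
  rearranges to X \<sigma>_2^-1 \<sigma>_3^-1 = X \<sigma>_2^-1 \<sigma>_1^-1. The skein relation
  then only adds equal terms: first the last letter becomes positive, then \<sigma>_2.\<close>

lemma cap_cap_twist:
  assumes n': "n' = n + 2" and N: "N = n + 4"
  shows "CA n \<diamondop> CA n' \<diamondop> S N (\<not> e) 2 \<diamondop> S N (\<not> e) 3 \<diamondop> S N e 1 \<diamondop> S N e 2 = CA n \<diamondop> CA n'"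
proof -
  let ?X = "CA n \<diamondop> CA n'"
  have N': "N = n' + 2" using n' N by simp
  have 1: "1 \<le> (1::nat)" "1 < N" and 2: "1 \<le> (2::nat)" "2 < N" and 3: "1 \<le> (3::nat)" "3 < N"
    using N by simp_all
  have X: "?X \<in> PHom P N n"
    by (rule lcomp_closed[OF CA_closed[OF n'] CA_closed[OF N']])
  have G: "?X \<diamondop> S N False 2 \<diamondop> S N False 3 \<diamondop> S N True 1 \<diamondop> S N True 2 = ?X"
    using rel[OF ib_rel.intros(13)[of q t \<delta> n]] N n'
    by (simp add: S_def CA_def lcls_Comp lcomp_assoc)
  have "(?X \<diamondop> S N False 2 \<diamondop> S N False 3 \<diamondop> S N True 1 \<diamondop> S N True 2) \<diamondop> S N False 2 \<diamondop> S N False 1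
      = ?X \<diamondop> S N False 2 \<diamondop> S N False 1" by (simp only: G)
  then have mm: "?X \<diamondop> S N False 2 \<diamondop> S N False 3 = ?X \<diamondop> S N False 2 \<diamondop> S N False 1"
    using 1 2 by (simp add: S_inverse S_inverse' lcomp_assoc)
  have h: "?X \<diamondop> S N e 3 = ?X \<diamondop> S N e 1" for e
    by (simp only: CA_S_3[OF N'] CA_S1[OF n'] CA_S1[OF N'] CA_S1[OF n', THEN ext2] lcomp_assoc
        lcomp_lscale lscale_lcomp)
  note X' = lcomp_closed[OF X S_closed[OF 2], of False]
  have mp: "?X \<diamondop> S N False 2 \<diamondop> S N True 3 = ?X \<diamondop> S N False 2 \<diamondop> S N True 1"
    using skein_insert[OF X' E_closed 3] skein_insert[OF X' E_closed 1] mm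
    by (simp only: lcomp_assoc E_right)
  have "?X \<diamondop> S N True 2 \<diamondop> S N True 3 = ?X \<diamondop> S N True 2 \<diamondop> S N True 1"
    using skein_insert[OF X S_closed[OF 3] 2, of True] skein_insert[OF X S_closed[OF 1] 2, of True]
    by (simp only: mp h)
  then have "(?X \<diamondop> S N True 2 \<diamondop> S N True 3) \<diamondop> S N False 1 \<diamondop> S N False 2
      = (?X \<diamondop> S N True 2 \<diamondop> S N True 1) \<diamondop> S N False 1 \<diamondop> S N False 2" by (simp only:)
  then have "?X \<diamondop> S N True 2 \<diamondop> S N True 3 \<diamondop> S N False 1 \<diamondop> S N False 2 = ?X"
    using 1 2 N' by (simp add: S_inverse S_inverse' lcomp_assoc)
  with G show ?thesis by (cases e) (simp_all add: lcomp_assoc)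
qed

section \<open>Cups and caps on the right\<close>

text \<open>\<open>cu e r n\<close> is the cup of sign \<open>e\<close> to the right of the first \<open>r\<close> of \<open>n\<close> strands; it is
  \<open>A(c)\<close> for \<open>e = True\<close> and \<open>q t\<^sup>-\<^sup>1 A(c')\<close> for \<open>e = False\<close>. The caps \<open>ca e r n\<close> give \<open>A(d')\<close> and
  \<open>q\<^sup>-\<^sup>1 t A(d)\<close> in the same way.\<close>

definition cu :: "bool \<Rightarrow> nat \<Rightarrow> nat \<Rightarrow> 'k ib_term set" where
  "cu e r n = D (n + 2) (\<not> e) 1 (r + 1) \<diamondop> D (n + 2) e 2 (r + 2) \<diamondop> CU n"

definition ca :: "bool \<Rightarrow> nat \<Rightarrow> nat \<Rightarrow> 'k ib_term set" where
  "ca e r n = CA n \<diamondop> U (n + 2) (\<not> e) 2 (r + 2) \<diamondop> U (n + 2) e 1 (r + 1)"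

lemma cu_closed:
  assumes "r \<le> n" "m = n + 2"
  shows "cu e r n \<in> PHom P n m"
  unfolding cu_def assms(2) by (rule lcomp_closed[OF W_closed lcomp_closed[OF W_closed CU_closed]])
    (use assms(1) in auto)

lemma ca_closed:
  assumes "r \<le> n" "m = n + 2"
  shows "ca e r n \<in> PHom P m n"
  unfolding ca_def assms(2) by (rule lcomp_closed[OF CA_closed lcomp_closed[OF W_closed W_closed]])
    (use assms(1) in auto)

text \<open>The cup raises the index by two, and each of its two legs, crossing the first r strands
  with constant sign, lowers it by one again.\<close>

lemma cu_S:
  assumes N: "N = r + 2" and i: "1 \<le> i" "i < r"
  shows "cu e r r \<diamondop> S r e' i = S N e' i \<diamondop> cu e r r"
proof -
  have 1: "CU r \<diamondop> S r e' i = S N e' (i + 2) \<diamondop> CU r"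
    by (rule CU_S[symmetric]) (use assms in simp_all)
  have 2: "D N e 2 (r + 2) \<diamondop> S N e' (i + 2) = S N e' (i + 1) \<diamondop> D N e 2 (r + 2)"
    using D_slide_S[of 2 "i + 1" "r + 2" N e e'] assms by simp
  have 3: "D N (\<not> e) 1 (r + 1) \<diamondop> S N e' (i + 1) = S N e' i \<diamondop> D N (\<not> e) 1 (r + 1)"
    using assms by (intro D_slide_S) simp_all
  show ?thesis
    unfolding cu_def
    by (simp only: N lcomp_assoc 1[unfolded N] 2[unfolded N, THEN ext2] 3[unfolded N, THEN ext2])
qed

lemma ca_S:
  assumes N: "N = r + 2" and i: "1 \<le> i" "i < r"
  shows "ca e r r \<diamondop> S N e' i = S r e' i \<diamondop> ca e r r"
proof -
  have 1: "CA r \<diamondop> S N e' (i + 2) = S r e' i \<diamondop> CA r"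
    by (rule CA_S) (use assms in simp_all)
  have 2: "U N (\<not> e) 2 (r + 2) \<diamondop> S N e' (i + 1) = S N e' (i + 2) \<diamondop> U N (\<not> e) 2 (r + 2)"
    using U_slide_S[of 2 "i + 1" "r + 2" N "\<not> e" e'] assms by simp
  have 3: "U N e 1 (r + 1) \<diamondop> S N e' i = S N e' (i + 1) \<diamondop> U N e 1 (r + 1)"
    using assms by (intro U_slide_S) simp_all
  show ?thesis
    unfolding ca_def
    by (simp only: N lcomp_assoc 1[unfolded N, THEN ext2] 2[unfolded N, THEN ext2] 3[unfolded N])
qed

lemma D_split2:
  assumes "N = M" "c = b + 2" "a + 2 \<le> c"
  shows "D N e a c = D N e (a + 2) c \<diamondop> S N e (a + 1) \<diamondop> S N e a"
  using assms by (simp add: D_last[of a] D_last[of "Suc a"] lcomp_assoc del: upt_Suc)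

lemma U_split2:
  assumes "a + 2 \<le> c"
  shows "U N e a c = S N e a \<diamondop> S N e (a + 1) \<diamondop> U N e (a + 2) c"
  using assms by (simp add: U_first[of a] U_first[of "Suc a"] del: upt_Suc)

text \<open>The four letters next to \<open>CU r'\<close> are the crossings of the displaced cup
  with the first two strands, the strands that another cup or cap can occupy. All other letters have
  index at least 3 and hence pass \<open>CU\<close> and \<open>CA\<close> with index lowered by
  two.\<close>

lemma cu_split:
  assumes N: "N = r + 4" and r': "r' = r + 2"
  shows "cu e r' r' = D N (\<not> e) 3 (r + 3) \<diamondop> D N e 4 (r + 4)
    \<diamondop> S N (\<not> e) 2 \<diamondop> S N (\<not> e) 1 \<diamondop> S N e 3 \<diamondop> S N e 2 \<diamondop> CU r'"
proof -
  have D1: "D N (\<not> e) 1 (r + 3) = D N (\<not> e) 3 (r + 3) \<diamondop> S N (\<not> e) 2 \<diamondop> S N (\<not> e) 1"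
    using D_split2[of N N "r + 3" "r + 1" 1 "\<not> e"] by (simp add: eval_nat_numeral)
  have D2: "D N e 2 (r + 4) = D N e 4 (r + 4) \<diamondop> S N e 3 \<diamondop> S N e 2"
    using D_split2[of N N "r + 4" "r + 2" 2 e] by (simp add: eval_nat_numeral)
  have c: "S N e' i \<diamondop> D N e 4 (r + 4) = D N e 4 (r + 4) \<diamondop> S N e' i" if "i \<le> 2" for e' i
    by (rule W_commute_S[symmetric]) (use that in auto)
  have N': "r' + 2 = N" "r' + 1 = r + 3" using N r' by simp_all
  have "cu e r' r' = D N (\<not> e) 1 (r + 3) \<diamondop> D N e 2 (r + 4) \<diamondop> CU r'"
    unfolding cu_def N' by (simp only: N)
  also have "\<dots> = D N (\<not> e) 3 (r + 3) \<diamondop> D N e 4 (r + 4)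
    \<diamondop> S N (\<not> e) 2 \<diamondop> S N (\<not> e) 1 \<diamondop> S N e 3 \<diamondop> S N e 2 \<diamondop> CU r'"
    by (simp only: D1 D2 lcomp_assoc c[OF order.refl, THEN ext2] c[OF one_le_numeral, THEN ext2])
  finally show ?thesis .
qed

lemma ca_split:
  assumes N: "N = r + 4" and r': "r' = r + 2"
  shows "ca e r' r' = CA r' \<diamondop> S N (\<not> e) 2 \<diamondop> S N (\<not> e) 3 \<diamondop> S N e 1 \<diamondop> S N e 2
    \<diamondop> U N (\<not> e) 4 (r + 4) \<diamondop> U N e 3 (r + 3)"
proof -
  have D1: "U N e 1 (r + 3) = S N e 1 \<diamondop> S N e 2 \<diamondop> U N e 3 (r + 3)"
    using U_split2[of 1 "r + 3" N e] by (simp add: eval_nat_numeral)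
  have D2: "U N (\<not> e) 2 (r + 4) = S N (\<not> e) 2 \<diamondop> S N (\<not> e) 3 \<diamondop> U N (\<not> e) 4 (r + 4)"
    using U_split2[of 2 "r + 4" N "\<not> e"] by (simp add: eval_nat_numeral)
  have c: "U N (\<not> e) 4 (r + 4) \<diamondop> S N e' i = S N e' i \<diamondop> U N (\<not> e) 4 (r + 4)" if "i \<le> 2" for e' i
    by (rule W_commute_S) (use that in auto)
  have N': "r' + 2 = N" "r' + 1 = r + 3" using N r' by simp_all
  have "ca e r' r' = CA r' \<diamondop> U N (\<not> e) 2 (r + 4) \<diamondop> U N e 1 (r + 3)"
    unfolding ca_def N' by (simp only: N)
  also have "\<dots> = CA r' \<diamondop> S N (\<not> e) 2 \<diamondop> S N (\<not> e) 3 \<diamondop> S N e 1 \<diamondop> S N e 2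
    \<diamondop> U N (\<not> e) 4 (r + 4) \<diamondop> U N e 3 (r + 3)"
    by (simp only: D1 D2 lcomp_assoc c[OF order.refl, THEN ext2] c[OF one_le_numeral, THEN ext2])
  finally show ?thesis .
qed

section \<open>Naturality with respect to the cup and the cap of B\<close>

lemma cu_CU:
  assumes r': "r' = r + 2"
  shows "cu e r' r' \<diamondop> CU r = CU r' \<diamondop> cu e r r"
proof -
  define N where N: "N = r + 4"
  have N': "N = r' + 2" using N r' by simp
  have "cu e r' r' \<diamondop> CU r = D N (\<not> e) 3 (r + 3) \<diamondop> D N e 4 (r + 4) \<diamondop> CU r' \<diamondop> CU r"
    by (simp only: cu_split[OF N r'] lcomp_assoc twist_cup_cup[OF r' N])
  also have "\<dots> = CU r' \<diamondop> D r' (\<not> e) 1 (r + 1) \<diamondop> D r' e 2 (r + 2) \<diamondop> CU r"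
    using cup_cap_UD(2)[OF N', of 3 1 "r + 3" "r + 1" "\<not> e", THEN ext2]
      cup_cap_UD(2)[OF N', of 4 2 "r + 4" "r + 2" e, THEN ext2] by (simp add: lcomp_assoc)
  finally show ?thesis unfolding cu_def r'[symmetric] .
qed

lemma cu_CA:
  assumes r': "r' = r + 2"
  shows "cu e r r \<diamondop> CA r = CA r' \<diamondop> cu e r' r'"
proof -
  define N where N: "N = r + 4"
  have N': "N = r' + 2" using N r' by simp
  have "CA r' \<diamondop> cu e r' r' = D r' (\<not> e) 1 (r + 1) \<diamondop> D r' e 2 (r + 2)
      \<diamondop> CA r' \<diamondop> S N (\<not> e) 2 \<diamondop> S N (\<not> e) 1 \<diamondop> S N e 3 \<diamondop> S N e 2 \<diamondop> CU r'"
    using cup_cap_UD(4)[OF N', of 3 1 "r + 3" "r + 1" "\<not> e", THEN ext2]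
      cup_cap_UD(4)[OF N', of 4 2 "r + 4" "r + 2" e, THEN ext2]
    by (simp add: cu_split[OF N r'] lcomp_assoc)
  also have "\<dots> = D r' (\<not> e) 1 (r + 1) \<diamondop> D r' e 2 (r + 2) \<diamondop> CU r \<diamondop> CA r"
    by (simp only: cap_twist_cup(2)[OF N' r'])
  finally show ?thesis unfolding cu_def r'[symmetric] by (simp only: lcomp_assoc)
qed

lemma ca_CA:
  assumes r': "r' = r + 2"
  shows "ca e r r \<diamondop> CA r' = CA r \<diamondop> ca e r' r'"
proof -
  define N where N: "N = r + 4"
  have N': "N = r' + 2" using N r' by simp
  have "CA r \<diamondop> ca e r' r' = (CA r \<diamondop> CA r' \<diamondop> S N (\<not> e) 2 \<diamondop> S N (\<not> e) 3 \<diamondop> S N e 1 \<diamondop> S N e 2)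
      \<diamondop> U N (\<not> e) 4 (r + 4) \<diamondop> U N e 3 (r + 3)"
    by (simp only: ca_split[OF N r'] lcomp_assoc)
  also have "\<dots> = CA r \<diamondop> CA r' \<diamondop> U N (\<not> e) 4 (r + 4) \<diamondop> U N e 3 (r + 3)"
    by (simp only: cap_cap_twist[OF r' N] lcomp_assoc)
  also have "\<dots> = CA r \<diamondop> U r' (\<not> e) 2 (r + 2) \<diamondop> U r' e 1 (r + 1) \<diamondop> CA r'"
    using cup_cap_UD(3)[OF N', of 3 1 "r + 3" "r + 1" e]
      cup_cap_UD(3)[OF N', of 4 2 "r + 4" "r + 2" "\<not> e", THEN ext2] by (simp add: lcomp_assoc)
  finally show ?thesis unfolding ca_def r'[symmetric] by (simp only: lcomp_assoc)
qed

lemma ca_CU: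
  assumes r': "r' = r + 2"
  shows "ca e r' r' \<diamondop> CU r' = CU r \<diamondop> ca e r r"
proof -
  define N where N: "N = r + 4"
  have N': "N = r' + 2" using N r' by simp
  have "ca e r' r' \<diamondop> CU r' = (CA r' \<diamondop> S N (\<not> e) 2 \<diamondop> S N (\<not> e) 3 \<diamondop> S N e 1 \<diamondop> S N e 2 \<diamondop> CU r')
      \<diamondop> U r' (\<not> e) 2 (r + 2) \<diamondop> U r' e 1 (r + 1)"
    using cup_cap_UD(1)[OF N', of 3 1 "r + 3" "r + 1" e]
      cup_cap_UD(1)[OF N', of 4 2 "r + 4" "r + 2" "\<not> e", THEN ext2]
    by (simp add: ca_split[OF N r'] lcomp_assoc)
  also have "\<dots> = (CU r \<diamondop> CA r) \<diamondop> U r' (\<not> e) 2 (r + 2) \<diamondop> U r' e 1 (r + 1)"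
    by (simp only: cap_twist_cup(1)[OF N' r'])
  finally show ?thesis unfolding ca_def r'[symmetric] by (simp only: lcomp_assoc)
qed

section \<open>Composites of a cup and a cap on the right\<close>

text \<open>The shorter word slides through the longer one, after which both have index at least 3
  apart from a single \<sigma>_2 and leave through the cup and the cap; what stays is cap \<sigma>_2
  cup. On the right the words cancel for c = r, and one crossing survives for c = r + 1.\<close>

lemma cap_UD_cup:
  assumes N: "N = n + 2" and h: "r \<le> c" "c + 1 \<le> n"
  shows "CA n \<diamondop> U N (\<not> e) 2 (r + 2) \<diamondop> D N e 2 (c + 3) \<diamondop> CU n
      = sc (ts e) (D n e 1 (c + 1) \<diamondop> U n (\<not> e) 1 (r + 1))" (is ?up)
    and "CA n \<diamondop> U N e 2 (c + 3) \<diamondop> D N (\<not> e) 2 (r + 2) \<diamondop> CU n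
      = sc (ts e) (D n (\<not> e) 1 (r + 1) \<diamondop> U n e 1 (c + 1))" (is ?down)
proof -
  have D: "D N e 2 (c + 3) = D N e 3 (c + 3) \<diamondop> S N e 2"
    using D_last[of 2 "c + 3" N e] by (simp add: eval_nat_numeral)
  have U: "U N e 2 (c + 3) = S N e 2 \<diamondop> U N e 3 (c + 3)"
    using U_first[of 2 "c + 3" N e] by (simp add: eval_nat_numeral)
  have n: "1 \<le> n" using h by simp
  have 1: "U N (\<not> e) 2 (r + 2) \<diamondop> D N e 2 (c + 3) = D N e 2 (c + 3) \<diamondop> U N (\<not> e) 3 (r + 3)"
    using U_D_slide(1)[of 2 2 "r + 2" "c + 3" N "\<not> e" e] N h by (simp add: eval_nat_numeral)
  have 2: "U N e 2 (c + 3) \<diamondop> D N (\<not> e) 2 (r + 2) = D N (\<not> e) 3 (r + 3) \<diamondop> U N e 2 (c + 3)"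
    using U_D_slide(4)[of 2 2 "r + 2" "c + 3" N e "\<not> e"] N h by (simp add: eval_nat_numeral)
  have u: "U N e' 3 (b + 3) \<diamondop> CU n = CU n \<diamondop> U n e' 1 (b + 1)" for e' b
    by (rule cup_cap_UD(1)[OF N]) simp_all
  have d: "CA n \<diamondop> D N e' 3 (b + 3) = D n e' 1 (b + 1) \<diamondop> CA n" for e' b
    by (rule cup_cap_UD(4)[OF N]) simp_all
  have "CA n \<diamondop> U N (\<not> e) 2 (r + 2) \<diamondop> D N e 2 (c + 3) \<diamondop> CU n
      = D n e 1 (c + 1) \<diamondop> (CA n \<diamondop> S N e 2 \<diamondop> CU n) \<diamondop> U n (\<not> e) 1 (r + 1)"
    by (simp only: 1[THEN ext2] lcomp_assoc) (simp only: D lcomp_assoc u d[THEN ext2])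
  then show ?up by (simp only: CA_S2_CU[OF N n] assocs E_W)
  have "CA n \<diamondop> U N e 2 (c + 3) \<diamondop> D N (\<not> e) 2 (r + 2) \<diamondop> CU n
      = D n (\<not> e) 1 (r + 1) \<diamondop> (CA n \<diamondop> S N e 2 \<diamondop> CU n) \<diamondop> U n e 1 (c + 1)"
    by (simp only: 2[THEN ext2] lcomp_assoc) (simp only: U lcomp_assoc u d[THEN ext2])
  then show ?down by (simp only: CA_S2_CU[OF N n] assocs E_W)
qed

text \<open>Sliding \<open>U N e 1 (r + 1)\<close> past the descending word lets its letters above 1
  cancel against \<open>U N (\<not> e) 2 (r + 2)\<close>. The last letter \<sigma>_1 is a curl at
  the cap and gives the scalar.\<close>

lemma cap_UUD:
  assumes N: "N = n + 2" and h: "r \<le> n"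
  shows "CA n \<diamondop> U N (\<not> e) 2 (r + 2) \<diamondop> U N e 1 (r + 1) \<diamondop> D N e 1 (r + 2)
    = sc (qs e) (CA n \<diamondop> U N e 2 (r + 2))"
proof -
  have 1: "U N e 1 (r + 1) \<diamondop> D N e 1 (r + 2) = D N e 1 (r + 2) \<diamondop> U N e 2 (r + 2)"
    using U_D_slide(1)[of 1 1 "r + 1" "r + 2" N e e] N h by (simp add: eval_nat_numeral)
  have 2: "D N e 1 (r + 2) = D N e 2 (r + 2) \<diamondop> S N e 1"
    using D_last[of 1 "r + 2" N e] by (simp add: eval_nat_numeral)
  have 3: "U N (\<not> e) 2 (r + 2) \<diamondop> D N e 2 (r + 2) = E N"
    using N h by (intro U_inverse) simp_all
  show ?thesis
    by (simp only: 1) (simp only: 2 lcomp_assoc 3[THEN ext2] E_ext E_left CA_S1[OF N, THEN ext2] lscale_lcomp)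
qed

text \<open>The same curl at the cup: after the slide the letters above 1 cancel and \<sigma>_1
  meets the cup. Here its sign is opposite to \<open>e\<close>, hence the inverse scalar.\<close>

lemma UDD_cup:
  assumes N: "N = n + 2" and h: "r \<le> n"
  shows "U N (\<not> e) 1 (r + 2) \<diamondop> D N (\<not> e) 1 (r + 1) \<diamondop> D N e 2 (r + 2) \<diamondop> CU n
    = sc (qs (\<not> e)) (D N (\<not> e) 2 (r + 2) \<diamondop> CU n)"
proof -
  have 1: "U N (\<not> e) 1 (r + 2) \<diamondop> D N (\<not> e) 1 (r + 1) = D N (\<not> e) 2 (r + 2) \<diamondop> U N (\<not> e) 1 (r + 2)"
    using U_D_slide(4)[of 1 1 "r + 1" "r + 2" N "\<not> e" "\<not> e"] N h by (simp add: eval_nat_numeral)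
  have 2: "U N (\<not> e) 1 (r + 2) = S N (\<not> e) 1 \<diamondop> U N (\<not> e) 2 (r + 2)"
    using U_first[of 1 "r + 2" N "\<not> e"] by (simp add: eval_nat_numeral)
  have 3: "U N (\<not> e) 2 (r + 2) \<diamondop> D N e 2 (r + 2) = E N"
    using N h by (intro U_inverse) simp_all
  have "U N (\<not> e) 1 (r + 2) \<diamondop> D N (\<not> e) 1 (r + 1) \<diamondop> D N e 2 (r + 2) \<diamondop> CU n
    = D N (\<not> e) 2 (r + 2) \<diamondop> (S N (\<not> e) 1 \<diamondop> U N (\<not> e) 2 (r + 2)) \<diamondop> D N e 2 (r + 2) \<diamondop> CU n"
    unfolding 2[symmetric] by (simp only: 1[THEN ext2] lcomp_assoc)
  also have "\<dots> = sc (qs (\<not> e)) (D N (\<not> e) 2 (r + 2) \<diamondop> CU n)"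
    by (simp only: lcomp_assoc 3[THEN ext2] E_left_CU[OF N] S1_CU[OF N] lcomp_lscale)
  finally show ?thesis .
qed

text \<open>The two words of the cap are inverse to the two words of the cup, so the circle is
  pulled back to the left, where it is \<delta>.\<close>

lemma ca_cu: "r \<le> n \<Longrightarrow> ca e r n \<diamondop> cu e r n = sc \<delta> (E n)"
proof -
  assume h: "r \<le> n"
  define N where N: "N = n + 2"
  have 1: "U N e 1 (r + 1) \<diamondop> D N (\<not> e) 1 (r + 1) = E N"
    using N h by (intro U_inverse) simp_all
  have 2: "U N (\<not> e) 2 (r + 2) \<diamondop> D N e 2 (r + 2) = E N"
    using N h by (intro U_inverse) simp_all
  show ?thesis
    unfolding ca_def cu_def N[symmetric]
    by (simp only: lcomp_assoc 1[THEN ext2] 2[THEN ext2] E_W E_W' E_left_CU[OF N] CA_CU)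
qed

text \<open>The words on indices 1 to r commute with the crossing and cancel. The crossing then
  extends the descending word by one letter, which gives the case c = r of
  \<open>cap_UD_cup\<close>.\<close>

lemma twist_right:
  assumes n: "n = r + 1" and N: "N = r + 3"
  shows "ca True r n \<diamondop> S N True (r + 2) \<diamondop> cu True r n = sc t (E n)"
proof -
  have N': "N = n + 2" using n N by simp
  have 1: "U N True 1 (r + 1) \<diamondop> S N True (r + 2) = S N True (r + 2) \<diamondop> U N True 1 (r + 1)"
    by (rule W_commute_S) auto
  have 2: "U N True 1 (r + 1) \<diamondop> D N False 1 (r + 1) = E N"
    using N by (intro U_inverse) simp_all
  have 3: "S N True (r + 2) \<diamondop> D N True 2 (r + 2) = D N True 2 (r + 3)"
    using D_first[of 2 "r + 2" N True] by (simp add: eval_nat_numeral)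
  have 4: "D n True 1 (r + 1) \<diamondop> U n False 1 (r + 1) = E n"
    using n by (intro D_inverse) simp_all
  have "ca True r n \<diamondop> S N True (r + 2) \<diamondop> cu True r n
      = CA n \<diamondop> U N False 2 (r + 2) \<diamondop> D N True 2 (r + 3) \<diamondop> CU n"
    unfolding ca_def cu_def N'[symmetric] not_True_eq_False
    by (simp only: lcomp_assoc 1[THEN ext2] 2[THEN ext2] E_W' E_W 3[THEN ext2])
  also have "\<dots> = sc t (E n)"
    using cap_UD_cup(1)[OF N', of r r True] n 4 by (simp del: upt_Suc)
  finally show ?thesis .
qed

text \<open>The value q^-1 t is a curl at the cap times a loop. Its inverse is the scalar of A(d),
  which makes the zigzag the identity.\<close>

lemma zigzag_up:
  assumes n: "n = r + 1"
  shows "ca False r n \<diamondop> cu True n n = sc (unit_inv q * t) (E n)"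
proof -
  define N where N: "N = n + 2"
  have n': "n + 2 = r + 3" "n + 1 = r + 2" using n by simp_all
  have N3: "N = r + 3" using N n by simp
  have 4: "D n True 1 (r + 1) \<diamondop> U n False 1 (r + 1) = E n"
    using n by (intro D_inverse) simp_all
  have "ca False r n \<diamondop> cu True n n
      = (CA n \<diamondop> U N True 2 (r + 2) \<diamondop> U N False 1 (r + 1) \<diamondop> D N False 1 (r + 2))
        \<diamondop> D N True 2 (r + 3) \<diamondop> CU n"
    unfolding ca_def cu_def n' N3[symmetric] not_True_eq_False not_False_eq_True
    by (simp only: lcomp_assoc)
  also have "\<dots> = sc (unit_inv q) (CA n \<diamondop> U N False 2 (r + 2) \<diamondop> D N True 2 (r + 3) \<diamondop> CU n)"
    using cap_UUD[OF N, of r False] n by (simp add: assocs del: upt_Suc)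
  also have "\<dots> = sc (unit_inv q * t) (E n)"
    using cap_UD_cup(1)[OF N, of r r True] n 4 by (simp add: lscale_lscale del: upt_Suc)
  finally show ?thesis .
qed

lemma zigzag_down:
  assumes n: "n = r + 1"
  shows "ca False n n \<diamondop> cu True r n = sc (unit_inv q * t) (E n)"
proof -
  define N where N: "N = n + 2"
  have n': "n + 2 = r + 3" "n + 1 = r + 2" using n by simp_all
  have N3: "N = r + 3" using N n by simp
  have 4: "D n False 1 (r + 1) \<diamondop> U n True 1 (r + 1) = E n"
    using n by (intro D_inverse) simp_all
  have "ca False n n \<diamondop> cu True r n
      = CA n \<diamondop> U N True 2 (r + 3) \<diamondop> U N False 1 (r + 2) \<diamondop> D N False 1 (r + 1) \<diamondop> D N True 2 (r + 2) \<diamondop> CU n"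
    unfolding ca_def cu_def n' N3[symmetric] not_True_eq_False not_False_eq_True
    by (simp only: lcomp_assoc)
  also have "\<dots> = sc (unit_inv q) (CA n \<diamondop> U N True 2 (r + 3) \<diamondop> D N False 2 (r + 2) \<diamondop> CU n)"
    using UDD_cup[OF N, of r True] n by (simp add: assocs del: upt_Suc)
  also have "\<dots> = sc (unit_inv q * t) (E n)"
    using cap_UD_cup(2)[OF N, of r r True] n 4 by (simp add: lscale_lscale del: upt_Suc)
  finally show ?thesis .
qed

text \<open>The crossing cancels the last letter of the cap's inner word. After the curl at the cup
  is removed, the words differ in length by one more letter than in a zigzag (c = r + 1), and this
  letter survives as the crossing on the right-hand side.\<close>

lemma rotate_right:
  assumes n: "n = r + 2" and N: "N = r + 4"
  shows "ca False n n \<diamondop> S N True (r + 2) \<diamondop> cu True r n = sc (unit_inv q * t) (S n True (r + 1))"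
proof -
  have N': "N = n + 2" using n N by simp
  have 1: "U N False 1 (r + 3) = U N False 1 (r + 2) \<diamondop> S N False (r + 2)"
    using U_last[of 1 "r + 2" N False] by (simp add: eval_nat_numeral)
  have 2: "S N False (r + 2) \<diamondop> S N True (r + 2) = E N"
    using N by (intro S_inverse) simp_all
  have 4: "D n False 1 (r + 1) \<diamondop> U n True 1 (r + 2) = S n True (r + 1)"
    using U_last[of 1 "r + 1" n True] D_inverse[of 1 "r + 1" n True False, THEN ext2] n
    by (simp add: lcomp_assoc eval_nat_numeral)
  have n': "n + 2 = r + 4" "n + 1 = r + 3" using n by simp_all
  have "ca False n n \<diamondop> S N True (r + 2) \<diamondop> cu True r n
      = CA n \<diamondop> U N True 2 (r + 4) \<diamondop> (U N False 1 (r + 2) \<diamondop> D N False 1 (r + 1) \<diamondop> D N True 2 (r + 2) \<diamondop> CU n)"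
    unfolding ca_def cu_def n' N[symmetric] not_True_eq_False not_False_eq_True
    by (simp only: lcomp_assoc 1 2[THEN ext2] E_W')
  also have "\<dots> = sc (unit_inv q) (CA n \<diamondop> U N True 2 (r + 4) \<diamondop> D N False 2 (r + 2) \<diamondop> CU n)"
    using UDD_cup[OF N', of r True] n by (simp add: assocs del: upt_Suc)
  also have "\<dots> = sc (unit_inv q * t) (S n True (r + 1))"
    using cap_UD_cup(2)[OF N', of r "r + 1" True] n 4 by (simp add: lscale_lscale eval_nat_numeral del: upt_Suc)
  finally show ?thesis .
qed

lemma rotate_left:
  assumes n: "n = r + 2" and N: "N = r + 4"
  shows "ca True r n \<diamondop> S N False (r + 2) \<diamondop> cu False n n = sc (q * unit_inv t) (S n False (r + 1))"
proof -
  have N': "N = n + 2" using n N by simp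
  have 1: "D N True 1 (r + 3) = S N True (r + 2) \<diamondop> D N True 1 (r + 2)"
    using D_first[of 1 "r + 2" N True] by (simp add: eval_nat_numeral)
  have 2: "S N False (r + 2) \<diamondop> S N True (r + 2) = E N"
    using N by (intro S_inverse) simp_all
  have 4: "D n False 1 (r + 2) \<diamondop> U n True 1 (r + 1) = S n False (r + 1)"
    using D_first[of 1 "r + 1" n False] D_inverse[of 1 "r + 1" n True False] n
    by (simp add: lcomp_assoc eval_nat_numeral)
  have n': "n + 2 = r + 4" "n + 1 = r + 3" using n by simp_all
  have "ca True r n \<diamondop> S N False (r + 2) \<diamondop> cu False n n
      = (CA n \<diamondop> U N False 2 (r + 2) \<diamondop> U N True 1 (r + 1) \<diamondop> D N True 1 (r + 2)) \<diamondop> D N False 2 (r + 4) \<diamondop> CU n"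
    unfolding ca_def cu_def n' N[symmetric] not_True_eq_False not_False_eq_True
    by (simp only: lcomp_assoc 1 2[THEN ext2] E_W')
  also have "\<dots> = sc q (CA n \<diamondop> U N True 2 (r + 2) \<diamondop> D N False 2 (r + 4) \<diamondop> CU n)"
    using cap_UUD[OF N', of r True] n by (simp add: assocs del: upt_Suc)
  also have "\<dots> = sc (q * unit_inv t) (S n False (r + 1))"
    using cap_UD_cup(1)[OF N', of r "r + 1" False] n 4 by (simp add: lscale_lscale eval_nat_numeral del: upt_Suc)
  finally show ?thesis .
qed

text \<open>Here no curl splits off at once. Sliding moves the long words outwards until a conjugate
  of \<sigma>_1 stands between the cap and the cup.\<close>

lemma twist_left:
  assumes n: "n = r + 1" and N: "N = r + 3"
  shows "ca False n n \<diamondop> S N True (r + 1) \<diamondop> cu False n n = sc t (E n)"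
proof -
  have N': "N = n + 2" using n N by simp
  have 1: "U N False 1 (r + 2) = U N False 1 (r + 1) \<diamondop> S N False (r + 1)"
    using U_last[of 1 "r + 1" N False] by (simp add: eval_nat_numeral)
  have 2: "S N False (r + 1) \<diamondop> S N True (r + 1) = E N"
    using N by (intro S_inverse) simp_all
  have 3: "U N False 1 (r + 1) \<diamondop> D N True 1 (r + 2) = D N True 1 (r + 2) \<diamondop> U N False 2 (r + 2)"
    using U_D_slide(1)[of 1 1 "r + 1" "r + 2" N False True] N by (simp add: eval_nat_numeral)
  have D1: "D N True 1 (r + 2) = D N True 2 (r + 2) \<diamondop> S N True 1"
    using D_last[of 1 "r + 2" N True] by (simp add: eval_nat_numeral)
  have s1: "U N True 2 (r + 3) \<diamondop> D N True 2 (r + 2) = D N True 3 (r + 3) \<diamondop> U N True 2 (r + 3)"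
    using U_D_slide(4)[of 2 2 "r + 2" "r + 3" N True True] N by (simp add: eval_nat_numeral)
  have s2: "U N False 2 (r + 2) \<diamondop> D N False 2 (r + 3) = D N False 2 (r + 3) \<diamondop> U N False 3 (r + 3)"
    using U_D_slide(1)[of 2 2 "r + 2" "r + 3" N False False] N by (simp add: eval_nat_numeral)
  have U2: "U N True 2 (r + 3) = S N True 2 \<diamondop> U N True 3 (r + 3)"
    using U_first[of 2 "r + 3" N True] by (simp add: eval_nat_numeral)
  have D2: "D N False 2 (r + 3) = D N False 3 (r + 3) \<diamondop> S N False 2"
    using D_last[of 2 "r + 3" N False] by (simp add: eval_nat_numeral)
  have c: "U N True 3 (r + 3) \<diamondop> S N True 1 = S N True 1 \<diamondop> U N True 3 (r + 3)"
    by (rule W_commute_S) auto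
  have i: "U N True 3 (r + 3) \<diamondop> D N False 3 (r + 3) = E N"
    using N by (intro U_inverse) simp_all
  have b: "S N True 2 \<diamondop> S N True 1 \<diamondop> S N False 2 = S N False 1 \<diamondop> S N True 2 \<diamondop> S N True 1"
    using S_braid(1)[of 1 N True False] N by (simp add: eval_nat_numeral)
  have u: "U N False 3 (r + 3) \<diamondop> CU n = CU n \<diamondop> U n False 1 (r + 1)"
    by (rule cup_cap_UD(1)[OF N']) simp_all
  have d: "CA n \<diamondop> D N True 3 (r + 3) = D n True 1 (r + 1) \<diamondop> CA n"
    by (rule cup_cap_UD(4)[OF N']) simp_all
  have e: "D n True 1 (r + 1) \<diamondop> U n False 1 (r + 1) = E n"
    using n by (intro D_inverse) simp_all
  have n': "n + 2 = r + 3" "n + 1 = r + 2" "1 \<le> n" using n by simp_all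
  \<comment> \<open>The letters above 2 cancel, and the conjugate of \<sigma>_1 by \<sigma>_2
    becomes the conjugate of \<sigma>_2 by \<sigma>_1^-1, whose outer letters are curls.\<close>
  have m: "U N True 2 (r + 3) \<diamondop> S N True 1 \<diamondop> D N False 2 (r + 3)
      = S N False 1 \<diamondop> S N True 2 \<diamondop> S N True 1"
    by (simp only: U2 D2 lcomp_assoc c[THEN ext2] i[THEN ext2] E_left b)
  have "ca False n n \<diamondop> S N True (r + 1) \<diamondop> cu False n n
      = CA n \<diamondop> U N True 2 (r + 3) \<diamondop> (U N False 1 (r + 1) \<diamondop> D N True 1 (r + 2)) \<diamondop> D N False 2 (r + 3) \<diamondop> CU n"
    unfolding ca_def cu_def n' N[symmetric] not_True_eq_False not_False_eq_True
    by (simp only: lcomp_assoc 1 2[THEN ext2] E_W')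
  also have "\<dots> = CA n \<diamondop> (U N True 2 (r + 3) \<diamondop> D N True 2 (r + 2)) \<diamondop> S N True 1
      \<diamondop> (U N False 2 (r + 2) \<diamondop> D N False 2 (r + 3)) \<diamondop> CU n"
    by (simp only: 3) (simp only: D1 lcomp_assoc)
  also have "\<dots> = D n True 1 (r + 1) \<diamondop> CA n
      \<diamondop> (U N True 2 (r + 3) \<diamondop> S N True 1 \<diamondop> D N False 2 (r + 3)) \<diamondop> CU n \<diamondop> U n False 1 (r + 1)"
    by (simp only: s1 s2 lcomp_assoc u d[THEN ext2])
  \<comment> \<open>The curls at the cap and at the cup have opposite signs, so their scalars q^-1
    and q cancel and only the loop contributes.\<close>
  also have "\<dots> = sc (unit_inv q * q) (D n True 1 (r + 1) \<diamondop> (CA n \<diamondop> S N True 2 \<diamondop> CU n) \<diamondop> U n False 1 (r + 1))"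
    by (simp only: m lcomp_assoc CA_S1[OF N', THEN ext2] S1_CU[OF N', THEN ext2] lscale_lcomp
        lcomp_lscale lscale_lscale if_True if_False mult.commute)
  also have "\<dots> = sc t (E n)"
    by (simp only: CA_S2_CU[OF N' n'(3)] assocs E_W e q_inv mult_1 if_True)
  finally show ?thesis .
qed

end

section \<open>Adding strands\<close>

lemma shift_shift: "shift j (shift k u) = shift (j + k) u"
proof (induction u)
  case (LGen g)
  show ?case by (cases g) (simp_all add: add.commute add.left_commute)
qed (simp_all add: add.commute add.left_commute)

lemma shift_zero [simp]: "shift 0 u = u"
proof (induction u)
  case (LGen g)
  show ?case by (cases g) simp_all
qed simp_all

context iquantum_brauer
begin

abbreviation A :: "nat \<Rightarrow> (nat, 'k ib_term set, nat, 'k ib_term set) fctr" where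
  "A \<equiv> add_strands q t \<delta>"

lemma lsrc_shift: "lsrc P (shift k u) = lsrc P u + k"
  and ltgt_shift: "ltgt P (shift k u) = ltgt P u + k"
proof -
  have "lsrc P (shift k u) = lsrc P u + k \<and> ltgt P (shift k u) = ltgt P u + k"
  proof (induction u)
    case (LGen g) show ?case by (cases g) simp_all
  qed simp_all
  then show "lsrc P (shift k u) = lsrc P u + k" "ltgt P (shift k u) = ltgt P u + k" by simp_all
qed

lemma lwf_shift: "lwf P u \<Longrightarrow> lwf P (shift k u)"
proof (induction u)
  case (LGen g) then show ?case by (cases g) auto
qed (simp_all add: lsrc_shift ltgt_shift)

lemma lhom_shift: "u \<in> lhom P a b \<Longrightarrow> shift k u \<in> lhom P (a + k) (b + k)"
  by (auto simp: lhom_def lwf_shift lsrc_shift ltgt_shift)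

lemma ib_rel_shift:
  assumes "ib_rel q t \<delta> u v"
  shows "ib_rel q t \<delta> (shift k u) (shift k v)"
  using assms
proof cases
  case (1 n i) then show ?thesis by (simp add: ib_rel.intros)
next
  case (2 n i) then show ?thesis by (simp add: ib_rel.intros)
next
  case (3 n i) then show ?thesis using ib_rel.intros(3)[of q t \<delta> "n + k" i] by simp
next
  case (4 i j n) then show ?thesis using ib_rel.intros(4)[of i j q t \<delta> "n + k"] by simp
next
  case (5 n i) then show ?thesis using ib_rel.intros(5)[of q t \<delta> "n + k" i] by simp
next
  case (6 n i) then show ?thesis using ib_rel.intros(6)[of q t \<delta> "n + k" i]
    by (simp add: add.commute add.left_commute)
next
  case (7 n i) then show ?thesis using ib_rel.intros(7)[of q t \<delta> "n + k" i]
    by (simp add: add.commute add.left_commute)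
next
  case (8 n) then show ?thesis using ib_rel.intros(8)[of q t \<delta> "n + k"] by simp
next
  case (9 n) then show ?thesis using ib_rel.intros(9)[of q t \<delta> "n + k"]
    by (simp add: add.commute add.left_commute)
next
  case (10 n) then show ?thesis using ib_rel.intros(10)[of q t \<delta> "n + k"]
    by (simp add: add.commute add.left_commute)
next
  case (11 n) then show ?thesis using ib_rel.intros(11)[of "n + k" q t \<delta>]
    by (simp add: add.commute add.left_commute)
next
  case (12 n)
  \<comment> \<open>The relation contains the truncated difference n - 2; writing n = m + 2 makes it
    commute with adding k.\<close>
  then obtain m where m: "n = m + 2" by (metis le_add_diff_inverse2)
  show ?thesis using 12 ib_rel.intros(12)[of "n + k" q t \<delta>]
    by (simp add: m add.commute add.left_commute)
next
  case (13 n) then show ?thesis using ib_rel.intros(13)[of q t \<delta> "n + k"]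
    by (simp add: add.assoc add.commute[of _ k])
next
  case (14 n) then show ?thesis using ib_rel.intros(14)[of q t \<delta> "n + k"]
    by (simp add: add.assoc add.commute[of _ k])
qed

text \<open>This makes \<open>add_strands\<close> independent of the representative. Strand counts
  grow while the positions of crossings stay, so relations go to relations.\<close>

lemma leq_shift: "leq P u v \<Longrightarrow> leq P (shift k u) (shift k v)"
proof (induction rule: leq.induct)
  case (leq_rel u v a b)
  then show ?case
    by (intro leq.leq_rel[of P "shift k u" "shift k v" "a + k" "b + k"] lhom_shift) (simp_all add: ib_rel_shift)
next
  case (leq_sym u v) show ?case by (rule leq.leq_sym[OF leq_sym.IH])
next
  case (leq_trans u v w) show ?case by (rule leq.leq_trans[OF leq_trans.IH])
next
  case (leq_Comp u u' v v')
  then show ?case using leq.leq_Comp[of P "shift k u" "shift k u'" "shift k v" "shift k v'"]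
    by (simp add: lwf_shift lsrc_shift ltgt_shift)
next
  case (leq_Plus u u' v v')
  then show ?case using leq.leq_Plus[of P "shift k u" "shift k u'" "shift k v" "shift k v'"]
    by (simp add: lwf_shift lsrc_shift ltgt_shift)
next
  case (leq_Scale u u' x)
  then show ?case by (simp add: leq.leq_Scale)
qed (use lhom_shift[where k = k] in \<open>auto simp: lwf_shift lsrc_shift ltgt_shift
      intro!: leq_refl leq_linear_axioms\<close>)

section \<open>The functors A_k and their strict composition\<close>

abbreviation C :: "(nat, 'k ib_term set, 'k) lincat" where "C \<equiv> IB q t \<delta>"

lemma C_linear: "linear_category C"
  unfolding IB_def by (rule linear_category_presented)

lemma C_sel [simp]: "Obj C = UNIV" "Hom C a b = PHom P a b" "Idm C a = E a"
  by (simp_all add: IB_def E_def presented_Hom presented_Idm)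

lemma C_ops:
  "X \<in> PHom P b c \<Longrightarrow> Y \<in> PHom P a b \<Longrightarrow> Comp C X Y = X \<diamondop> Y"
  "X \<in> PHom P a b \<Longrightarrow> Scale C x X = sc x X"
  "X \<in> PHom P a b \<Longrightarrow> Y \<in> PHom P a b \<Longrightarrow> Plus C X Y = lplus P X Y"
  unfolding IB_def by (rule Comp_eq_lcomp Scale_eq_lscale Plus_eq_lplus; assumption)+

lemma in_Mor: "lwf P u \<Longrightarrow> lcls P u \<in> Mor C"
  by (auto simp: Mor_def lhom_def)

lemma Mor_cases: "X \<in> Mor C \<Longrightarrow> \<exists>u. lwf P u \<and> X = lcls P u"
  by (auto simp: Mor_def lhom_def)

lemma A_Obj [simp]: "FObj (A k) r = r + k"
  by (simp add: add_strands_def)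

lemma A_lcls: "lwf P u \<Longrightarrow> FMor (A k) (lcls P u) = lcls P (shift k u)"
  using leq_shift[OF rep_lcls[of P u], of k]
  by (simp add: add_strands_def in_Mor lcls_eqI[symmetric])

lemma A_lcomp:
  "X \<in> PHom P b c \<Longrightarrow> Y \<in> PHom P a b \<Longrightarrow> FMor (A k) (X \<diamondop> Y) = FMor (A k) X \<diamondop> FMor (A k) Y"
  by (auto simp: lhom_def lcls_Comp[symmetric] A_lcls)

lemma A_lscale: "X \<in> PHom P a b \<Longrightarrow> FMor (A k) (sc x X) = sc x (FMor (A k) X)"
  by (auto simp: lhom_def lcls_Scale[symmetric] A_lcls)

lemma A_lplus:
  "X \<in> PHom P a b \<Longrightarrow> Y \<in> PHom P a b \<Longrightarrow> FMor (A k) (lplus P X Y) = lplus P (FMor (A k) X) (FMor (A k) Y)"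
  by (auto simp: lhom_def lcls_Plus[symmetric] A_lcls)

lemma A_E [simp]: "FMor (A k) (E n) = E (n + k)"
  by (simp add: E_def A_lcls)

lemma A_closed: "X \<in> PHom P a b \<Longrightarrow> FMor (A k) X \<in> PHom P (a + k) (b + k)"
  using lhom_shift by (auto simp: A_lcls lhom_def)

lemma A_S: "1 \<le> i \<Longrightarrow> i < n \<Longrightarrow> FMor (A k) (S n e i) = S (n + k) e i"
  by (simp add: S_def A_lcls)

lemma A_CU: "FMor (A k) (CU n) = CU (n + k)"
  by (simp add: CU_def A_lcls)

lemma A_CA: "FMor (A k) (CA n) = CA (n + k)"
  by (simp add: CA_def A_lcls)

lemma A_W: "\<forall>i\<in>set is. 1 \<le> i \<and> i < n \<Longrightarrow> FMor (A k) (W n e is) = W (n + k) e is"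
proof (induction "is")
  case (Cons i "is")
  then have "S n e i \<in> PHom P n n" "W n e is \<in> PHom P n n" by (auto intro: S_closed W_closed)
  then show ?case using Cons by (simp add: A_lcomp A_S)
qed simp

lemma A_cu: "r \<le> n \<Longrightarrow> FMor (A k) (cu e r n) = cu e r (n + k)"
proof -
  assume h: "r \<le> n"
  have v: "\<forall>i\<in>set (rev [1..<r + 1]). 1 \<le> i \<and> i < n + 2" "\<forall>i\<in>set (rev [2..<r + 2]). 1 \<le> i \<and> i < n + 2"
    using h by auto
  note X = W_closed[OF v(1), of "\<not> e"] and Y = W_closed[OF v(2), of e] and Z = CU_closed[OF refl, of n]
  show ?thesis
    unfolding cu_def A_lcomp[OF X lcomp_closed[OF Y Z]] A_lcomp[OF Y Z] A_W[OF v(1)] A_W[OF v(2)] A_CU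
    by (simp only: add.assoc add.commute[of k])
qed

lemma A_ca: "r \<le> n \<Longrightarrow> FMor (A k) (ca e r n) = ca e r (n + k)"
proof -
  assume h: "r \<le> n"
  have v: "\<forall>i\<in>set [1..<r + 1]. 1 \<le> i \<and> i < n + 2" "\<forall>i\<in>set [2..<r + 2]. 1 \<le> i \<and> i < n + 2"
    using h by auto
  note Y = W_closed[OF v(1), of e] and X = W_closed[OF v(2), of "\<not> e"] and Z = CA_closed[OF refl, of n]
  show ?thesis
    unfolding ca_def A_lcomp[OF Z lcomp_closed[OF X Y]] A_lcomp[OF X Y] A_W[OF v(1)] A_W[OF v(2)] A_CA
    by (simp only: add.assoc add.commute[of k])
qed

lemma A_endofunctor: "endofunctor C (A k)"
proof (rule linear_category.endofunctorI[OF C_linear], goal_cases)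
  case 8 show ?case by (simp add: add_strands_def)
next
  case (4 a b c f g)
  then have f: "f \<in> PHom P a b" and g: "g \<in> PHom P b c" by simp_all
  show ?case by (simp only: C_ops(1)[OF g f] C_ops(1)[OF A_closed[OF g] A_closed[OF f]] A_lcomp[OF g f])
next
  case (5 a b f g)
  then have f: "f \<in> PHom P a b" and g: "g \<in> PHom P a b" by simp_all
  show ?case by (simp only: C_ops(3)[OF f g] C_ops(3)[OF A_closed[OF f] A_closed[OF g]] A_lplus[OF f g])
next
  case (6 a b f x)
  then have f: "f \<in> PHom P a b" by simp
  show ?case by (simp only: C_ops(2)[OF f] C_ops(2)[OF A_closed[OF f]] A_lscale[OF f])
qed (simp_all add: A_closed)

text \<open>The unit object of the endofunctor category is thus one of the A_k; together with
  \<open>A_comp\<close> this gives every word of OS the image \<open>A (length w)\<close>.\<close>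

lemma A_id: "id_fctr C = A 0"
proof (rule linear_category.fctr_eqI[OF C_linear linear_category.endofunctor_id[OF C_linear] A_endofunctor])
  fix f assume f: "f \<in> Mor C"
  with Mor_cases[OF f] show "FMor (id_fctr C) f = FMor (A 0) f"
    by (auto simp: linear_category.id_fctr_Mor'[OF C_linear] A_lcls del: equalityI)
qed (simp add: id_fctr_def)

lemma A_comp: "comp_fctr C (A j) (A k) = A (j + k)"
proof (rule linear_category.fctr_eqI[OF C_linear
      linear_category.endofunctor_comp[OF C_linear A_endofunctor A_endofunctor] A_endofunctor])
  fix f assume f: "f \<in> Mor C"
  with Mor_cases[OF f] show "FMor (comp_fctr C (A j) (A k)) f = FMor (A (j + k)) f"
    by (auto simp: linear_category.comp_fctr_Mor'[OF C_linear] A_lcls lwf_shift shift_shift del: equalityI)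
qed (simp add: comp_fctr_def)

section \<open>Naturality\<close>

lemma sc_zero: "X \<in> PHom P a b \<Longrightarrow> sc 0 X = lcls P (LZero a b)"
  by (auto simp: lcls_Scale[symmetric] intro!: lcls_eqI leq_Scale_zero del: equalityI)

lemma lZero_closed: "lcls P (LZero a b) \<in> PHom P a b"
  by (auto simp: lhom_def)

lemma comp_zero:
  assumes X: "X \<in> PHom P b c"
  shows "X \<diamondop> lcls P (LZero a b) = lcls P (LZero a c)"
proof -
  have "X \<diamondop> lcls P (LZero a b) = X \<diamondop> sc 0 (lcls P (LZero a b))"
    by (simp only: sc_zero[OF lZero_closed])
  also have "\<dots> = lcls P (LZero a c)"
    by (simp only: lcomp_lscale sc_zero[OF lcomp_closed[OF X lZero_closed]])
  finally show ?thesis .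
qed

lemma zero_comp:
  assumes X: "X \<in> PHom P a b"
  shows "lcls P (LZero b c) \<diamondop> X = lcls P (LZero a c)"
proof -
  have "lcls P (LZero b c) \<diamondop> X = sc 0 (lcls P (LZero b c)) \<diamondop> X"
    by (simp only: sc_zero[OF lZero_closed])
  also have "\<dots> = lcls P (LZero a c)"
    by (simp only: lscale_lcomp sc_zero[OF lcomp_closed[OF lZero_closed X]])
  finally show ?thesis .
qed

text \<open>Naturality squares paste along composites and are closed under linear combinations, so
  the squares at generators imply all others. The shifts k and l differ when \<eta> is to be a cup
  or a cap.\<close>

lemma naturality_from_generators:
  assumes \<eta>: "\<And>a. \<eta> a \<in> PHom P (a + k) (a + l)"
    and gens: "\<And>g. g \<in> ib_gens \<Longrightarrow>
      \<eta> (ib_tgt g) \<diamondop> lcls P (shift k (LGen g)) = lcls P (shift l (LGen g)) \<diamondop> \<eta> (ib_src g)"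
  shows "lwf P u \<Longrightarrow> \<eta> (ltgt P u) \<diamondop> lcls P (shift k u) = lcls P (shift l u) \<diamondop> \<eta> (lsrc P u)"
proof (induction u)
  case (LId a)
  show ?case using lcomp_lId[OF \<eta>] lId_lcomp[OF \<eta>] by simp
next
  case (LGen g)
  then show ?case using gens by simp
next
  case (LComp u v)
  then have "\<eta> (ltgt P u) \<diamondop> lcls P (shift k (u \<cdot> v))
      = (lcls P (shift l u) \<diamondop> \<eta> (lsrc P u)) \<diamondop> lcls P (shift k v)"
    by (simp add: lcls_Comp lcomp_assoc[symmetric])
  also have "\<dots> = lcls P (shift l u) \<diamondop> lcls P (shift l v) \<diamondop> \<eta> (lsrc P v)"
    using LComp by (simp add: lcomp_assoc)
  finally show ?case by (simp add: lcls_Comp lcomp_assoc)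
next
  case (LZero a b)
  show ?case by (simp add: comp_zero[OF \<eta>] zero_comp[OF \<eta>])
next
  case (LPlus u v)
  have c: "lcls P (shift k' w) \<in> PHom P (lsrc P w + k') (ltgt P w + k')" if "lwf P w" for k' w
    by (rule imageI) (rule lhom_shift, use that in \<open>simp add: lhom_def\<close>)
  from LPlus have w: "lwf P u" "lwf P v" "lsrc P v = lsrc P u" "ltgt P v = ltgt P u" by simp_all
  note cu' = c[OF w(1)] and cv = c[OF w(2), unfolded w(3,4)]
  show ?case
    using LPlus.IH(1)[OF w(1)] LPlus.IH(2)[OF w(2)]
    by (simp add: lcls_Plus lcomp_lplus[OF \<eta> cu' cv] lplus_lcomp[OF cu' cv \<eta>] w(3,4))
next
  case (LScale x u)
  then show ?case by (simp add: lcls_Scale lcomp_lscale lscale_lcomp)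
qed

lemma nattrans_closed:
  assumes \<eta>: "\<And>a. \<eta> a \<in> PHom P (a + k) (a + l)"
    and Cu: "\<And>n. \<eta> (n + 2) \<diamondop> CU (n + k) = CU (n + l) \<diamondop> \<eta> n"
    and Ca: "\<And>n. \<eta> n \<diamondop> CA (n + k) = CA (n + l) \<diamondop> \<eta> (n + 2)"
    and Si: "\<And>n e i. 1 \<le> i \<Longrightarrow> i < n \<Longrightarrow> \<eta> n \<diamondop> S (n + k) e i = S (n + l) e i \<diamondop> \<eta> n"
  shows "\<lparr>NSrc = A k, NTgt = A l, At = \<eta>\<rparr> \<in> Hom (End_cat C) (A k) (A l)"
proof -
  have gens: "\<eta> (ib_tgt g) \<diamondop> lcls P (shift k (LGen g)) = lcls P (shift l (LGen g)) \<diamondop> \<eta> (ib_src g)"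
    if "g \<in> ib_gens" for g
  proof (cases g)
    case (Cup r)
    then show ?thesis using Cu[of r] by (simp add: CU_def)
  next
    case (Cap r)
    then show ?thesis using Ca[of r] by (simp add: CA_def)
  next
    case (Sig n i)
    then show ?thesis using Si[of i n True] that by (simp add: S_def)
  next
    case (SigInv n i)
    then show ?thesis using Si[of i n False] that by (simp add: S_def)
  qed
  show ?thesis
  proof (rule linear_category.End_HomI[OF C_linear])
    fix a b f assume "f \<in> Hom C a b"
    then obtain u where u: "f = lcls P u" "lwf P u" "lsrc P u = a" "ltgt P u = b"
      by (auto simp: lhom_def)
    then have f: "f \<in> PHom P a b" by (auto simp: lhom_def)
    show "At \<lparr>NSrc = A k, NTgt = A l, At = \<eta>\<rparr> b \<odot>\<^bsub>C\<^esub> FMor (A k) f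
        = FMor (A l) f \<odot>\<^bsub>C\<^esub> At \<lparr>NSrc = A k, NTgt = A l, At = \<eta>\<rparr> a"
      using naturality_from_generators[OF \<eta> gens u(2)]
      by (simp add: C_ops(1)[OF \<eta> A_closed[OF f]] C_ops(1)[OF A_closed[OF f] \<eta>])
        (simp add: u A_lcls)
  qed (simp_all add: \<eta>)
qed

section \<open>The natural transformations assigned to the generators\<close>

text \<open>The scalar of \<open>CapUD\<close> is the inverse of the value q^-1 t of the unscaled
  zigzags; \<open>CupUD\<close> carries the opposite scalar, so that the circle d c' keeps the value
  \<delta>.\<close>

primrec gen_at :: "os_gen \<Rightarrow> nat \<Rightarrow> 'k ib_term set" where
  "gen_at Xpos = (\<lambda>r. S (r + 2) True (r + 1))"
| "gen_at Xneg = (\<lambda>r. S (r + 2) False (r + 1))"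
| "gen_at CupDU = (\<lambda>r. cu True r r)"
| "gen_at CupUD = (\<lambda>r. sc (unit_inv q * t) (cu False r r))"
| "gen_at CapDU = (\<lambda>r. ca True r r)"
| "gen_at CapUD = (\<lambda>r. sc (q * unit_inv t) (ca False r r))"

definition gen_nat :: "os_gen \<Rightarrow> (nat, 'k ib_term set) nattrans" where
  "gen_nat g = \<lparr>NSrc = A (length (os_src g)), NTgt = A (length (os_tgt g)), At = gen_at g\<rparr>"

lemma gen_at_crossing_closed:
  "\<lparr>NSrc = A 2, NTgt = A 2, At = \<lambda>r. S (r + 2) e (r + 1)\<rparr> \<in> Hom (End_cat C) (A 2) (A 2)"
proof (rule nattrans_closed)
  show "S (a + 2) e (a + 1) \<in> PHom P (a + 2) (a + 2)" for a by (rule S_closed) simp_all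
  show "S (n + 2 + 2) e (n + 2 + 1) \<diamondop> CU (n + 2) = CU (n + 2) \<diamondop> S (n + 2) e (n + 1)" for n
    by (rule CU_S) simp_all
  show "S (n + 2) e (n + 1) \<diamondop> CA (n + 2) = CA (n + 2) \<diamondop> S (n + 2 + 2) e (n + 2 + 1)" for n
    by (rule CA_S[symmetric]) simp_all
  show "S (n + 2) e (n + 1) \<diamondop> S (n + 2) e' i = S (n + 2) e' i \<diamondop> S (n + 2) e (n + 1)"
    if "1 \<le> i" "i < n" for n e' i by (rule S_commute) (use that in simp)
qed

text \<open>With a general scalar and sign this covers A(c), for x = 1, and A(c'), for x = q^-1
  t.\<close>

lemma gen_at_cup_closed:
  "\<lparr>NSrc = A 0, NTgt = A 2, At = \<lambda>r. sc x (cu e r r)\<rparr> \<in> Hom (End_cat C) (A 0) (A 2)"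
proof (rule nattrans_closed)
  show "sc x (cu e a a) \<in> PHom P (a + 0) (a + 2)" for a
    unfolding add_0_right by (intro lscale_closed cu_closed) simp_all
  show "sc x (cu e (n + 2) (n + 2)) \<diamondop> CU (n + 0) = CU (n + 2) \<diamondop> sc x (cu e n n)" for n
    by (simp only: assocs cu_CU[OF refl] add_0_right)
  show "sc x (cu e n n) \<diamondop> CA (n + 0) = CA (n + 2) \<diamondop> sc x (cu e (n + 2) (n + 2))" for n
    by (simp only: assocs cu_CA[OF refl] add_0_right)
  show "sc x (cu e n n) \<diamondop> S (n + 0) e' i = S (n + 2) e' i \<diamondop> sc x (cu e n n)"
    if "1 \<le> i" "i < n" for n e' i by (simp only: assocs cu_S[OF refl that] add_0_right)
qed

lemma gen_at_cap_closed:
  "\<lparr>NSrc = A 2, NTgt = A 0, At = \<lambda>r. sc x (ca e r r)\<rparr> \<in> Hom (End_cat C) (A 2) (A 0)"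
proof (rule nattrans_closed)
  show "sc x (ca e a a) \<in> PHom P (a + 2) (a + 0)" for a
    unfolding add_0_right by (intro lscale_closed ca_closed) simp_all
  show "sc x (ca e (n + 2) (n + 2)) \<diamondop> CU (n + 2) = CU (n + 0) \<diamondop> sc x (ca e n n)" for n
    by (simp only: assocs ca_CU[OF refl] add_0_right)
  show "sc x (ca e n n) \<diamondop> CA (n + 2) = CA (n + 0) \<diamondop> sc x (ca e (n + 2) (n + 2))" for n
    by (simp only: assocs ca_CA[OF refl] add_0_right)
  show "sc x (ca e n n) \<diamondop> S (n + 2) e' i = S (n + 0) e' i \<diamondop> sc x (ca e n n)"
    if "1 \<le> i" "i < n" for n e' i by (simp only: assocs ca_S[OF refl that] add_0_right)
qed

lemma gen_nat_closed:
  "gen_nat g \<in> Hom (End_cat C) (A (length (os_src g))) (A (length (os_tgt g)))"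
proof -
  have one: "sc 1 (cu e r r) = cu e r r" "sc 1 (ca e r r) = ca e r r" for e r
    by (rule lscale_one[OF cu_closed[OF order.refl refl]], rule lscale_one[OF ca_closed[OF order.refl refl]])
  show ?thesis
    using gen_at_crossing_closed[of True] gen_at_crossing_closed[of False]
      gen_at_cup_closed[of 1 True] gen_at_cup_closed[of "unit_inv q * t" False]
      gen_at_cap_closed[of 1 True] gen_at_cap_closed[of "q * unit_inv t" False]
    unfolding one by (cases g) (simp_all add: gen_nat_def numeral_2_eq_2)
qed

section \<open>The relations of the oriented skein category\<close>

abbreviation RE :: "((nat, 'k ib_term set, nat, 'k ib_term set) fctr, (nat, 'k ib_term set) nattrans, 'k) moncat"
  where "RE \<equiv> rev_tensor (End_cat C)"

abbreviation OP :: "(arrow, os_gen, 'k) mpresentation" where "OP \<equiv> os_pres q t \<delta>"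

section \<open>Components of the image of a term of OS\<close>

definition ev :: "'k os_term \<Rightarrow> (nat, 'k ib_term set) nattrans" where
  "ev = mev RE (\<lambda>_. A (Suc 0)) gen_nat"

lemma RE_sel: "Obj RE = Obj (End_cat C)" "Hom RE = Hom (End_cat C)" "Idm RE = Idm (End_cat C)"
  "Comp RE = Comp (End_cat C)" "Zerom RE = Zerom (End_cat C)" "Plus RE = Plus (End_cat C)"
  "Scale RE = Scale (End_cat C)" "Unit RE = id_fctr C"
  "TObj RE = (\<lambda>a b. comp_fctr C b a)" "TMor RE = (\<lambda>f g. TMor (End_cat C) g f)"
  by (simp_all add: rev_tensor_def linear_category.End_sel[OF C_linear])

lemma OP_simps [simp]: "Gens OP = UNIV" "GSrc OP = os_src" "GTgt OP = os_tgt" "Rels OP = os_rel q t \<delta>"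
  by (simp_all add: os_pres_def)

lemma objects: "tensor_objects RE (\<lambda>_. A (Suc 0)) w = A (length w)"
  by (induction w) (simp_all add: RE_sel A_id A_comp)

lemma assignment: "moncat_assignment OP RE (\<lambda>_. A (Suc 0)) gen_nat"
proof (intro moncat_assignment.intro moncat_assignment_axioms.intro)
  show "strict_monoidal_category RE"
    by (intro strict_monoidal_category_rev_tensor linear_category.strict_monoidal_category_End C_linear)
  show "A (Suc 0) \<in> Obj RE"
    by (simp add: RE_sel linear_category.End_sel[OF C_linear] A_endofunctor)
  show "gen_nat g \<in> Hom RE (tensor_objects RE (\<lambda>_. A (Suc 0)) (GSrc OP g)) (tensor_objects RE (\<lambda>_. A (Suc 0)) (GTgt OP g))" for g
    using gen_nat_closed[of g] by (simp add: objects RE_sel)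
qed

lemma ev_closed: "mwf OP u \<Longrightarrow> ev u \<in> Hom (End_cat C) (A (length (msrc OP u))) (A (length (mtgt OP u)))"
  using moncat_assignment.mev_closed[OF assignment, of u] by (simp add: objects RE_sel ev_def)

lemma ev_at_closed: "mwf OP u \<Longrightarrow> At (ev u) r \<in> PHom P (r + length (msrc OP u)) (r + length (mtgt OP u))"
  using linear_category.End_HomD(4)[OF C_linear ev_closed[of u], of r] by simp

lemma ev_sel: "mwf OP u \<Longrightarrow> NSrc (ev u) = A (length (msrc OP u))" "mwf OP u \<Longrightarrow> NTgt (ev u) = A (length (mtgt OP u))"
  using linear_category.End_HomD(1,2)[OF C_linear ev_closed[of u]] by simp_all

lemma At_Id: "At (ev (MId w)) r = E (r + length w)"
  by (simp add: ev_def RE_sel linear_category.End_At[OF C_linear] objects)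

lemma At_Gen: "At (ev (MGen g)) r = gen_at g r"
  by (simp add: ev_def gen_nat_def)

lemma At_Comp: "mwf OP (u \<bullet> v) \<Longrightarrow> At (ev (u \<bullet> v)) r = At (ev u) r \<diamondop> At (ev v) r"
  using ev_at_closed[of u r] ev_at_closed[of v r]
  by (simp add: ev_def RE_sel linear_category.End_At[OF C_linear] C_ops(1))

text \<open>Since the tensor product is reversed, \<open>u\<close> acts first and on the left
  strands. Identity strands on the left of a morphism move its base point r, and those on the right
  add strands to its component.\<close>

lemma At_Tens:
  assumes "mwf OP (u \<otimes>\<^sub>m v)"
  shows "At (ev (u \<otimes>\<^sub>m v)) r
    = At (ev v) (r + length (mtgt OP u)) \<diamondop> FMor (A (length (msrc OP v))) (At (ev u) r)"
proof -
  from assms have u: "mwf OP u" and v: "mwf OP v" by simp_all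
  note 1 = ev_at_closed[OF v, of "r + length (mtgt OP u)"]
    and 2 = A_closed[OF ev_at_closed[OF u, of r], of "length (msrc OP v)"]
  show ?thesis
    using C_ops(1)[OF 1 2] ev_sel(2)[OF u] ev_sel(1)[OF v]
    by (simp add: ev_def RE_sel linear_category.End_At[OF C_linear])
qed

lemma At_Plus: "mwf OP (MPlus u v) \<Longrightarrow> At (ev (MPlus u v)) r = lplus P (At (ev u) r) (At (ev v) r)"
  using ev_at_closed[of u r] ev_at_closed[of v r]
  by (simp add: ev_def RE_sel linear_category.End_At[OF C_linear] C_ops(3))

lemma At_Scale: "mwf OP u \<Longrightarrow> At (ev (MScale x u)) r = sc x (At (ev u) r)"
  using ev_at_closed[of u r]
  by (simp add: ev_def RE_sel linear_category.End_At[OF C_linear] C_ops(2))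

lemmas At_simps = At_Id At_Gen At_Comp At_Tens At_Plus At_Scale

lemma cu_units: "m = n + 2 \<Longrightarrow> r \<le> n \<Longrightarrow> E m \<diamondop> cu e r n = cu e r n" "r \<le> n \<Longrightarrow> cu e r n \<diamondop> E n = cu e r n"
  unfolding E_def by (rule lId_lcomp[OF cu_closed], assumption+, rule lcomp_lId[OF cu_closed], assumption, rule refl)

lemma ca_units: "r \<le> n \<Longrightarrow> E n \<diamondop> ca e r n = ca e r n" "m = n + 2 \<Longrightarrow> r \<le> n \<Longrightarrow> ca e r n \<diamondop> E m = ca e r n"
  unfolding E_def by (rule lId_lcomp[OF ca_closed], assumption, rule refl, rule lcomp_lId[OF ca_closed], assumption+)

lemmas units = cu_units ca_units cu_units[THEN ext2] ca_units[THEN ext2]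

lemma A_sc_cu: "r \<le> n \<Longrightarrow> FMor (A k) (sc x (cu e r n)) = sc x (cu e r (n + k))"
  by (simp add: A_lscale[OF cu_closed[OF _ refl]] A_cu)

lemma A_sc_ca: "r \<le> n \<Longrightarrow> FMor (A k) (sc x (ca e r n)) = sc x (ca e r (n + k))"
  by (simp add: A_lscale[OF ca_closed[OF _ refl]] A_ca)

lemmas A_gens = A_S A_cu A_ca A_sc_cu A_sc_ca

lemmas At_calc = At_simps A_gens units assocs

lemma qt_cancel: "q * unit_inv t * (unit_inv q * t) = 1" "unit_inv q * t * (q * unit_inv t) = 1"
proof -
  have "q * unit_inv t * (unit_inv q * t) = (q * unit_inv q) * (t * unit_inv t)"
    by (simp only: mult.assoc mult.commute mult.left_commute)
  also have "\<dots> = 1" by (simp only: q_inv t_inv mult_1)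
  finally show "q * unit_inv t * (unit_inv q * t) = 1" .
  then show "unit_inv q * t * (q * unit_inv t) = 1" by (simp only: mult.commute)
qed

text \<open>Both arrows go to the same functor, and the rotated crossing is again the crossing.
  Together with \<open>At_Lneg\<close>, this reduces the relations between R_+ and L_- to the
  invertibility of a crossing of B.\<close>

lemma At_Rpos: "At (ev Rpos) r = S (r + 2) True (r + 1)"
proof -
  have "At (ev Rpos) r = sc (q * unit_inv t)
      (ca False (r + 2) (r + 2) \<diamondop> S (r + 4) True (r + 2) \<diamondop> cu True r (r + 2))"
    by (simp add: Rpos_def At_calc eval_nat_numeral)
  also have "\<dots> = sc 1 (S (r + 2) True (r + 1))"
    by (simp only: rotate_right[OF refl refl] lscale_lscale qt_cancel)
  also have "\<dots> = S (r + 2) True (r + 1)"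
    by (rule lscale_one[OF S_closed]) simp_all
  finally show ?thesis .
qed

lemma At_Lneg: "At (ev Lneg) r = S (r + 2) False (r + 1)"
proof -
  have "At (ev Lneg) r = sc (unit_inv q * t)
      (ca True r (r + 2) \<diamondop> S (r + 4) False (r + 2) \<diamondop> cu False (r + 2) (r + 2))"
    by (simp add: Lneg_def At_calc eval_nat_numeral)
  also have "\<dots> = sc 1 (S (r + 2) False (r + 1))"
    by (simp only: rotate_left[OF refl refl] lscale_lscale qt_cancel)
  also have "\<dots> = S (r + 2) False (r + 1)"
    by (rule lscale_one[OF S_closed]) simp_all
  finally show ?thesis .
qed

lemma Rpos_typed [simp]: "mwf OP Rpos" "msrc OP Rpos = [\<up>, \<down>]" "mtgt OP Rpos = [\<down>, \<up>]"
  and Lneg_typed [simp]: "mwf OP Lneg" "msrc OP Lneg = [\<down>, \<up>]" "mtgt OP Lneg = [\<up>, \<down>]"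
  by (simp_all add: Rpos_def Lneg_def)

lemma sc_one_E: "sc 1 (E n) = E n"
  by (rule lscale_one[OF E_closed])

lemma At_rel:
  assumes "os_rel q t \<delta> u v"
  shows "At (ev u) r = At (ev v) r"
  using assms
proof cases
  case 1
  then show ?thesis by (simp add: At_calc S_inverse)
next
  case 2
  then show ?thesis by (simp add: At_calc S_inverse)
next
  case 3
  \<comment> \<open>At the object r, a crossing with a strand on its right has index r + 1, and with
    a strand on its left index r + 2; both live on r + 3 strands.\<close>
  then show ?thesis using S_braid(2)[of "Suc r" "Suc (Suc (Suc r))" True True]
    by (simp add: At_calc)
next
  case 4
  then show ?thesis by (simp add: At_Comp At_Id At_Rpos At_Lneg S_inverse)
next
  case 5
  then show ?thesis by (simp add: At_Comp At_Id At_Rpos At_Lneg S_inverse)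
next
  case 6
  have i: "1 \<le> r + 1" "r + 1 < r + 2" by simp_all
  note St = S_closed[OF i, of True] and Sf = S_closed[OF i, of False]
  have "lplus P (S (r + 2) True (r + 1)) (sc (- 1) (S (r + 2) False (r + 1)))
      = lplus P (lplus P (sc z (E (r + 2))) (S (r + 2) False (r + 1))) (sc (- 1) (S (r + 2) False (r + 1)))"
    by (simp only: skein[OF i] lplus_commute[OF Sf lscale_closed[OF E_closed]])
  also have "\<dots> = sc z (E (r + 2))" by (rule lplus_neg(1)[OF lscale_closed[OF E_closed] Sf])
  finally show ?thesis using 6 by (simp add: At_simps)
next
  case 7
  then have "At (ev u) r = ca True r (r + 1) \<diamondop> S (r + 3) True (r + 2) \<diamondop> cu True r (r + 1)"
    by (simp add: At_calc eval_nat_numeral)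
  also have "\<dots> = sc t (E (r + 1))" by (rule twist_right[OF refl refl])
  finally show ?thesis using 7 by (simp add: At_simps)
next
  case 8
  then have "At (ev u) r = sc (unit_inv q * t * (q * unit_inv t))
      (ca False (r + 1) (r + 1) \<diamondop> S (r + 3) True (r + 1) \<diamondop> cu False (r + 1) (r + 1))"
    by (simp add: At_calc eval_nat_numeral)
  also have "\<dots> = sc t (E (r + 1))"
    by (simp only: twist_left[OF refl refl] qt_cancel lscale_lscale mult_1)
  finally show ?thesis using 8 by (simp add: At_simps)
next
  case 9
  then have "At (ev u) r = sc (unit_inv q * t * (q * unit_inv t)) (ca False r r \<diamondop> cu False r r)"
    by (simp add: At_calc)
  also have "\<dots> = sc \<delta> (E r)"
    by (simp only: ca_cu[OF order.refl] qt_cancel lscale_lscale mult_1)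
  finally show ?thesis using 9 by (simp add: At_simps)
next
  case 10
  then have "At (ev u) r = sc (q * unit_inv t) (ca False r (r + 1) \<diamondop> cu True (r + 1) (r + 1))"
    by (simp add: At_calc)
  also have "\<dots> = E (r + 1)"
    by (simp only: zigzag_up[OF refl] qt_cancel lscale_lscale sc_one_E)
  finally show ?thesis using 10 by (simp add: At_simps)
next
  case 11
  then have "At (ev u) r = sc (q * unit_inv t) (ca False (r + 1) (r + 1) \<diamondop> cu True r (r + 1))"
    by (simp add: At_calc)
  also have "\<dots> = E (r + 1)"
    by (simp only: zigzag_down[OF refl] qt_cancel lscale_lscale sc_one_E)
  finally show ?thesis using 11 by (simp add: At_simps)
qed

lemma ev_rel:
  assumes "Rels OP u v" "u \<in> mhom OP a b" "v \<in> mhom OP a b"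
  shows "mev RE (\<lambda>_. A (Suc 0)) gen_nat u = mev RE (\<lambda>_. A (Suc 0)) gen_nat v"
proof -
  have "ev u \<in> Hom (End_cat C) (A (length a)) (A (length b))"
    "ev v \<in> Hom (End_cat C) (A (length a)) (A (length b))"
    using ev_closed[of u] ev_closed[of v] assms(2,3) by (simp_all add: mhom_def)
  then have "ev u = ev v"
    by (rule linear_category.End_eqI[OF C_linear]) (use assms(1) At_rel in simp)
  then show ?thesis by (simp add: ev_def)
qed

definition skein_functor ::
    "(arrow list, 'k os_term set, (nat, 'k ib_term set, nat, 'k ib_term set) fctr,
      (nat, 'k ib_term set) nattrans) fctr" where
  "skein_functor = mfunctor OP RE (\<lambda>_. A (Suc 0)) gen_nat"

lemma strict_monoidal_functor_skein: "strict_monoidal_functor (OS q t \<delta>) RE skein_functor"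
  unfolding OS_def skein_functor_def
  by (rule moncat_assignment.strict_monoidal_functor_mfunctor[OF assignment ev_rel])

lemma skein_functor_Obj: "FObj skein_functor w = A (length w)"
  by (simp add: skein_functor_def mfunctor_def objects)

lemma skein_functor_gen: "FMor skein_functor (os_mor q t \<delta> g) = gen_nat g"
  unfolding skein_functor_def os_mor_def
  by (subst moncat_assignment.FMor_mfunctor[OF assignment ev_rel]) simp_all

section \<open>Comparison with the words in the statement\<close>

lemma ib_mor_eq: "ib_mor q t \<delta> (Cup n) = CU n" "ib_mor q t \<delta> (Cap n) = CA n"
  "ib_mor q t \<delta> (Sig n i) = S n True i" "ib_mor q t \<delta> (SigInv n i) = S n False i"
  by (simp_all add: ib_mor_def CU_def CA_def S_def)

text \<open>The words of the statement are folded with the composition of the category,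
  \<open>W\<close> with the total one; the two agree on typed morphisms, which is why the letters
  must be in range.\<close>

lemma word_eq:
  assumes "\<forall>i\<in>set is. 1 \<le> i \<and> i < n"
  shows "pos_word q t \<delta> n is = W n True is" "neg_word q t \<delta> n is = W n False is"
proof -
  have "pos_word q t \<delta> n is = W n True is \<and> neg_word q t \<delta> n is = W n False is"
    using assms
  proof (induction "is")
    case (Cons i "is")
    then have c: "S n e i \<in> PHom P n n" "W n e is \<in> PHom P n n" for e
      by (auto intro: S_closed W_closed)
    from Cons show ?case
      by (simp add: pos_word_def neg_word_def ib_mor_eq C_ops(1)[OF c])
  qed (simp add: pos_word_def neg_word_def)
  then show "pos_word q t \<delta> n is = W n True is" "neg_word q t \<delta> n is = W n False is" by simp_all
qed

lemma upt_valid: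
  "\<forall>i\<in>set [1..<r + 1]. 1 \<le> i \<and> i < r + 2" "\<forall>i\<in>set [2..<r + 2]. 1 \<le> i \<and> i < r + 2"
  "\<forall>i\<in>set (rev [1..<r + 1]). 1 \<le> i \<and> i < r + 2" "\<forall>i\<in>set (rev [2..<r + 2]). 1 \<le> i \<and> i < r + 2"
  by auto

lemma cu_words:
  "neg_word q t \<delta> (r + 2) (rev [1..<r + 1]) \<odot>\<^bsub>C\<^esub> pos_word q t \<delta> (r + 2) (rev [2..<r + 2])
    \<odot>\<^bsub>C\<^esub> ib_mor q t \<delta> (Cup r) = cu True r r"
  "pos_word q t \<delta> (r + 2) (rev [1..<r + 1]) \<odot>\<^bsub>C\<^esub> neg_word q t \<delta> (r + 2) (rev [2..<r + 2])
    \<odot>\<^bsub>C\<^esub> ib_mor q t \<delta> (Cup r) = cu False r r"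
proof -
  note X = W_closed[OF upt_valid(3)] and Y = W_closed[OF upt_valid(4)] and Z = CU_closed[OF refl, of r]
  show "neg_word q t \<delta> (r + 2) (rev [1..<r + 1]) \<odot>\<^bsub>C\<^esub> pos_word q t \<delta> (r + 2) (rev [2..<r + 2])
    \<odot>\<^bsub>C\<^esub> ib_mor q t \<delta> (Cup r) = cu True r r"
    "pos_word q t \<delta> (r + 2) (rev [1..<r + 1]) \<odot>\<^bsub>C\<^esub> neg_word q t \<delta> (r + 2) (rev [2..<r + 2])
    \<odot>\<^bsub>C\<^esub> ib_mor q t \<delta> (Cup r) = cu False r r"
    by (simp_all only: word_eq[OF upt_valid(3)] word_eq[OF upt_valid(4)] ib_mor_eq cu_def
        C_ops(1)[OF Y Z] C_ops(1)[OF X lcomp_closed[OF Y Z]] not_True_eq_False not_False_eq_True)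
qed

lemma ca_words:
  "ib_mor q t \<delta> (Cap r) \<odot>\<^bsub>C\<^esub> neg_word q t \<delta> (r + 2) [2..<r + 2]
    \<odot>\<^bsub>C\<^esub> pos_word q t \<delta> (r + 2) [1..<r + 1] = ca True r r"
  "ib_mor q t \<delta> (Cap r) \<odot>\<^bsub>C\<^esub> pos_word q t \<delta> (r + 2) [2..<r + 2]
    \<odot>\<^bsub>C\<^esub> neg_word q t \<delta> (r + 2) [1..<r + 1] = ca False r r"
proof -
  note Y = W_closed[OF upt_valid(1)] and X = W_closed[OF upt_valid(2)] and Z = CA_closed[OF refl, of r]
  show "ib_mor q t \<delta> (Cap r) \<odot>\<^bsub>C\<^esub> neg_word q t \<delta> (r + 2) [2..<r + 2]
    \<odot>\<^bsub>C\<^esub> pos_word q t \<delta> (r + 2) [1..<r + 1] = ca True r r"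
    "ib_mor q t \<delta> (Cap r) \<odot>\<^bsub>C\<^esub> pos_word q t \<delta> (r + 2) [2..<r + 2]
    \<odot>\<^bsub>C\<^esub> neg_word q t \<delta> (r + 2) [1..<r + 1] = ca False r r"
    by (simp_all only: word_eq[OF upt_valid(1)] word_eq[OF upt_valid(2)] ib_mor_eq ca_def
        C_ops(1)[OF X Y] C_ops(1)[OF Z lcomp_closed[OF X Y]] not_True_eq_False not_False_eq_True)
qed

end

theorem theorem3p3:
  fixes q t \<delta> :: "'k::{comm_ring, comm_monoid_mult}"
  assumes "q dvd 1" and "t dvd 1" and "\<delta> * (q - unit_inv q) = t - unit_inv t"
  shows "\<exists>A. strict_monoidal_functor (OS q t \<delta>) (rev_tensor (End_cat (IB q t \<delta>))) A \<and>
    FObj A [\<up>] = add_strands q t \<delta> 1 \<and>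
    FObj A [\<down>] = add_strands q t \<delta> 1 \<and>
    FMor A (os_mor q t \<delta> Xpos) =
      \<lparr>NSrc = add_strands q t \<delta> 2, NTgt = add_strands q t \<delta> 2,
       At = (\<lambda>r. ib_mor q t \<delta> (Sig (r + 2) (r + 1)))\<rparr> \<and>
    FMor A (os_mor q t \<delta> Xneg) =
      \<lparr>NSrc = add_strands q t \<delta> 2, NTgt = add_strands q t \<delta> 2,
       At = (\<lambda>r. ib_mor q t \<delta> (SigInv (r + 2) (r + 1)))\<rparr> \<and>
    FMor A (os_mor q t \<delta> CupDU) =
      \<lparr>NSrc = id_fctr (IB q t \<delta>), NTgt = add_strands q t \<delta> 2,
       At = (\<lambda>r. neg_word q t \<delta> (r + 2) (rev [1..<r + 1]) \<odot>\<^bsub>IB q t \<delta>\<^esub>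
                 pos_word q t \<delta> (r + 2) (rev [2..<r + 2]) \<odot>\<^bsub>IB q t \<delta>\<^esub>
                 ib_mor q t \<delta> (Cup r))\<rparr> \<and>
    FMor A (os_mor q t \<delta> CupUD) =
      \<lparr>NSrc = id_fctr (IB q t \<delta>), NTgt = add_strands q t \<delta> 2,
       At = (\<lambda>r. (unit_inv q * t) \<star>\<^bsub>IB q t \<delta>\<^esub>
                (pos_word q t \<delta> (r + 2) (rev [1..<r + 1]) \<odot>\<^bsub>IB q t \<delta>\<^esub>
                 neg_word q t \<delta> (r + 2) (rev [2..<r + 2]) \<odot>\<^bsub>IB q t \<delta>\<^esub>
                 ib_mor q t \<delta> (Cup r)))\<rparr> \<and>
    FMor A (os_mor q t \<delta> CapDU) =
      \<lparr>NSrc = add_strands q t \<delta> 2, NTgt = id_fctr (IB q t \<delta>),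
       At = (\<lambda>r. ib_mor q t \<delta> (Cap r) \<odot>\<^bsub>IB q t \<delta>\<^esub>
                 neg_word q t \<delta> (r + 2) [2..<r + 2] \<odot>\<^bsub>IB q t \<delta>\<^esub>
                 pos_word q t \<delta> (r + 2) [1..<r + 1])\<rparr> \<and>
    FMor A (os_mor q t \<delta> CapUD) =
      \<lparr>NSrc = add_strands q t \<delta> 2, NTgt = id_fctr (IB q t \<delta>),
       At = (\<lambda>r. (q * unit_inv t) \<star>\<^bsub>IB q t \<delta>\<^esub>
                (ib_mor q t \<delta> (Cap r) \<odot>\<^bsub>IB q t \<delta>\<^esub>
                 pos_word q t \<delta> (r + 2) [2..<r + 2] \<odot>\<^bsub>IB q t \<delta>\<^esub>
                 neg_word q t \<delta> (r + 2) [1..<r + 1]))\<rparr>"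
proof -
  interpret B: iquantum_brauer q t \<delta> by unfold_locales (fact assms)+
  show ?thesis
    \<comment> \<open>The word identities come first: they match \<open>ib_mor\<close>, which the
      next unfolding removes.\<close>
    unfolding B.cu_words B.ca_words
    unfolding B.ib_mor_eq B.A_id
      B.C_ops(2)[OF B.cu_closed[OF order.refl refl]] B.C_ops(2)[OF B.ca_closed[OF order.refl refl]]
    by (rule exI[of _ B.skein_functor])
      (simp add: B.strict_monoidal_functor_skein B.skein_functor_Obj B.skein_functor_gen
        B.gen_nat_def numeral_2_eq_2)
qed

end
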